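(* Consider the model $Y_{i,j}=\mu(x_{i,j})+s(x_{i,j})e_{i,j}$, $1\le j\le m_i$, $1\le i\le n$, with $N_n=m_1+\cdots+m_n$, $M_n=\max_{1\le i\le n}m_i$, the errors $e_{i,j}$, kernel $K$, and conditions (D), (X), (K), (S), (C) as described in the context, and let $$\hat\mu(x)=\operatorname{argmin}_{\theta}\sum_{i=1}^n\sum_{j=1}^{m_i}|Y_{i,j}-\theta|\,K_{b_n}(x_{i,j}-x),\qquad K_{b_n}(u)=K(u/b_n).$$ Assume that (D), (X), (K), (S) and (C) hold, that $b_n\to0$ and $(\log N_n)^3/(N_nb_n)\to0$, and further that $(\log N_n)^9/(N_nb_n)+N_nb_n^9\to0$, $nM_n=O(N_n)$, $nb_n\to\infty$, and $\log N_n=O(\sqrt{M_n})$. Then for any $x\in\mathcal S_\epsilon([a,b])=[a+\epsilon,b-\epsilon]$ ($\epsilon>0$ an arbitrary fixed small number), $$(N_nb_n)^{1/2}\left[\hat\mu(x)-\mu(x)-\psi_K\rho_\mu(x)b_n^2\right]\Rightarrow N\left(0,\frac{\varphi_K(b-a)s^2(x)}{4f_e^2(0)}\right),$$ where $$\rho_\mu(x)=\mu''(x)-\left[\frac{\mu'(x)f_e'(0)}{f_e(0)}+2s'(x)\right]\frac{\mu'(x)}{s(x)}.$$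
   Context: Asymptotics: all limits are taken along a sequence of designs $(n;m_1,\dots,m_n;x_{i,j})$, indexed by $n$, with $N_n=m_1+\cdots+m_n\to\infty$; the $m_i$ and the nonrandom points $x_{i,j}$ may change along the sequence. $\|Z\|_q=[\mathbb E|Z|^q]^{1/q}$, $\Rightarrow$ is convergence in distribution, and the argmin denotes any minimizer. Errors: $\varepsilon_{i,j}$ ($i,j\in\mathbb Z$) are i.i.d. random variables, $G$ is a measurable function, and $e_{i,j}=G(\varepsilon_{i,j},\varepsilon_{i,j\pm1},\varepsilon_{i,j\pm2},\ldots)$ (a function of the whole two-sided sequence centred at $j$). Thus for each $i$, $\{e_{i,j}\}_j$ is an independent copy of the stationary process $e_j=G(\varepsilon_j,\varepsilon_{j\pm1},\varepsilon_{j\pm2},\ldots)$ with i.i.d. $\varepsilon_j$. $F_e$ and $f_e=F_e'$ are the distribution and density functions of $e_0$. For identifiability, $e_0$ has median $0$ and $|e_0|$ has median $1$, i.e. $F_e(0)=1/2$ and $F_e(1)-F_e(-1)=1/2$. (D) There are constants $q>0$, $\rho\in(0,1)$ with $\|e_0-e_0(k)\|_q=O(\rho^k)$ (as a function of $k\in\mathbb N$), where $e_0(k)=G(\varepsilon_0,\varepsilon_{\pm1},\ldots,\varepsilon_{\pm k},\varepsilon'_{\pm(k+1)},\varepsilon'_{\pm(k+2)},\ldots)$ and $\{\varepsilon'_j\}$ is an i.i.d. copy of $\{\varepsilon_j\}$. (X) All $x_{i,j}$ lie in $[a,b]$ and, ordered as $a=\tilde x_0<\tilde x_1<\cdots<\tilde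 x_{N_n}<\tilde x_{N_n+1}=b$, satisfy $\max_{0\le k\le N_n}|\tilde x_{k+1}-\tilde x_k-(b-a)/N_n|=O(N_n^{-2})$. (K) $K\ge0$, $\int_{\mathbb R}K(u)\,du=1$, and $K$ is symmetric with bounded support and bounded derivative. Write $\varphi_K=\int K^2(u)\,du$ and $\psi_K=\frac12\int u^2K(u)\,du$. (S) $\mu,s\in\mathcal C^4([a,b])$, $\inf_{x\in[a,b]}s(x)>0$, $f_e\in\mathcal C^4(\mathbb R)$, $f_e(0)>0$, $f_e(1)+f_e(-1)>0$, where $\mathcal C^r(S)$ is the set of functions with bounded derivatives up to order $r$ on $S$ (including order $0$). (C) For every given $x\in\mathcal S_\epsilon([a,b])$ and every sequence of positive integers $k_n=O(\log N_n)$ there exists $\iota_n$ with $k_n\iota_n\to0$ such that $$\sum_{(i,j_1,j_2)\in\mathcal I}K_{b_n}(x_{i,j_1}-x)K_{b_n}(x_{i,j_2}-x)=O[\min(h,M_n)\,n\,b_n\,k_n\,\iota_n]$$ for all positive integers $\alpha$ and all $h\ge\max(k_n,\alpha)$, where $\mathcal I=\{(i,j_1,j_2):1\le i\le n,\ \alpha\le j_1<j_2\le\min(\alpha+h-1,m_i),\ |j_1-j_2|\le k_n\}$. Moreover $\max_j\sum_{i=1}^nK_{b_n}^r(x_{i,j}-x)=O(nb_n)$ for $r=2,4$ (the sum being over those $i$ with $m_i\ge j$). *)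

theory Defs
  imports "HOL-Probability.Probability" "HOL-Library.Landau_Symbols"
begin

text \<open>
  A sequence of designs is given by \<open>m n i\<close> (observations on subject \<open>i\<close>) and \<open>X n i j\<close>
  (design points) for \<open>1 \<le> i \<le> n\<close>, \<open>1 \<le> j \<le> m n i\<close>, both allowed to change with \<open>n\<close>;
  values outside these index ranges are irrelevant.  The bandwidth sequence is \<open>bw\<close>, while
  \<open>a\<close> and \<open>b\<close> are the end points of the design interval.  Limits and \<open>O\<close>-terms without
  explicit filter are along \<open>n \<rightarrow> \<infinity>\<close>.
\<close>

definition N_obs :: "(nat \<Rightarrow> nat \<Rightarrow> nat) \<Rightarrow> nat \<Rightarrow> nat" where
  "N_obs m n = (\<Sum>i=1..n. m n i)"

definition M_obs :: "(nat \<Rightarrow> nat \<Rightarrow> nat) \<Rightarrow> nat \<Rightarrow> nat" where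
  "M_obs m n = Max (m n ` {1..n})"

text \<open>Errors: \<open>G\<close> receives the two-sided innovation sequence recentred at \<open>j\<close>.\<close>

definition err ::
  "((int \<Rightarrow> real) \<Rightarrow> real) \<Rightarrow> (int \<Rightarrow> int \<Rightarrow> 'w \<Rightarrow> real) \<Rightarrow> int \<Rightarrow> int \<Rightarrow> 'w \<Rightarrow> real" where
  "err G \<epsilon> i j \<omega> = G (\<lambda>l. \<epsilon> i (j + l) \<omega>)"

text \<open>
  Row \<open>0\<close> is not observed (data use \<open>i \<ge> 1\<close>) and serves as the generic stationary process
  \<open>e\<^sub>j\<close>; thus \<open>err G \<epsilon> 0 0\<close> is \<open>e\<^sub>0\<close>, and the following is \<open>e\<^sub>0(k)\<close>.
\<close>

definition err_coupled ::
  "((int \<Rightarrow> real) \<Rightarrow> real) \<Rightarrow> (int \<Rightarrow> int \<Rightarrow> 'w \<Rightarrow> real) \<Rightarrow> (int \<Rightarrow> 'w \<Rightarrow> real) \<Rightarrow> nat \<Rightarrow> 'w \<Rightarrow> real" where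
  "err_coupled G \<epsilon> \<epsilon>' k \<omega> = G (\<lambda>l. if \<bar>l\<bar> \<le> int k then \<epsilon> 0 l \<omega> else \<epsilon>' l \<omega>)"

definition iid_innovations ::
  "'w measure \<Rightarrow> (int \<Rightarrow> int \<Rightarrow> 'w \<Rightarrow> real) \<Rightarrow> (int \<Rightarrow> 'w \<Rightarrow> real) \<Rightarrow> bool" where
  "iid_innovations M \<epsilon> \<epsilon>' \<longleftrightarrow>
     prob_space.indep_vars M (\<lambda>_. borel) (case_sum (\<lambda>(i, j). \<epsilon> i j) \<epsilon>')
       (UNIV :: ((int \<times> int) + int) set) \<and>
     (\<forall>i j. distr M borel (\<epsilon> i j) = distr M borel (\<epsilon> 0 0)) \<and>
     (\<forall>j. distr M borel (\<epsilon>' j) = distr M borel (\<epsilon> 0 0))"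

definition F_err ::
  "'w measure \<Rightarrow> ((int \<Rightarrow> real) \<Rightarrow> real) \<Rightarrow> (int \<Rightarrow> int \<Rightarrow> 'w \<Rightarrow> real) \<Rightarrow> real \<Rightarrow> real" where
  "F_err M G \<epsilon> = cdf (distr M borel (err G \<epsilon> 0 0))"

definition f_err ::
  "'w measure \<Rightarrow> ((int \<Rightarrow> real) \<Rightarrow> real) \<Rightarrow> (int \<Rightarrow> int \<Rightarrow> 'w \<Rightarrow> real) \<Rightarrow> real \<Rightarrow> real" where
  "f_err M G \<epsilon> = deriv (F_err M G \<epsilon>)"

definition Lq_norm :: "'w measure \<Rightarrow> real \<Rightarrow> ('w \<Rightarrow> real) \<Rightarrow> real" where
  "Lq_norm M q Z = (\<integral>\<omega>. \<bar>Z \<omega>\<bar> powr q \<partial>M) powr (1 / q)"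

text \<open>
  The integrability clause rules out that an infinite moment is read as \<open>0\<close>.
\<close>

definition cond_D ::
  "'w measure \<Rightarrow> ((int \<Rightarrow> real) \<Rightarrow> real) \<Rightarrow> (int \<Rightarrow> int \<Rightarrow> 'w \<Rightarrow> real) \<Rightarrow> (int \<Rightarrow> 'w \<Rightarrow> real) \<Rightarrow> bool" where
  "cond_D M G \<epsilon> \<epsilon>' \<longleftrightarrow>
     (\<exists>q \<rho>. q > 0 \<and> 0 < \<rho> \<and> \<rho> < 1 \<and>
        (\<forall>\<^sub>F k in sequentially.
           integrable M (\<lambda>\<omega>. \<bar>err G \<epsilon> 0 0 \<omega> - err_coupled G \<epsilon> \<epsilon>' k \<omega>\<bar> powr q)) \<and>
        (\<lambda>k. Lq_norm M q (\<lambda>\<omega>. err G \<epsilon> 0 0 \<omega> - err_coupled G \<epsilon> \<epsilon>' k \<omega>)) \<in> O(\<lambda>k. \<rho> ^ k))"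

text \<open>The list \<open>[a, x\<^sub>1, \<dots>, x\<^sub>N, b]\<close> with all \<open>N\<close> design points sorted (repetitions kept).\<close>

definition ordered_design ::
  "real \<Rightarrow> real \<Rightarrow> (nat \<Rightarrow> nat \<Rightarrow> nat) \<Rightarrow> (nat \<Rightarrow> nat \<Rightarrow> nat \<Rightarrow> real) \<Rightarrow> nat \<Rightarrow> real list" where
  "ordered_design a b m X n =
     a # sort [X n i j. i \<leftarrow> [1..<Suc n], j \<leftarrow> [1..<Suc (m n i)]] @ [b]"

definition cond_X ::
  "real \<Rightarrow> real \<Rightarrow> (nat \<Rightarrow> nat \<Rightarrow> nat) \<Rightarrow> (nat \<Rightarrow> nat \<Rightarrow> nat \<Rightarrow> real) \<Rightarrow> bool" where
  "cond_X a b m X \<longleftrightarrow>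
     (\<forall>n. \<forall>i\<in>{1..n}. \<forall>j\<in>{1..m n i}. X n i j \<in> {a..b}) \<and>
     (\<forall>n. sorted_wrt (<) (ordered_design a b m X n)) \<and>
     (\<lambda>n. MAX k\<in>{0..N_obs m n}.
        \<bar>ordered_design a b m X n ! Suc k - ordered_design a b m X n ! k
          - (b - a) / real (N_obs m n)\<bar>) \<in> O(\<lambda>n. 1 / (real (N_obs m n))\<^sup>2)"

definition cond_K :: "(real \<Rightarrow> real) \<Rightarrow> bool" where
  "cond_K K \<longleftrightarrow>
     (\<forall>u. K u \<ge> 0) \<and> has_bochner_integral lborel K 1 \<and> (\<forall>u. K (- u) = K u) \<and>
     bounded {u. K u \<noteq> 0} \<and> (\<forall>u. K differentiable (at u)) \<and> bounded (range (deriv K))"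

definition phi_K :: "(real \<Rightarrow> real) \<Rightarrow> real" where
  "phi_K K = (\<integral>u. (K u)\<^sup>2 \<partial>lborel)"

definition psi_K :: "(real \<Rightarrow> real) \<Rightarrow> real" where
  "psi_K K = 1 / 2 * (\<integral>u. u\<^sup>2 * K u \<partial>lborel)"

text \<open>
  Bounded derivatives of orders \<open>0, \<dots>, r\<close> on \<open>S\<close>; derivatives are taken within \<open>S\<close>, hence
  one-sided at the end points of an interval.  The highest derivative need not be continuous.
\<close>

definition bounded_C :: "nat \<Rightarrow> real set \<Rightarrow> (real \<Rightarrow> real) \<Rightarrow> bool" where
  "bounded_C r S f \<longleftrightarrow>
     (\<exists>D :: nat \<Rightarrow> real \<Rightarrow> real.
        D 0 = f \<and>
        (\<forall>k<r. \<forall>t\<in>S. (D k has_real_derivative D (Suc k) t) (at t within S)) \<and>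
        (\<forall>k\<le>r. bounded (D k ` S)))"

definition cond_S ::
  "real \<Rightarrow> real \<Rightarrow> (real \<Rightarrow> real) \<Rightarrow> (real \<Rightarrow> real) \<Rightarrow> (real \<Rightarrow> real) \<Rightarrow> bool" where
  "cond_S a b \<mu> s f \<longleftrightarrow>
     bounded_C 4 {a..b} \<mu> \<and> bounded_C 4 {a..b} s \<and> (INF t\<in>{a..b}. s t) > 0 \<and>
     bounded_C 4 UNIV f \<and> f 0 > 0 \<and> f 1 + f (- 1) > 0"

definition K_bw :: "(real \<Rightarrow> real) \<Rightarrow> real \<Rightarrow> real \<Rightarrow> real" where
  "K_bw K c u = K (u / c)"

definition near_pairs ::
  "(nat \<Rightarrow> nat \<Rightarrow> nat) \<Rightarrow> nat \<Rightarrow> nat \<Rightarrow> nat \<Rightarrow> nat \<Rightarrow> (nat \<times> nat \<times> nat) set" where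
  "near_pairs m n k \<alpha> h =
     {(i, j1, j2). 1 \<le> i \<and> i \<le> n \<and> \<alpha> \<le> j1 \<and> j1 < j2 \<and> j2 \<le> min (\<alpha> + h - 1) (m n i) \<and>
        \<bar>int j1 - int j2\<bar> \<le> int k}"

text \<open>
  The first \<open>O\<close>-bound is uniform in \<open>\<alpha>\<close> and \<open>h\<close>, whose range depends on \<open>n\<close>; therefore it is
  written out with its constant \<open>C\<close>.
\<close>

definition cond_C ::
  "real \<Rightarrow> real \<Rightarrow> real \<Rightarrow> (nat \<Rightarrow> nat \<Rightarrow> nat) \<Rightarrow> (nat \<Rightarrow> nat \<Rightarrow> nat \<Rightarrow> real) \<Rightarrow>
     (real \<Rightarrow> real) \<Rightarrow> (nat \<Rightarrow> real) \<Rightarrow> bool" where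
  "cond_C a b \<delta> m X K bw \<longleftrightarrow>
     (\<forall>x\<in>{a + \<delta>..b - \<delta>}.
        (\<forall>k :: nat \<Rightarrow> nat.
           (\<forall>n. k n \<ge> 1) \<and> (\<lambda>n. real (k n)) \<in> O(\<lambda>n. ln (real (N_obs m n))) \<longrightarrow>
           (\<exists>\<iota> :: nat \<Rightarrow> real.
              (\<lambda>n. real (k n) * \<iota> n) \<longlonglongrightarrow> 0 \<and>
              (\<exists>C. \<forall>\<^sub>F n in sequentially. \<forall>\<alpha> h. \<alpha> \<ge> 1 \<and> h \<ge> max (k n) \<alpha> \<longrightarrow>
                 \<bar>\<Sum>(i, j1, j2)\<in>near_pairs m n (k n) \<alpha> h.
                    K_bw K (bw n) (X n i j1 - x) * K_bw K (bw n) (X n i j2 - x)\<bar>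
                 \<le> C * \<bar>real (min h (M_obs m n)) * real n * bw n * real (k n) * \<iota> n\<bar>))) \<and>
        (\<forall>r\<in>{2, 4}.
           (\<lambda>n. MAX j\<in>{1..M_obs m n}.
              \<Sum>i\<in>{i \<in> {1..n}. j \<le> m n i}. K_bw K (bw n) (X n i j - x) ^ r)
           \<in> O(\<lambda>n. real n * bw n)))"

definition Y_obs ::
  "(real \<Rightarrow> real) \<Rightarrow> (real \<Rightarrow> real) \<Rightarrow> (nat \<Rightarrow> nat \<Rightarrow> nat \<Rightarrow> real) \<Rightarrow> ((int \<Rightarrow> real) \<Rightarrow> real) \<Rightarrow>
     (int \<Rightarrow> int \<Rightarrow> 'w \<Rightarrow> real) \<Rightarrow> nat \<Rightarrow> nat \<Rightarrow> nat \<Rightarrow> 'w \<Rightarrow> real" where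
  "Y_obs \<mu> s X G \<epsilon> n i j \<omega> = \<mu> (X n i j) + s (X n i j) * err G \<epsilon> (int i) (int j) \<omega>"

definition LAD_loss ::
  "(nat \<Rightarrow> nat \<Rightarrow> nat) \<Rightarrow> (nat \<Rightarrow> nat \<Rightarrow> nat \<Rightarrow> real) \<Rightarrow> (real \<Rightarrow> real) \<Rightarrow> (nat \<Rightarrow> real) \<Rightarrow>
     (nat \<Rightarrow> nat \<Rightarrow> nat \<Rightarrow> real) \<Rightarrow> nat \<Rightarrow> real \<Rightarrow> real \<Rightarrow> real" where
  "LAD_loss m X K bw y n x \<theta> =
     (\<Sum>i=1..n. \<Sum>j=1..m n i. \<bar>y n i j - \<theta>\<bar> * K_bw K (bw n) (X n i j - x))"

text \<open>For interior \<open>x\<close> the derivatives within \<open>{a..b}\<close> agree with the two-sided ones used here.\<close>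

definition rho_mu :: "(real \<Rightarrow> real) \<Rightarrow> (real \<Rightarrow> real) \<Rightarrow> (real \<Rightarrow> real) \<Rightarrow> real \<Rightarrow> real" where
  "rho_mu \<mu> s f x =
     deriv (deriv \<mu>) x - (deriv \<mu> x * deriv f 0 / f 0 + 2 * deriv s x) * (deriv \<mu> x / s x)"

end

theory Submission
  imports Defs
begin

text \<open>
  A minimiser of \<open>\<theta> \<mapsto> \<Sum> w\<^sub>\<alpha> \<bar>Y\<^sub>\<alpha> - \<theta>\<bar>\<close> is at most \<open>\<theta>\<close> if the sign statistic
  \<open>\<Sum> w\<^sub>\<alpha> (of_bool (Y\<^sub>\<alpha> \<le> \<theta>) - 1 / 2)\<close> is positive, and only if it is nonnegative.  Hence the
  distribution function of the normalised estimator at \<open>t\<close> is read off from the sign statistic at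
  \<open>\<theta> = \<mu> x + \<psi>\<^sub>K \<rho>\<^sub>\<mu> b\<^sub>n\<^sup>2 + t / sqrt (N\<^sub>n b\<^sub>n)\<close>, and no Bahadur representation is needed.

  By (D) and Fubini, the innovations at distance more than \<open>k = O(log N\<^sub>n)\<close> can be frozen at a
  deterministic sequence without changing any of the indicators, up to an event of probability
  \<open>O(1 / N\<^sub>n)\<close>.  The resulting summands are \<open>2k\<close>-dependent within rows and independent across rows.
  For such sums the characteristic function satisfies \<open>\<phi>' u + u \<phi> u \<approx> 0\<close> (Stein's method in the form
  of Tikhomirov), which gives asymptotic normality; by (C) the off-diagonal covariances do not
  contribute to the variance.  The mean is a Riemann sum, whose Taylor expansion shows that the
  bias term \<open>\<psi>\<^sub>K \<rho>\<^sub>\<mu> b\<^sub>n\<^sup>2\<close> cancels the second-order term, so that only the drift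
  \<open>t f\<^sub>e(0) / (s x (b - a))\<close> remains.
\<close>

section \<open>Central limit theorem for locally dependent sums\<close>

text \<open>Summands are dependent inside rows that may be long. Instead of cutting the rows into
  blocks, the central limit theorem is stated for a finite family in which every summand has at most
  \<open>d\<close> neighbours, and it charges only powers of \<open>d\<close>: the errors are of
  order \<open>sqrt (d^3 / (N b))\<close> and \<open>d^2 / sqrt (N b)\<close>, which is affordable
  because \<open>d = 4 k + 1 = O(log N)\<close>. Indicators are discontinuous in the error, so
  closeness of the truncated error does not by itself control them; the Lipschitz property of
  \<open>F_err\<close> bounds the chance that the error falls near the threshold. Freezing the tail
  at one deterministic sequence, rather than drawing a fresh tail for each site, keeps every
  truncated error a function of the given innovations: the probability space stays the same, and
  disjoint windows give exact independence. The truncation, the thresholds and the centring are all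
  rebuilt for each \<open>t\<close>. This suffices because weak convergence asks for one argument of
  the distribution function at a time.\<close>

definition depends_on :: "('k \<Rightarrow> 'w \<Rightarrow> real) \<Rightarrow> 'k set \<Rightarrow> ('w \<Rightarrow> real) \<Rightarrow> bool" where
  "depends_on E A U \<longleftrightarrow>
     (\<exists>h \<in> borel_measurable (PiM A (\<lambda>_. borel)). \<forall>\<omega>. U \<omega> = h (restrict (\<lambda>k. E k \<omega>) A))"

lemma depends_on_mono:
  assumes "depends_on E A U" "A \<subseteq> B"
  shows "depends_on E B U"
proof -
  obtain h where h: "h \<in> borel_measurable (PiM A (\<lambda>_. borel))"
    and U: "\<And>\<omega>. U \<omega> = h (restrict (\<lambda>k. E k \<omega>) A)"
    using assms(1) unfolding depends_on_def by blast
  have "(\<lambda>f. h (restrict f A)) \<in> borel_measurable (PiM B (\<lambda>_. borel :: real measure))"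
    by (rule measurable_compose[OF measurable_restrict_subset[OF assms(2)] h])
  moreover have "U \<omega> = h (restrict (restrict (\<lambda>k. E k \<omega>) B) A)" for \<omega>
    using U assms(2) by (simp add: Int_absorb1)
  ultimately show ?thesis
    unfolding depends_on_def by (intro bexI[of _ "\<lambda>f. h (restrict f A)"]) auto
qed

lemma depends_on_compose2:
  fixes f :: "real \<Rightarrow> real \<Rightarrow> real"
  assumes "depends_on E A U" "depends_on E A V"
    and "(\<lambda>p. f (fst p) (snd p)) \<in> borel_measurable borel"
  shows "depends_on E A (\<lambda>\<omega>. f (U \<omega>) (V \<omega>))"
proof -
  obtain h1 where h1: "h1 \<in> borel_measurable (PiM A (\<lambda>_. borel))"
    and U: "\<And>\<omega>. U \<omega> = h1 (restrict (\<lambda>k. E k \<omega>) A)"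
    using assms(1) unfolding depends_on_def by blast
  obtain h2 where h2: "h2 \<in> borel_measurable (PiM A (\<lambda>_. borel))"
    and V: "\<And>\<omega>. V \<omega> = h2 (restrict (\<lambda>k. E k \<omega>) A)"
    using assms(2) unfolding depends_on_def by blast
  have "(\<lambda>r. (h1 r, h2 r)) \<in> borel_measurable (PiM A (\<lambda>_. borel))"
    using h1 h2 by simp
  from measurable_compose[OF this assms(3)]
  have "(\<lambda>r. f (h1 r) (h2 r)) \<in> borel_measurable (PiM A (\<lambda>_. borel))" by simp
  then show ?thesis
    unfolding depends_on_def by (intro bexI[of _ "\<lambda>r. f (h1 r) (h2 r)"]) (auto simp: U V)
qed

lemma depends_on_const: "depends_on E A (\<lambda>_. c)"
  unfolding depends_on_def by (intro bexI[of _ "\<lambda>_. c"]) auto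

lemma depends_on_compose:
  fixes f :: "real \<Rightarrow> real"
  assumes "depends_on E A U" "f \<in> borel_measurable borel"
  shows "depends_on E A (\<lambda>\<omega>. f (U \<omega>))"
proof -
  have "(\<lambda>p::real\<times>real. f (fst p)) \<in> borel_measurable borel"
    using assms(2) by (intro measurable_compose[OF _ assms(2)] borel_measurable_continuous_onI continuous_intros)
  then show ?thesis
    using depends_on_compose2[OF assms(1) assms(1), of "\<lambda>x y. f x"] by simp
qed

lemma depends_on_add:
  assumes "depends_on E A U" "depends_on E A V"
  shows "depends_on E A (\<lambda>\<omega>. U \<omega> + V \<omega>)"
  by (rule depends_on_compose2[OF assms])
    (intro borel_measurable_continuous_onI continuous_intros)

lemma depends_on_mult:
  assumes "depends_on E A U" "depends_on E B V"
  shows "depends_on E (A \<union> B) (\<lambda>\<omega>. U \<omega> * V \<omega>)"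
  by (rule depends_on_compose2[OF depends_on_mono[OF assms(1)] depends_on_mono[OF assms(2)]])
    (auto intro!: borel_measurable_continuous_onI continuous_intros)

lemma depends_on_sum:
  assumes "finite J" "\<And>\<beta>. \<beta> \<in> J \<Longrightarrow> depends_on E (A \<beta>) (U \<beta>)"
  shows "depends_on E (\<Union>\<beta>\<in>J. A \<beta>) (\<lambda>\<omega>. \<Sum>\<beta>\<in>J. U \<beta> \<omega>)"
  using assms
proof (induction J)
  case empty
  show ?case by (simp add: depends_on_const)
next
  case (insert \<beta> J)
  have "depends_on E (\<Union>\<beta>\<in>insert \<beta> J. A \<beta>) (\<lambda>\<omega>. \<Sum>\<beta>\<in>J. U \<beta> \<omega>)"
    by (rule depends_on_mono[OF insert.IH]) (use insert.prems in auto)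
  moreover have "depends_on E (\<Union>\<beta>\<in>insert \<beta> J. A \<beta>) (U \<beta>)"
    by (rule depends_on_mono[of E "A \<beta>"]) (use insert.prems in auto)
  ultimately show ?case
    using insert.hyps by (simp add: depends_on_add)
qed

context prob_space
begin

lemma depends_on_measurable:
  assumes "indep_vars (\<lambda>_. borel) E UNIV" "depends_on E A U"
  shows "U \<in> borel_measurable M"
proof -
  obtain h where h: "h \<in> borel_measurable (PiM A (\<lambda>_. borel))"
    and U: "\<And>\<omega>. U \<omega> = h (restrict (\<lambda>k. E k \<omega>) A)"
    using assms(2) unfolding depends_on_def by blast
  have "E k \<in> borel_measurable M" for k
    using assms(1) unfolding indep_vars_def by simp
  then have "(\<lambda>\<omega>. restrict (\<lambda>k. E k \<omega>) A) \<in> measurable M (PiM A (\<lambda>_. borel))"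
    by (intro measurable_restrict) auto
  from measurable_compose[OF this h] show ?thesis
    by (simp add: U[abs_def])
qed

text \<open>Disjoint blocks of an independent family are independent as random elements of two
  product spaces, and measurable images inherit this. \<open>depends_on\<close> asks for a
  factorisation through \<open>restrict\<close> at every point rather than almost surely, so no null
  sets have to be carried along. The free maps \<open>f\<close> and \<open>g\<close> also admit
  complex-valued images.\<close>

lemma depends_on_indep:
  assumes "indep_vars (\<lambda>_. borel) E UNIV" "depends_on E A U" "depends_on E B V" "A \<inter> B = {}"
    and "f \<in> measurable borel N1" "g \<in> measurable borel N2"
  shows "indep_var N1 (\<lambda>\<omega>. f (U \<omega>)) N2 (\<lambda>\<omega>. g (V \<omega>))"
proof -
  obtain h1 where h1: "h1 \<in> borel_measurable (PiM A (\<lambda>_. borel))"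
    and U: "\<And>\<omega>. U \<omega> = h1 (restrict (\<lambda>k. E k \<omega>) A)"
    using assms(2) unfolding depends_on_def by blast
  obtain h2 where h2: "h2 \<in> borel_measurable (PiM B (\<lambda>_. borel))"
    and V: "\<And>\<omega>. V \<omega> = h2 (restrict (\<lambda>k. E k \<omega>) B)"
    using assms(3) unfolding depends_on_def by blast
  have "indep_var (PiM A (\<lambda>_. borel)) (\<lambda>\<omega>. restrict (\<lambda>k. E k \<omega>) A)
      (PiM B (\<lambda>_. borel)) (\<lambda>\<omega>. restrict (\<lambda>k. E k \<omega>) B)"
    by (rule indep_var_restrict[OF assms(1)]) (use assms(4) in auto)
  from indep_var_compose[OF this measurable_comp[OF h1 assms(5)] measurable_comp[OF h2 assms(6)]]
  show ?thesis by (simp add: comp_def U V)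
qed

lemma depends_on_expectation_mult:
  assumes E: "indep_vars (\<lambda>_. borel) E UNIV" and U: "depends_on E A U" and V: "depends_on E B V"
    and AB: "A \<inter> B = {}" and bU: "\<And>\<omega>. \<bar>U \<omega>\<bar> \<le> c" and bV: "\<And>\<omega>. \<bar>V \<omega>\<bar> \<le> d"
  shows "expectation (\<lambda>\<omega>. U \<omega> * V \<omega>) = expectation U * expectation V"
proof -
  have "indep_var borel U borel V"
    using depends_on_indep[OF E U V AB, of id borel id borel] by simp
  moreover have "integrable M U"
    by (rule integrable_const_bound[of _ c]) (use bU depends_on_measurable[OF E U] in auto)
  moreover have "integrable M V"
    by (rule integrable_const_bound[of _ d]) (use bV depends_on_measurable[OF E V] in auto)
  ultimately show ?thesis by (rule indep_var_lebesgue_integral)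
qed

text \<open>Independence splits off the factor \<open>expectation U = 0\<close>. In Stein's argument
  \<open>U\<close> is one summand and \<open>V\<close> is the part of the sum that shares no
  innovation with it.\<close>

lemma depends_on_expectation_iexp:
  assumes E: "indep_vars (\<lambda>_. borel) E UNIV" and U: "depends_on E A U" and V: "depends_on E B V"
    and AB: "A \<inter> B = {}" and bU: "\<And>\<omega>. \<bar>U \<omega>\<bar> \<le> c" and U0: "expectation U = 0"
  shows "(\<integral>\<omega>. complex_of_real (U \<omega>) * iexp (t * V \<omega>) \<partial>M) = 0"
proof -
  have mU: "U \<in> borel_measurable M" and mV: "V \<in> borel_measurable M"
    using depends_on_measurable[OF E] U V by auto
  have "indep_var borel (\<lambda>\<omega>. complex_of_real (U \<omega>)) borel (\<lambda>\<omega>. iexp (t * V \<omega>))"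
    by (rule depends_on_indep[OF E U V AB, of complex_of_real borel "\<lambda>v. iexp (t * v)" borel])
       (auto intro!: borel_measurable_continuous_onI continuous_intros)
  moreover have "integrable M (\<lambda>\<omega>. complex_of_real (U \<omega>))"
    by (rule integrable_const_bound[of _ c]) (use bU mU in auto)
  moreover have "integrable M (\<lambda>\<omega>. iexp (t * V \<omega>))"
    by (rule integrable_iexp) (use mV in auto)
  ultimately have "(\<integral>\<omega>. complex_of_real (U \<omega>) * iexp (t * V \<omega>) \<partial>M)
     = (\<integral>\<omega>. complex_of_real (U \<omega>) \<partial>M) * (\<integral>\<omega>. iexp (t * V \<omega>) \<partial>M)"
    by (rule indep_var_lebesgue_integral)
  then show ?thesis using U0 by simp
qed

end

section \<open>Characteristic functions and the Gaussian differential equation\<close>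

lemma norm_iexp_diff_linear: "norm (iexp x - 1 - \<i> * x) \<le> x\<^sup>2 / 2"
proof -
  have "(\<Sum>k\<le>1. (\<i> * x)^k / fact k) = 1 + \<i> * x" by simp
  then show ?thesis using iexp_approx1[of x 1]
    by (simp add: diff_diff_eq numeral_2_eq_2)
qed

context prob_space
begin

text \<open>Because \<open>Z\<close> is bounded by \<open>c\<close>, the first-order error of the
  exponential is at most \<open>h\<^sup>2 * (c\<^sup>2 / 2)\<close> at every point. Integrating this
  uniform bound gives the derivative directly, without interchanging a limit and an
  integral.\<close>

lemma char_bounded_has_vector_derivative:
  assumes Z: "Z \<in> borel_measurable M" and c: "\<And>\<omega>. \<bar>Z \<omega>\<bar> \<le> c"
  shows "((\<lambda>t. \<integral>\<omega>. iexp (t * Z \<omega>) \<partial>M) has_vector_derivative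
      (\<i> * (\<integral>\<omega>. complex_of_real (Z \<omega>) * iexp (t * Z \<omega>) \<partial>M))) (at t)"
proof -
  have c0: "0 \<le> c" using c[of undefined] by linarith
  define \<phi> where "\<phi> t = (\<integral>\<omega>. iexp (t * Z \<omega>) \<partial>M)" for t
  define D where "D = \<i> * (\<integral>\<omega>. complex_of_real (Z \<omega>) * iexp (t * Z \<omega>) \<partial>M)"
  have int1: "integrable M (\<lambda>\<omega>. iexp (s * Z \<omega>))" for s
    by (rule integrable_iexp) (use Z in auto)
  have int2: "integrable M (\<lambda>\<omega>. complex_of_real (Z \<omega>) * iexp (t * Z \<omega>))"
    by (rule integrable_const_bound[of _ c]) (use c Z in \<open>auto simp: norm_mult\<close>)
  have bound: "norm (\<phi> (t + h) - \<phi> t - h *\<^sub>R D) \<le> h\<^sup>2 * (c\<^sup>2 / 2)" for h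
  proof -
    have eq: "\<phi> (t + h) - \<phi> t - h *\<^sub>R D = (\<integral>\<omega>. iexp ((t + h) * Z \<omega>) - iexp (t * Z \<omega>)
        - of_real h * \<i> * (complex_of_real (Z \<omega>) * iexp (t * Z \<omega>)) \<partial>M)"
      unfolding \<phi>_def D_def scaleR_conv_of_real
      using int1[of t] int1[of "t+h"] int2
      by (simp add: Bochner_Integration.integral_diff mult.assoc)
    have pw: "norm (iexp ((t + h) * Z \<omega>) - iexp (t * Z \<omega>)
        - of_real h * \<i> * (complex_of_real (Z \<omega>) * iexp (t * Z \<omega>))) \<le> h\<^sup>2 * (c\<^sup>2 / 2)" for \<omega>
    proof -
      have "iexp ((t + h) * Z \<omega>) - iexp (t * Z \<omega>)
        - of_real h * \<i> * (complex_of_real (Z \<omega>) * iexp (t * Z \<omega>))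
        = iexp (t * Z \<omega>) * (iexp (h * Z \<omega>) - 1 - \<i> * complex_of_real (h * Z \<omega>))"
        by (simp add: algebra_simps exp_add)
      then have "norm (iexp ((t + h) * Z \<omega>) - iexp (t * Z \<omega>)
        - of_real h * \<i> * (complex_of_real (Z \<omega>) * iexp (t * Z \<omega>)))
        = norm (iexp (h * Z \<omega>) - 1 - \<i> * complex_of_real (h * Z \<omega>))"
        by (simp add: norm_mult)
      also have "\<dots> \<le> (h * Z \<omega>)\<^sup>2 / 2" by (rule norm_iexp_diff_linear)
      also have "\<dots> \<le> h\<^sup>2 * (c\<^sup>2 / 2)"
        using power_mono[OF c[of \<omega>], of 2] by (simp add: power_mult_distrib mult_left_mono)
      finally show ?thesis .
    qed
    show ?thesis
      unfolding eq
      by (rule order_trans[OF integral_norm_bound])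
         (intro integral_le_const integrable_norm Bochner_Integration.integrable_diff int1
           integrable_mult_right int2 AE_I2 pw)
  qed
  have "(\<phi> has_derivative (\<lambda>h. h *\<^sub>R D)) (at t)"
    unfolding has_derivative_at
  proof (intro conjI)
    show "bounded_linear (\<lambda>h. h *\<^sub>R D)" by (rule bounded_linear_scaleR_left)
    have lim: "((\<lambda>h. \<bar>h\<bar> * (c\<^sup>2 / 2)) \<longlongrightarrow> 0) (at 0)"
      by (auto intro!: tendsto_eq_intros)
    have le: "norm (\<phi> (t + h) - \<phi> t - h *\<^sub>R D) / norm h \<le> \<bar>h\<bar> * (c\<^sup>2 / 2)" for h :: real
      using bound[of h] by (cases "h = 0") (auto simp: divide_simps power2_eq_square abs_mult_self_eq algebra_simps)
    show "(\<lambda>h. norm (\<phi> (t + h) - \<phi> t - h *\<^sub>R D) / norm h) \<midarrow>0\<rightarrow> 0"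
    proof (rule Lim_null_comparison[OF always_eventually lim], rule allI)
      fix h show "norm (norm (\<phi> (t + h) - \<phi> t - h *\<^sub>R D) / norm h) \<le> \<bar>h\<bar> * (c\<^sup>2 / 2)"
        by (rule order_trans[OF eq_refl le], rule trans[OF real_norm_def abs_of_nonneg])
           (intro divide_nonneg_nonneg norm_ge_zero)
    qed
  qed
  then show ?thesis
    unfolding has_vector_derivative_def \<phi>_def D_def .
qed

end

text \<open>
  If \<open>\<phi>' (u) + u * \<phi> u\<close> is small, then \<open>\<phi> u * exp (u\<^sup>2 / 2)\<close> is nearly constant.
\<close>

lemma gaussian_ode_comparison:
  fixes \<phi> :: "real \<Rightarrow> complex"
  assumes d: "\<And>u. (\<phi> has_vector_derivative \<phi>' u) (at u)" and "\<phi> 0 = 1"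
    and b: "\<And>u. \<bar>u\<bar> \<le> \<bar>t\<bar> \<Longrightarrow> norm (\<phi>' u + of_real u * \<phi> u) \<le> B"
  shows "norm (\<phi> t - complex_of_real (exp (- (t\<^sup>2) / 2))) \<le> \<bar>t\<bar> * B"
proof -
  define g where "g u = \<phi> u * complex_of_real (exp (u\<^sup>2 / 2))" for u
  define g' where "g' u = (\<phi>' u + of_real u * \<phi> u) * complex_of_real (exp (u\<^sup>2 / 2))" for u
  \<comment> \<open>The symmetric interval contains both 0 and \<open>t\<close> whatever the sign of
    \<open>t\<close>.\<close>
  define S where "S = {- \<bar>t\<bar>..\<bar>t\<bar>}"
  have dg: "(g has_vector_derivative g' u) (at u within S)" for u
  proof -
    have e: "((\<lambda>u. complex_of_real (exp (u\<^sup>2 / 2))) has_vector_derivative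
        complex_of_real (exp (u\<^sup>2 / 2) * u)) (at u within S)"
      by (auto intro!: derivative_eq_intros has_vector_derivative_of_real
          simp flip: has_real_derivative_iff_has_vector_derivative)
    have "(g has_vector_derivative (\<phi> u * complex_of_real (exp (u\<^sup>2 / 2) * u)
        + \<phi>' u * complex_of_real (exp (u\<^sup>2 / 2)))) (at u within S)"
      unfolding g_def
      by (rule has_vector_derivative_mult[OF has_vector_derivative_at_within[OF d] e])
    then show ?thesis by (simp add: g'_def algebra_simps)
  qed
  have "norm (g t - g 0) \<le> (B * exp (t\<^sup>2 / 2)) * norm (t - 0)"
  proof (rule differentiable_bound[of S g "\<lambda>u h. h *\<^sub>R g' u"])
    show "convex S" "t \<in> S" "0 \<in> S" by (auto simp: S_def)
    show "(g has_derivative (\<lambda>h. h *\<^sub>R g' u)) (at u within S)" for u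
      using dg[of u] by (simp add: has_vector_derivative_def)
    show "onorm (\<lambda>h. h *\<^sub>R g' u) \<le> B * exp (t\<^sup>2 / 2)" if "u \<in> S" for u
    proof -
      have u: "\<bar>u\<bar> \<le> \<bar>t\<bar>" using that by (auto simp: S_def)
      have "norm (g' u) = norm (\<phi>' u + of_real u * \<phi> u) * exp (u\<^sup>2 / 2)"
        by (simp add: g'_def norm_mult)
      also have "\<dots> \<le> B * exp (t\<^sup>2 / 2)"
        using b[OF u] abs_le_square_iff[of u t] u order_trans[OF norm_ge_zero b[OF u]]
        by (intro mult_mono) auto
      finally have *: "norm (g' u) \<le> B * exp (t\<^sup>2 / 2)" .
      show ?thesis
        by (rule onorm_le) (use * in \<open>auto intro: mult_left_mono simp: mult.commute\<close>)
    qed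
  qed
  then have *: "norm (g t - 1) \<le> \<bar>t\<bar> * B * exp (t\<^sup>2 / 2)"
    using assms(2) by (simp add: g_def mult.commute mult.left_commute)
  have "\<phi> t - exp (- (t\<^sup>2) / 2) = (g t - 1) * complex_of_real (exp (- (t\<^sup>2) / 2))"
    unfolding g_def by (simp add: algebra_simps exp_minus exp_of_real[symmetric] field_simps del: exp_of_real)
  then have "norm (\<phi> t - exp (- (t\<^sup>2) / 2)) = norm (g t - 1) * exp (- (t\<^sup>2) / 2)"
    by (simp only: norm_mult norm_of_real abs_exp_cancel)
  also have "\<dots> \<le> \<bar>t\<bar> * B * exp (t\<^sup>2 / 2) * exp (- (t\<^sup>2) / 2)"
    by (rule mult_right_mono[OF *]) simp
  also have "\<dots> = \<bar>t\<bar> * B"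
    by (simp add: exp_minus)
  finally show ?thesis by simp
qed

context prob_space
begin

text \<open>Triangle inequality through the mean of \<open>S\<close>. The centred part
  \<open>Y\<close> is then handled by nonnegativity of its own variance, which bounds its mean by
  the standard deviation of \<open>S\<close>.\<close>

lemma expectation_abs_diff_le:
  assumes "S \<in> borel_measurable M" and "\<And>\<omega>. \<bar>S \<omega>\<bar> \<le> c"
  shows "expectation (\<lambda>\<omega>. \<bar>r - S \<omega>\<bar>) \<le> \<bar>expectation S - r\<bar> + sqrt (variance S)"
proof -
  have S: "integrable M S"
    by (rule integrable_const_bound[of _ c]) (use assms in auto)
  define Y where "Y \<omega> = \<bar>S \<omega> - expectation S\<bar>" for \<omega>
  have bY: "\<bar>Y \<omega>\<bar> \<le> c + \<bar>expectation S\<bar>" for \<omega>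
    using assms(2)[of \<omega>] by (auto simp: Y_def)
  have Ym: "Y \<in> borel_measurable M" using assms(1) by (simp add: Y_def[abs_def])
  have Y: "integrable M Y"
    by (rule integrable_const_bound[of _ "c + \<bar>expectation S\<bar>"]) (use bY Ym in auto)
  have bY2: "norm ((Y \<omega>)\<^sup>2) \<le> (c + \<bar>expectation S\<bar>)\<^sup>2" for \<omega>
    using power_mono[OF bY[of \<omega>], of 2] by simp
  have Y2: "integrable M (\<lambda>\<omega>. (Y \<omega>)\<^sup>2)"
    by (rule integrable_const_bound[OF AE_I2[OF bY2]]) (use Ym in simp)
  have "0 \<le> variance Y" by simp
  then have "(expectation Y)\<^sup>2 \<le> expectation (\<lambda>\<omega>. (Y \<omega>)\<^sup>2)"
    using variance_eq[OF Y Y2] by simp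
  then have sq: "expectation Y \<le> sqrt (variance S)"
    by (intro real_le_rsqrt) (simp add: Y_def)
  have "expectation (\<lambda>\<omega>. \<bar>r - S \<omega>\<bar>) \<le> expectation (\<lambda>\<omega>. Y \<omega> + \<bar>expectation S - r\<bar>)"
    using S Y by (intro integral_mono) (auto simp: Y_def)
  also have "\<dots> = expectation Y + \<bar>expectation S - r\<bar>"
    using Y by (simp add: prob_space)
  finally show ?thesis using sq by simp
qed

lemma abs_expectation_le:
  assumes "\<And>\<omega>. \<bar>U \<omega>\<bar> \<le> (c::real)"
  shows "\<bar>expectation U\<bar> \<le> c"
proof (cases "integrable M U")
  case True
  have "\<bar>expectation U\<bar> \<le> expectation (\<lambda>\<omega>. \<bar>U \<omega>\<bar>)"
    by (rule integral_abs_bound)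
  also have "\<dots> \<le> c"
    by (intro integral_le_const) (use True assms in auto)
  finally show ?thesis .
next
  \<comment> \<open>A nonintegrable \<open>U\<close> has integral 0 by convention, and
    \<open>c\<close> is nonnegative because it bounds an absolute value. This is why no
    measurability has to be assumed.\<close>
  case False
  then show ?thesis using assms[of undefined] by (simp add: not_integrable_integral_eq)
qed

end

text \<open>Two summands are neighbours when their sets of innovations meet. The individual bounds
  \<open>v\<close> are kept beside the uniform bound \<open>B\<close>: in the application
  \<open>v\<close> carries the kernel weights, so \<open>sum v I\<close> is of order
  \<open>sqrt (N b)\<close>, whereas \<open>card I * B\<close> would be of order
  \<open>N / sqrt (N b)\<close>.\<close>

locale local_dependence = prob_space M for M :: "'w measure" +
  fixes E :: "'k \<Rightarrow> 'w \<Rightarrow> real" and I :: "'a set" and A :: "'a \<Rightarrow> 'k set"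
    and \<xi> :: "'a \<Rightarrow> 'w \<Rightarrow> real" and v :: "'a \<Rightarrow> real" and B :: real and d :: nat
  assumes indep: "indep_vars (\<lambda>_. borel) E UNIV"
    and fin: "finite I"
    and dep: "\<alpha> \<in> I \<Longrightarrow> depends_on E (A \<alpha>) (\<xi> \<alpha>)"
    and mean0: "\<alpha> \<in> I \<Longrightarrow> expectation (\<xi> \<alpha>) = 0"
    and bound_v: "\<alpha> \<in> I \<Longrightarrow> \<bar>\<xi> \<alpha> \<omega>\<bar> \<le> v \<alpha>"
    and bound_B: "\<alpha> \<in> I \<Longrightarrow> v \<alpha> \<le> B"
    and card_nbh: "\<alpha> \<in> I \<Longrightarrow> card {\<beta> \<in> I. A \<alpha> \<inter> A \<beta> \<noteq> {}} \<le> d"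
begin

definition nbh :: "'a \<Rightarrow> 'a set" where
  "nbh \<alpha> = {\<beta> \<in> I. A \<alpha> \<inter> A \<beta> \<noteq> {}}"

definition Z :: "'w \<Rightarrow> real" where
  "Z \<omega> = (\<Sum>\<alpha>\<in>I. \<xi> \<alpha> \<omega>)"

definition R :: "'a \<Rightarrow> 'w \<Rightarrow> real" where
  "R \<alpha> \<omega> = (\<Sum>\<beta>\<in>nbh \<alpha>. \<xi> \<beta> \<omega>)"

text \<open>This is the quadratic statistic that appears at first order when each
  \<open>exp (i u (Z - R \<alpha>))\<close> is expanded around \<open>exp (i u Z)\<close>. Its mean
  is the variance of \<open>Z\<close>, since summands that are not neighbours are uncorrelated; so
  \<open>S\<close> should be close to 1.\<close>

definition S :: "'w \<Rightarrow> real" where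
  "S \<omega> = (\<Sum>\<alpha>\<in>I. \<xi> \<alpha> \<omega> * R \<alpha> \<omega>)"

lemma nbh_subset: "nbh \<alpha> \<subseteq> I" and finite_nbh: "finite (nbh \<alpha>)"
  using fin by (auto simp: nbh_def)

lemma card_nbh': "\<alpha> \<in> I \<Longrightarrow> card (nbh \<alpha>) \<le> d"
  using card_nbh by (simp add: nbh_def)

lemma v_nonneg: "\<alpha> \<in> I \<Longrightarrow> 0 \<le> v \<alpha>"
  using bound_v[of \<alpha> undefined] by linarith

lemma bound_\<xi>: "\<alpha> \<in> I \<Longrightarrow> \<bar>\<xi> \<alpha> \<omega>\<bar> \<le> B"
  using bound_v bound_B order_trans by blast

lemma meas_\<xi> [measurable]: "\<alpha> \<in> I \<Longrightarrow> \<xi> \<alpha> \<in> borel_measurable M"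
  using depends_on_measurable[OF indep dep] .

lemma meas_R [measurable]: "R \<alpha> \<in> borel_measurable M"
  unfolding R_def[abs_def] using nbh_subset by (intro borel_measurable_sum meas_\<xi>) auto

lemma meas_Z [measurable]: "Z \<in> borel_measurable M"
  unfolding Z_def[abs_def] by (intro borel_measurable_sum meas_\<xi>)

lemma meas_S [measurable]: "S \<in> borel_measurable M"
  unfolding S_def[abs_def] by (intro borel_measurable_sum borel_measurable_times meas_\<xi> meas_R)

lemma bound_R:
  assumes "\<alpha> \<in> I"
  shows "\<bar>R \<alpha> \<omega>\<bar> \<le> d * B"
proof -
  have B: "0 \<le> B" using v_nonneg[OF assms] bound_B[OF assms] by linarith
  have "\<bar>R \<alpha> \<omega>\<bar> \<le> (\<Sum>\<beta>\<in>nbh \<alpha>. \<bar>\<xi> \<beta> \<omega>\<bar>)"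
    unfolding R_def by (rule sum_abs)
  also have "\<dots> \<le> (\<Sum>\<beta>\<in>nbh \<alpha>. B)"
    by (intro sum_mono bound_\<xi>) (use nbh_subset in auto)
  also have "\<dots> \<le> d * B"
    using card_nbh'[OF assms] B by (simp add: mult_right_mono)
  finally show ?thesis .
qed

lemma bound_Z: "\<bar>Z \<omega>\<bar> \<le> sum v I"
  unfolding Z_def by (rule order_trans[OF sum_abs sum_mono[OF bound_v]])

lemma bound_S: "\<bar>S \<omega>\<bar> \<le> sum v I * (d * B)"
proof -
  have "\<bar>S \<omega>\<bar> \<le> (\<Sum>\<alpha>\<in>I. \<bar>\<xi> \<alpha> \<omega> * R \<alpha> \<omega>\<bar>)"
    unfolding S_def by (rule sum_abs)
  also have "\<dots> \<le> (\<Sum>\<alpha>\<in>I. v \<alpha> * (d * B))"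
    unfolding abs_mult by (intro sum_mono mult_mono bound_v bound_R v_nonneg) auto
  finally show ?thesis by (simp add: sum_distrib_right)
qed

text \<open>Subtracting \<open>R \<alpha>\<close> removes from \<open>Z\<close> exactly the summands
  that share an innovation with the one at \<alpha>. The remainder is independent of this summand,
  which has mean zero.\<close>

lemma stein_term_eq_0:
  assumes "\<alpha> \<in> I"
  shows "(\<integral>\<omega>. complex_of_real (\<xi> \<alpha> \<omega>) * iexp (t * (Z \<omega> - R \<alpha> \<omega>)) \<partial>M) = 0"
proof -
  have *: "Z \<omega> - R \<alpha> \<omega> = (\<Sum>\<beta>\<in>I - nbh \<alpha>. \<xi> \<beta> \<omega>)" for \<omega>
    unfolding Z_def R_def by (rule sum_diff[symmetric]) (use fin nbh_subset in auto)
  have "depends_on E (\<Union>\<beta>\<in>I - nbh \<alpha>. A \<beta>) (\<lambda>\<omega>. Z \<omega> - R \<alpha> \<omega>)"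
    unfolding * by (rule depends_on_sum) (use fin dep in auto)
  moreover have "A \<alpha> \<inter> (\<Union>\<beta>\<in>I - nbh \<alpha>. A \<beta>) = {}"
    by (auto simp: nbh_def)
  ultimately show ?thesis
    using depends_on_expectation_iexp[OF indep dep[OF assms] _ _ bound_v[OF assms] mean0[OF assms]]
    by blast
qed

text \<open>The first two terms are the integrand of \<phi>' u + u * \<phi> u, and the subtracted
  sum costs nothing because it integrates to zero. Factoring out the unimodular
  \<open>exp (i u Z)\<close> leaves \<open>u * (1 - S)\<close> plus second-order Taylor errors, each
  at most half the square of \<open>u * R \<alpha>\<close>.\<close>

lemma stein_pointwise:
  "norm (\<i> * (complex_of_real (Z \<omega>) * iexp (u * Z \<omega>)) + of_real u * iexp (u * Z \<omega>)
      - \<i> * (\<Sum>\<alpha>\<in>I. complex_of_real (\<xi> \<alpha> \<omega>) * iexp (u * (Z \<omega> - R \<alpha> \<omega>))))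
    \<le> \<bar>u\<bar> * \<bar>1 - S \<omega>\<bar> + u\<^sup>2 * ((d * B)\<^sup>2 * sum v I / 2)"
proof -
  define err where "err \<alpha> = iexp (- (u * R \<alpha> \<omega>)) - 1 + \<i> * of_real (u * R \<alpha> \<omega>)" for \<alpha>
  have shift: "iexp (u * (Z \<omega> - R \<alpha> \<omega>))
      = iexp (u * Z \<omega>) * (1 - \<i> * of_real (u * R \<alpha> \<omega>) + err \<alpha>)" for \<alpha>
  proof -
    have "iexp (u * (Z \<omega> - R \<alpha> \<omega>)) = iexp (u * Z \<omega>) * iexp (- (u * R \<alpha> \<omega>))"
      by (simp add: exp_add[symmetric] algebra_simps)
    then show ?thesis by (simp add: err_def)
  qed
  have sum_eq: "(\<Sum>\<alpha>\<in>I. complex_of_real (\<xi> \<alpha> \<omega>) * iexp (u * (Z \<omega> - R \<alpha> \<omega>)))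
     = iexp (u * Z \<omega>) * (complex_of_real (Z \<omega>) - \<i> * of_real u * of_real (S \<omega>)
         + (\<Sum>\<alpha>\<in>I. of_real (\<xi> \<alpha> \<omega>) * err \<alpha>))"
  proof -
    have gen: "(\<Sum>\<alpha>\<in>I. of_real (\<xi> \<alpha> \<omega>) * (w * (1 - \<i> * of_real (u * R \<alpha> \<omega>) + err \<alpha>)))
       = w * (of_real (\<Sum>\<alpha>\<in>I. \<xi> \<alpha> \<omega>) - \<i> * of_real u * of_real (\<Sum>\<alpha>\<in>I. \<xi> \<alpha> \<omega> * R \<alpha> \<omega>)
         + (\<Sum>\<alpha>\<in>I. of_real (\<xi> \<alpha> \<omega>) * err \<alpha>))" for w :: complex
      by (simp add: sum_distrib_left sum.distrib sum_subtractf algebra_simps)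
    show ?thesis
      unfolding shift gen Z_def[of \<omega>, symmetric] S_def[of \<omega>, symmetric] ..
  qed
  have "\<i> * (complex_of_real (Z \<omega>) * iexp (u * Z \<omega>)) + of_real u * iexp (u * Z \<omega>)
      - \<i> * (\<Sum>\<alpha>\<in>I. complex_of_real (\<xi> \<alpha> \<omega>) * iexp (u * (Z \<omega> - R \<alpha> \<omega>)))
    = iexp (u * Z \<omega>) * (of_real (u * (1 - S \<omega>)) - \<i> * (\<Sum>\<alpha>\<in>I. of_real (\<xi> \<alpha> \<omega>) * err \<alpha>))"
    unfolding sum_eq by (simp add: algebra_simps)
  then have "norm (\<i> * (complex_of_real (Z \<omega>) * iexp (u * Z \<omega>)) + of_real u * iexp (u * Z \<omega>)
      - \<i> * (\<Sum>\<alpha>\<in>I. complex_of_real (\<xi> \<alpha> \<omega>) * iexp (u * (Z \<omega> - R \<alpha> \<omega>))))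
    = norm (of_real (u * (1 - S \<omega>)) - \<i> * (\<Sum>\<alpha>\<in>I. of_real (\<xi> \<alpha> \<omega>) * err \<alpha>))"
    by (simp only: norm_mult norm_exp_i_times mult_1)
  also have "\<dots> \<le> norm (complex_of_real (u * (1 - S \<omega>)))
      + norm (\<i> * (\<Sum>\<alpha>\<in>I. of_real (\<xi> \<alpha> \<omega>) * err \<alpha>))"
    by (rule norm_triangle_ineq4)
  also have "norm (complex_of_real (u * (1 - S \<omega>))) = \<bar>u\<bar> * \<bar>1 - S \<omega>\<bar>"
    by (simp only: norm_of_real abs_mult)
  also have "norm (\<i> * (\<Sum>\<alpha>\<in>I. of_real (\<xi> \<alpha> \<omega>) * err \<alpha>)) \<le> (\<Sum>\<alpha>\<in>I. v \<alpha> * ((u * (d * B))\<^sup>2 / 2))"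
  proof -
    have e: "norm (err \<alpha>) \<le> (u * (d * B))\<^sup>2 / 2" if "\<alpha> \<in> I" for \<alpha>
    proof -
      have "norm (err \<alpha>) \<le> (- (u * R \<alpha> \<omega>))\<^sup>2 / 2"
        using norm_iexp_diff_linear[of "- (u * R \<alpha> \<omega>)"] by (simp add: err_def)
      also have "\<dots> \<le> (u * (d * B))\<^sup>2 / 2"
        using power_mono[OF bound_R[OF that, of \<omega>], of 2]
        by (simp add: power_mult_distrib mult_left_mono)
      finally show ?thesis .
    qed
    have "norm (\<i> * (\<Sum>\<alpha>\<in>I. of_real (\<xi> \<alpha> \<omega>) * err \<alpha>)) = norm (\<Sum>\<alpha>\<in>I. of_real (\<xi> \<alpha> \<omega>) * err \<alpha>)"
      by (simp add: norm_mult)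
    also have "\<dots> \<le> (\<Sum>\<alpha>\<in>I. v \<alpha> * ((u * (d * B))\<^sup>2 / 2))"
      by (intro sum_norm_le, unfold norm_mult norm_of_real)
           (intro mult_mono bound_v e v_nonneg norm_ge_zero)
    finally show ?thesis .
  qed
  also have "(\<Sum>\<alpha>\<in>I. v \<alpha> * ((u * (d * B))\<^sup>2 / 2)) = u\<^sup>2 * ((d * B)\<^sup>2 * sum v I / 2)"
    unfolding sum_distrib_right[symmetric] by (simp add: power_mult_distrib)
  finally show ?thesis by simp
qed

lemma char_diff_le:
  "norm ((\<integral>\<omega>. iexp (t * Z \<omega>) \<partial>M) - complex_of_real (exp (- (t\<^sup>2) / 2)))
    \<le> t\<^sup>2 * expectation (\<lambda>\<omega>. \<bar>1 - S \<omega>\<bar>) + \<bar>t\<bar> ^ 3 * ((d * B)\<^sup>2 * sum v I)"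
proof -
  define c where "c = expectation (\<lambda>\<omega>. \<bar>1 - S \<omega>\<bar>)"
  define e where "e = (d * B)\<^sup>2 * sum v I"
  have e0: "0 \<le> e" unfolding e_def by (intro mult_nonneg_nonneg sum_nonneg v_nonneg) auto
  have c0: "0 \<le> c" unfolding c_def by simp
  have i1: "integrable M (\<lambda>\<omega>. iexp (u * Z \<omega>))" for u
    by (rule integrable_iexp) auto
  have i2: "integrable M (\<lambda>\<omega>. complex_of_real (Z \<omega>) * iexp (u * Z \<omega>))" for u
    by (rule integrable_const_bound[of _ "sum v I"]) (use bound_Z in \<open>auto simp: norm_mult\<close>)
  have i3: "integrable M (\<lambda>\<omega>. complex_of_real (\<xi> \<alpha> \<omega>) * iexp (u * (Z \<omega> - R \<alpha> \<omega>)))" if "\<alpha> \<in> I" for u \<alpha>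
    by (rule integrable_const_bound[of _ "v \<alpha>"])
       (use bound_v[OF that] meas_\<xi>[OF that] in \<open>auto simp: norm_mult norm_exp_i_times simp del: of_real_diff of_real_mult\<close>)
  have i4: "integrable M (\<lambda>\<omega>. \<bar>1 - S \<omega>\<bar>)"
  proof (rule integrable_const_bound[of _ "1 + sum v I * (d * B)"])
    show "AE \<omega> in M. norm \<bar>1 - S \<omega>\<bar> \<le> 1 + sum v I * (d * B)"
    proof (rule AE_I2)
      fix \<omega> show "norm \<bar>1 - S \<omega>\<bar> \<le> 1 + sum v I * (d * B)"
        using bound_S[of \<omega>] unfolding real_norm_def by linarith
    qed
  qed auto
  have key: "norm (\<i> * (\<integral>\<omega>. complex_of_real (Z \<omega>) * iexp (u * Z \<omega>) \<partial>M)
      + of_real u * (\<integral>\<omega>. iexp (u * Z \<omega>) \<partial>M)) \<le> \<bar>u\<bar> * c + u\<^sup>2 * (e / 2)" for u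
  proof -
    let ?f = "\<lambda>\<omega>. \<i> * (complex_of_real (Z \<omega>) * iexp (u * Z \<omega>)) + of_real u * iexp (u * Z \<omega>)
      - \<i> * (\<Sum>\<alpha>\<in>I. complex_of_real (\<xi> \<alpha> \<omega>) * iexp (u * (Z \<omega> - R \<alpha> \<omega>)))"
    have int_f: "integrable M ?f"
      by (intro Bochner_Integration.integrable_diff Bochner_Integration.integrable_add
          integrable_mult_right Bochner_Integration.integrable_sum i1 i2 i3)
    have "(\<integral>\<omega>. (\<Sum>\<alpha>\<in>I. complex_of_real (\<xi> \<alpha> \<omega>) * iexp (u * (Z \<omega> - R \<alpha> \<omega>))) \<partial>M) = 0"
      by (subst Bochner_Integration.integral_sum[OF i3]) (auto simp only: stein_term_eq_0 sum.neutral_const intro: sum.neutral)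
    moreover have "integral\<^sup>L M ?f = \<i> * (\<integral>\<omega>. complex_of_real (Z \<omega>) * iexp (u * Z \<omega>) \<partial>M)
      + of_real u * (\<integral>\<omega>. iexp (u * Z \<omega>) \<partial>M)
      - \<i> * (\<integral>\<omega>. (\<Sum>\<alpha>\<in>I. complex_of_real (\<xi> \<alpha> \<omega>) * iexp (u * (Z \<omega> - R \<alpha> \<omega>))) \<partial>M)"
      by (rule has_bochner_integral_integral_eq)
         (intro has_bochner_integral_diff has_bochner_integral_add has_bochner_integral_mult_right
           has_bochner_integral_integrable Bochner_Integration.integrable_sum i1 i2 i3)
    ultimately have "norm (\<i> * (\<integral>\<omega>. complex_of_real (Z \<omega>) * iexp (u * Z \<omega>) \<partial>M)
      + of_real u * (\<integral>\<omega>. iexp (u * Z \<omega>) \<partial>M)) = norm (integral\<^sup>L M ?f)"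
      by (simp only: mult_zero_right diff_zero)
    also have "\<dots> \<le> (\<integral>\<omega>. norm (?f \<omega>) \<partial>M)"
      by (rule integral_norm_bound)
    also have "\<dots> \<le> (\<integral>\<omega>. \<bar>u\<bar> * \<bar>1 - S \<omega>\<bar> + u\<^sup>2 * ((d * B)\<^sup>2 * sum v I / 2) \<partial>M)"
      by (rule integral_mono[OF integrable_norm[OF int_f] _ stein_pointwise])
         (intro Bochner_Integration.integrable_add integrable_mult_right i4 integrable_const)
    also have "\<dots> = \<bar>u\<bar> * c + u\<^sup>2 * (e / 2)"
      using i4 by (simp add: c_def e_def prob_space)
    finally show ?thesis .
  qed
  have "norm ((\<integral>\<omega>. iexp (t * Z \<omega>) \<partial>M) - complex_of_real (exp (- (t\<^sup>2) / 2))) \<le> \<bar>t\<bar> * (\<bar>t\<bar> * c + t\<^sup>2 * (e / 2))"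
  proof (rule gaussian_ode_comparison[OF char_bounded_has_vector_derivative[OF meas_Z bound_Z]])
    show "expectation (\<lambda>\<omega>. iexp (0 * Z \<omega>)) = 1" by (simp add: prob_space)
    fix u :: real assume u: "\<bar>u\<bar> \<le> \<bar>t\<bar>"
    have "\<bar>u\<bar> * c + u\<^sup>2 * (e / 2) \<le> \<bar>t\<bar> * c + t\<^sup>2 * (e / 2)"
      using u c0 e0 by (intro add_mono mult_right_mono) (auto simp: abs_le_square_iff)
    with key[of u] show "norm (\<i> * (\<integral>\<omega>. complex_of_real (Z \<omega>) * iexp (u * Z \<omega>) \<partial>M)
      + of_real u * (\<integral>\<omega>. iexp (u * Z \<omega>) \<partial>M)) \<le> \<bar>t\<bar> * c + t\<^sup>2 * (e / 2)"
      by linarith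
  qed
  also have "\<bar>t\<bar> * (\<bar>t\<bar> * c + t\<^sup>2 * (e / 2)) \<le> t\<^sup>2 * c + \<bar>t\<bar> ^ 3 * e"
  proof -
    have "\<bar>t\<bar> * (\<bar>t\<bar> * c + t\<^sup>2 * (e / 2)) = t\<^sup>2 * c + \<bar>t\<bar> ^ 3 * e / 2"
      unfolding power2_abs[of t, symmetric] by (simp add: algebra_simps power2_eq_square power3_eq_cube del: abs_mult_self_eq)
    moreover have "0 \<le> \<bar>t\<bar> ^ 3 * e" using e0 by simp
    ultimately show ?thesis by linarith
  qed
  finally show ?thesis unfolding c_def e_def .
qed

text \<open>The variance is a sum of covariances of products indexed by neighbour pairs, and a
  covariance vanishes when the two pairs share no innovation. For a fixed pair the union
  \<open>U\<close> of its two neighbourhoods has at most \<open>2 * d\<close> elements. A pair that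
  interacts with it has one coordinate in \<open>U\<close> and the other next to it, which leaves at
  most \<open>4 * d * d\<close> choices. Each covariance is at most \<open>2 * v * B ^ 3\<close>,
  and \<open>d\<close> choices for the second member of the fixed pair complete the factor
  \<open>8 * d ^ 3\<close>.\<close>

lemma variance_S_le: "variance S \<le> 8 * real d ^ 3 * B ^ 3 * sum v I"
proof -
  define P where "P = Sigma I nbh"
  define V where "V p \<omega> = \<xi> (fst p) \<omega> * \<xi> (snd p) \<omega>" for p \<omega>
  define AA where "AA p = A (fst p) \<union> A (snd p)" for p
  have finP: "finite P" unfolding P_def using fin finite_nbh by auto
  have PI: "fst p \<in> I" "snd p \<in> I" if "p \<in> P" for p
    using that by (auto simp: P_def nbh_def)
  have depV: "depends_on E (AA p) (V p)" if "p \<in> P" for p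
    unfolding AA_def V_def by (rule depends_on_mult) (use dep PI[OF that] in auto)
  have bV: "\<bar>V p \<omega>\<bar> \<le> v (fst p) * B" if "p \<in> P" for p \<omega>
    unfolding V_def abs_mult by (intro mult_mono bound_v bound_\<xi> v_nonneg PI[OF that]) auto
  have B0: "0 \<le> B" if "p \<in> P" for p
    using v_nonneg[OF PI(1)[OF that]] bound_B[OF PI(1)[OF that]] by linarith
  have vB0: "0 \<le> v (fst p) * B" if "p \<in> P" for p
    using bV[OF that] abs_ge_zero order_trans by blast
  have bV': "\<bar>V p \<omega>\<bar> \<le> B * B" if "p \<in> P" for p \<omega>
    by (rule order_trans[OF bV[OF that]]) (intro mult_right_mono bound_B PI[OF that] B0[OF that])
  have mV: "V p \<in> borel_measurable M" if "p \<in> P" for p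
    using depends_on_measurable[OF indep depV[OF that]] .
  have iV: "integrable M (V p)" if "p \<in> P" for p
    by (rule integrable_const_bound[of _ "v (fst p) * B"]) (use bV mV that in auto)
  have bVV: "\<bar>V p \<omega> * V q \<omega>\<bar> \<le> v (fst p) * B * (B * B)" if "p \<in> P" "q \<in> P" for p q \<omega>
    unfolding abs_mult by (intro mult_mono bV bV' vB0 that) auto
  have iVV: "integrable M (\<lambda>\<omega>. V p \<omega> * V q \<omega>)" if "p \<in> P" "q \<in> P" for p q
    by (rule integrable_const_bound[of _ "v (fst p) * B * (B * B)"]) (use bVV mV that in auto)
  have S_eq: "S \<omega> = (\<Sum>p\<in>P. V p \<omega>)" for \<omega>
    unfolding S_def P_def V_def R_def sum_distrib_left
    by (subst sum.Sigma) (use fin finite_nbh in \<open>auto simp: case_prod_beta\<close>)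
  have S2_eq: "(S \<omega>)\<^sup>2 = (\<Sum>p\<in>P. \<Sum>q\<in>P. V p \<omega> * V q \<omega>)" for \<omega>
    by (simp add: S_eq power2_eq_square sum_product)
  have iS: "integrable M S" unfolding S_eq[abs_def] using iV by auto
  have iS2: "integrable M (\<lambda>\<omega>. (S \<omega>)\<^sup>2)" unfolding S2_eq using iVV by auto
  define cv where "cv p q = expectation (\<lambda>\<omega>. V p \<omega> * V q \<omega>) - expectation (V p) * expectation (V q)" for p q
  have var: "variance S = (\<Sum>p\<in>P. \<Sum>q\<in>P. cv p q)"
  proof -
    have "expectation (\<lambda>\<omega>. (S \<omega>)\<^sup>2) = (\<Sum>p\<in>P. \<Sum>q\<in>P. expectation (\<lambda>\<omega>. V p \<omega> * V q \<omega>))"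
      unfolding S2_eq
      by (subst Bochner_Integration.integral_sum, intro Bochner_Integration.integrable_sum iVV, assumption+)
         (rule sum.cong[OF refl], rule Bochner_Integration.integral_sum, rule iVV)
    moreover have "expectation S = (\<Sum>p\<in>P. expectation (V p))"
      unfolding S_eq[abs_def] by (rule Bochner_Integration.integral_sum) (rule iV)
    ultimately show ?thesis
      unfolding variance_eq[OF iS iS2] cv_def
      by (simp add: power2_eq_square sum_product sum_subtractf)
  qed
  have cv0: "cv p q = 0" if "p \<in> P" "q \<in> P" "AA p \<inter> AA q = {}" for p q
    unfolding cv_def
    using depends_on_expectation_mult[OF indep depV[OF that(1)] depV[OF that(2)] that(3) bV[OF that(1)] bV[OF that(2)]]
    by simp
  have cv_le: "\<bar>cv p q\<bar> \<le> 2 * (v (fst p) * B ^ 3)" if "p \<in> P" "q \<in> P" for p q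
  proof -
    have "\<bar>expectation (\<lambda>\<omega>. V p \<omega> * V q \<omega>)\<bar> \<le> v (fst p) * B * (B * B)"
      by (rule abs_expectation_le) (rule bVV[OF that])
    moreover have "\<bar>expectation (V p) * expectation (V q)\<bar> \<le> v (fst p) * B * (B * B)"
      unfolding abs_mult using that vB0
      by (intro mult_mono abs_expectation_le bV bV') auto
    ultimately show ?thesis unfolding cv_def power3_eq_cube by (simp add: mult.assoc)
  qed
  have inner: "(\<Sum>q\<in>P. cv p q) \<le> 8 * real d ^ 2 * (v (fst p) * B ^ 3)" if p: "p \<in> P" for p
  proof -
    define L where "L = {q \<in> P. AA p \<inter> AA q \<noteq> {}}"
    define U where "U = nbh (fst p) \<union> nbh (snd p)"
    have U: "finite U" "U \<subseteq> I" using finite_nbh nbh_subset by (auto simp: U_def)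
    have cU: "card U \<le> 2 * d"
      unfolding U_def using card_Un_le[of "nbh (fst p)" "nbh (snd p)"] card_nbh'[OF PI(1)[OF p]] card_nbh'[OF PI(2)[OF p]]
      by linarith
    \<comment> \<open>The neighbour relation is symmetric, so a pair whose second coordinate lies in
      \<open>U\<close> is the swap of an element of \<open>Sigma U nbh\<close>.\<close>
    have L_sub: "L \<subseteq> Sigma U nbh \<union> prod.swap ` Sigma U nbh"
    proof
      fix q assume q: "q \<in> L"
      obtain g h where qq: "q = (g, h)" by (cases q)
      have gh: "g \<in> I" "h \<in> nbh g" "h \<in> I" "g \<in> nbh h"
        using q nbh_subset by (auto simp: L_def P_def qq nbh_def)
      have "g \<in> U \<or> h \<in> U"
        using q gh by (auto simp: L_def AA_def U_def nbh_def qq)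
      then show "q \<in> Sigma U nbh \<union> prod.swap ` Sigma U nbh"
        using gh by (force simp: qq image_iff)
    qed
    have cS: "card (Sigma U nbh) \<le> 2 * d * d"
    proof -
      have "card (Sigma U nbh) = (\<Sum>g\<in>U. card (nbh g))"
        using U(1) finite_nbh by simp
      also have "\<dots> \<le> (\<Sum>g\<in>U. d)" by (intro sum_mono card_nbh') (use U in auto)
      also have "\<dots> \<le> 2 * d * d" using cU by simp
      finally show ?thesis .
    qed
    have finS: "finite (Sigma U nbh)" using U finite_nbh by auto
    have "card L \<le> card (Sigma U nbh \<union> prod.swap ` Sigma U nbh)"
      by (rule card_mono[OF _ L_sub]) (use finS in auto)
    also have "\<dots> \<le> card (Sigma U nbh) + card (prod.swap ` Sigma U nbh)"
      by (rule card_Un_le)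
    also have "\<dots> \<le> 4 * d * d"
      using cS card_image_le[OF finS, of prod.swap] by linarith
    finally have "real (card L) \<le> real (4 * d * d)" by (rule of_nat_mono)
    then have cL: "real (card L) \<le> 4 * real d ^ 2"
      by (simp add: power2_eq_square)
    have nn: "0 \<le> 2 * (v (fst p) * B ^ 3)"
      using v_nonneg[OF PI(1)[OF p]] B0[OF p] by simp
    have "(\<Sum>q\<in>P. cv p q) = (\<Sum>q\<in>L. cv p q)"
      by (rule sum.mono_neutral_right) (use finP cv0[OF p] in \<open>auto simp: L_def\<close>)
    also have "\<dots> \<le> (\<Sum>q\<in>L. 2 * (v (fst p) * B ^ 3))"
      by (rule sum_mono) (use cv_le[OF p] in \<open>auto simp: L_def abs_le_iff\<close>)
    also have "\<dots> = real (card L) * (2 * (v (fst p) * B ^ 3))" by simp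
    also have "\<dots> \<le> 4 * real d ^ 2 * (2 * (v (fst p) * B ^ 3))"
      by (rule mult_right_mono[OF cL nn])
    finally show ?thesis by simp
  qed
  have "variance S \<le> (\<Sum>p\<in>P. 8 * real d ^ 2 * (v (fst p) * B ^ 3))"
    unfolding var by (rule sum_mono[OF inner])
  also have "\<dots> = (\<Sum>\<alpha>\<in>I. real (card (nbh \<alpha>)) * (8 * real d ^ 2 * (v \<alpha> * B ^ 3)))"
  proof -
    have "(\<Sum>p\<in>P. f (fst p)) = (\<Sum>\<alpha>\<in>I. \<Sum>\<beta>\<in>nbh \<alpha>. f \<alpha>)" for f :: "'a \<Rightarrow> real"
      unfolding P_def by (subst sum.Sigma) (use fin finite_nbh in \<open>auto simp: case_prod_beta\<close>)
    from this[of "\<lambda>\<alpha>. 8 * real d ^ 2 * (v \<alpha> * B ^ 3)"] show ?thesis by simp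
  qed
  also have "\<dots> \<le> (\<Sum>\<alpha>\<in>I. real d * (8 * real d ^ 2 * (v \<alpha> * B ^ 3)))"
  proof (intro sum_mono mult_right_mono)
    fix \<alpha> assume a: "\<alpha> \<in> I"
    show "real (card (nbh \<alpha>)) \<le> real d" using card_nbh'[OF a] by simp
    have "0 \<le> B" using v_nonneg[OF a] bound_B[OF a] by linarith
    then show "0 \<le> 8 * real d ^ 2 * (v \<alpha> * B ^ 3)" using v_nonneg[OF a] by simp
  qed
  also have "\<dots> = 8 * real d ^ 3 * B ^ 3 * sum v I"
    by (simp add: sum_distrib_left sum_distrib_right power3_eq_cube power2_eq_square algebra_simps)
  finally show ?thesis .
qed

lemma expectation_S: "expectation S = (\<Sum>\<alpha>\<in>I. \<Sum>\<beta>\<in>nbh \<alpha>. expectation (\<lambda>\<omega>. \<xi> \<alpha> \<omega> * \<xi> \<beta> \<omega>))"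
proof -
  have i: "integrable M (\<lambda>\<omega>. \<xi> \<alpha> \<omega> * \<xi> \<beta> \<omega>)" if "\<alpha> \<in> I" "\<beta> \<in> nbh \<alpha>" for \<alpha> \<beta>
  proof (rule integrable_const_bound[of _ "B * B"])
    have b: "\<beta> \<in> I" using that nbh_subset by auto
    show "AE \<omega> in M. norm (\<xi> \<alpha> \<omega> * \<xi> \<beta> \<omega>) \<le> B * B"
      using bound_\<xi>[OF that(1)] bound_\<xi>[OF b] by (intro AE_I2) (auto simp: abs_mult intro!: mult_mono intro: order_trans[OF abs_ge_zero])
    show "(\<lambda>\<omega>. \<xi> \<alpha> \<omega> * \<xi> \<beta> \<omega>) \<in> borel_measurable M"
      using meas_\<xi>[OF that(1)] meas_\<xi>[OF b] by simp
  qed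
  have "expectation S = (\<Sum>\<alpha>\<in>I. expectation (\<lambda>\<omega>. \<Sum>\<beta>\<in>nbh \<alpha>. \<xi> \<alpha> \<omega> * \<xi> \<beta> \<omega>))"
    unfolding S_def[abs_def] R_def sum_distrib_left
    by (rule Bochner_Integration.integral_sum) (intro Bochner_Integration.integrable_sum i)
  also have "\<dots> = (\<Sum>\<alpha>\<in>I. \<Sum>\<beta>\<in>nbh \<alpha>. expectation (\<lambda>\<omega>. \<xi> \<alpha> \<omega> * \<xi> \<beta> \<omega>))"
    by (rule sum.cong[OF refl]) (rule Bochner_Integration.integral_sum, rule i)
  finally show ?thesis .
qed

text \<open>The double sum is the mean of \<open>S\<close>, hence the variance of the normalised
  sum. In the application \<open>B\<close> is of order \<open>1 / sqrt (N b)\<close> and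
  \<open>sum v I\<close> of order \<open>sqrt (N b)\<close>, so the square root is of order
  \<open>sqrt (d^3 / (N b))\<close> and the cubic term of order
  \<open>d^2 / sqrt (N b)\<close>.\<close>

theorem clt_bound:
  "norm ((\<integral>\<omega>. iexp (t * (\<Sum>\<alpha>\<in>I. \<xi> \<alpha> \<omega>)) \<partial>M) - complex_of_real (exp (- (t\<^sup>2) / 2)))
    \<le> t\<^sup>2 * (\<bar>(\<Sum>\<alpha>\<in>I. \<Sum>\<beta>\<in>{\<beta> \<in> I. A \<alpha> \<inter> A \<beta> \<noteq> {}}. expectation (\<lambda>\<omega>. \<xi> \<alpha> \<omega> * \<xi> \<beta> \<omega>)) - 1\<bar>
        + sqrt (8 * real d ^ 3 * B ^ 3 * sum v I)) + \<bar>t\<bar> ^ 3 * ((d * B)\<^sup>2 * sum v I)"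
proof -
  have "expectation (\<lambda>\<omega>. \<bar>1 - S \<omega>\<bar>) \<le> \<bar>expectation S - 1\<bar> + sqrt (variance S)"
    by (rule expectation_abs_diff_le[OF meas_S bound_S])
  also have "\<dots> \<le> \<bar>expectation S - 1\<bar> + sqrt (8 * real d ^ 3 * B ^ 3 * sum v I)"
    using variance_S_le by simp
  finally have "t\<^sup>2 * expectation (\<lambda>\<omega>. \<bar>1 - S \<omega>\<bar>)
      \<le> t\<^sup>2 * (\<bar>expectation S - 1\<bar> + sqrt (8 * real d ^ 3 * B ^ 3 * sum v I))"
    by (rule mult_left_mono) simp
  with char_diff_le[of t] show ?thesis
    unfolding expectation_S nbh_def Z_def by linarith
qed

end

section \<open>Weighted medians and Riemann sums over the design\<close>

lemma weighted_sign_eq: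
  "2 * (u - v) * (of_bool (z \<le> \<theta>) - 1 / 2) = (if z \<le> \<theta> then u - v else v - (u :: real))"
  by (simp add: field_simps)

text \<open>If \<open>q\<close> exceeded \<theta>, moving from \<theta> to \<open>q\<close> would
  raise the loss of each datum \<open>y \<le> \<theta>\<close> by exactly
  \<open>q - \<theta>\<close> and lower the loss of any other datum by at most that amount. A
  positive sign statistic then makes the total loss at \<open>q\<close> strictly larger than at
  \<theta>.\<close>

lemma weighted_median_le:
  fixes y w :: "'a \<Rightarrow> real"
  assumes w: "\<And>\<alpha>. \<alpha> \<in> I \<Longrightarrow> 0 \<le> w \<alpha>"
    and min: "\<And>\<theta>. (\<Sum>\<alpha>\<in>I. \<bar>y \<alpha> - q\<bar> * w \<alpha>) \<le> (\<Sum>\<alpha>\<in>I. \<bar>y \<alpha> - \<theta>\<bar> * w \<alpha>)"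
    and pos: "(\<Sum>\<alpha>\<in>I. w \<alpha> * (of_bool (y \<alpha> \<le> \<theta>) - 1 / 2)) > 0"
  shows "q \<le> \<theta>"
proof (rule ccontr)
  assume "\<not> q \<le> \<theta>"
  then have q: "q > \<theta>" by simp
  have "2 * (q - \<theta>) * (\<Sum>\<alpha>\<in>I. w \<alpha> * (of_bool (y \<alpha> \<le> \<theta>) - 1 / 2))
     = (\<Sum>\<alpha>\<in>I. (2 * (q - \<theta>) * (of_bool (y \<alpha> \<le> \<theta>) - 1 / 2)) * w \<alpha>)"
    by (simp add: sum_distrib_left algebra_simps)
  also have "\<dots> \<le> (\<Sum>\<alpha>\<in>I. (\<bar>y \<alpha> - q\<bar> - \<bar>y \<alpha> - \<theta>\<bar>) * w \<alpha>)"
  proof (intro sum_mono mult_right_mono w)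
    fix \<alpha>
    show "2 * (q - \<theta>) * (of_bool (y \<alpha> \<le> \<theta>) - 1 / 2) \<le> \<bar>y \<alpha> - q\<bar> - \<bar>y \<alpha> - \<theta>\<bar>"
      unfolding weighted_sign_eq using q by (auto simp: abs_if)
  qed
  also have "\<dots> = (\<Sum>\<alpha>\<in>I. \<bar>y \<alpha> - q\<bar> * w \<alpha>) - (\<Sum>\<alpha>\<in>I. \<bar>y \<alpha> - \<theta>\<bar> * w \<alpha>)"
    by (simp add: left_diff_distrib sum_subtractf)
  also have "\<dots> \<le> 0" using min[of \<theta>] by simp
  finally show False using pos q by (simp add: mult_le_0_iff)
qed

text \<open>If the statistic at \<theta> were negative, the loss would still be decreasing to the
  right of \<theta>, as far as the next datum. A point \<theta>' in that gap therefore beats any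
  \<open>q \<le> \<theta>\<close>. The conclusion is not strict because a weighted median need not
  be unique.\<close>

lemma weighted_median_ge:
  fixes y w :: "'a \<Rightarrow> real"
  assumes fin: "finite I" and w: "\<And>\<alpha>. \<alpha> \<in> I \<Longrightarrow> 0 \<le> w \<alpha>"
    and min: "\<And>\<theta>. (\<Sum>\<alpha>\<in>I. \<bar>y \<alpha> - q\<bar> * w \<alpha>) \<le> (\<Sum>\<alpha>\<in>I. \<bar>y \<alpha> - \<theta>\<bar> * w \<alpha>)"
    and q: "q \<le> \<theta>"
  shows "(\<Sum>\<alpha>\<in>I. w \<alpha> * (of_bool (y \<alpha> \<le> \<theta>) - 1 / 2)) \<ge> 0"
proof (rule ccontr)
  assume neg: "\<not> ?thesis"
  \<comment> \<open>\<theta>' must lie beyond \<theta> without passing a datum. The element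
    \<open>\<theta> + 1\<close> keeps the set nonempty when no datum exceeds \<theta>.\<close>
  define J where "J = insert (\<theta> + 1) (y ` {\<alpha> \<in> I. y \<alpha> > \<theta>})"
  define \<theta>' where "\<theta>' = Min J"
  have J: "finite J" "J \<noteq> {}" using fin by (auto simp: J_def)
  have "\<theta>' > \<theta>" unfolding \<theta>'_def using J by (subst Min_gr_iff) (auto simp: J_def)
  have J_le: "\<theta>' \<le> y \<alpha>" if "\<alpha> \<in> I" "y \<alpha> > \<theta>" for \<alpha>
    unfolding \<theta>'_def using J that by (intro Min_le) (auto simp: J_def)
  have "0 \<le> (\<Sum>\<alpha>\<in>I. \<bar>y \<alpha> - \<theta>'\<bar> * w \<alpha>) - (\<Sum>\<alpha>\<in>I. \<bar>y \<alpha> - q\<bar> * w \<alpha>)"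
    using min[of \<theta>'] by simp
  also have "\<dots> = (\<Sum>\<alpha>\<in>I. (\<bar>y \<alpha> - \<theta>'\<bar> - \<bar>y \<alpha> - q\<bar>) * w \<alpha>)"
    by (simp add: left_diff_distrib sum_subtractf)
  also have "\<dots> \<le> (\<Sum>\<alpha>\<in>I. (2 * (\<theta>' - q) * (of_bool (y \<alpha> \<le> \<theta>) - 1 / 2)) * w \<alpha>)"
  proof (intro sum_mono mult_right_mono w)
    fix \<alpha> assume "\<alpha> \<in> I"
    then show "\<bar>y \<alpha> - \<theta>'\<bar> - \<bar>y \<alpha> - q\<bar> \<le> 2 * (\<theta>' - q) * (of_bool (y \<alpha> \<le> \<theta>) - 1 / 2)"
      unfolding weighted_sign_eq using q \<open>\<theta>' > \<theta>\<close> J_le[of \<alpha>] by (auto simp: abs_if)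
  qed
  also have "\<dots> = 2 * (\<theta>' - q) * (\<Sum>\<alpha>\<in>I. w \<alpha> * (of_bool (y \<alpha> \<le> \<theta>) - 1 / 2))"
    by (simp add: sum_distrib_left algebra_simps)
  finally show False using neg q \<open>\<theta>' > \<theta>\<close> by (simp add: zero_le_mult_iff)
qed

text \<open>The three errors come from cells whose length differs from \<open>d\<close>, from the
  variation of \<phi> within a cell, and from the last cell. The second is charged only near the
  support \<open>{l..r}\<close>: in the application \<Lambda> is of order \<open>1 / bw n\<close>,
  and only a support of length of order \<open>bw n\<close> compensates for it. Charging the whole
  interval would lose that factor.\<close>

lemma riemann_sum_error:
  fixes p :: "nat \<Rightarrow> real" and \<phi> :: "real \<Rightarrow> real"
  assumes p0: "p 0 = a" and pN: "p (Suc N) = b"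
    and mono: "\<And>k. k \<le> N \<Longrightarrow> p k \<le> p (Suc k)"
    and gap: "\<And>k. k \<le> N \<Longrightarrow> \<bar>p (Suc k) - p k - d\<bar> \<le> e"
    and d: "0 < d" and e: "e \<le> d"
    and lip: "\<And>u v. u \<in> {a..b} \<Longrightarrow> v \<in> {a..b} \<Longrightarrow> \<bar>\<phi> u - \<phi> v\<bar> \<le> \<Lambda> * \<bar>u - v\<bar>"
    and bound: "\<And>u. u \<in> {a..b} \<Longrightarrow> \<bar>\<phi> u\<bar> \<le> S"
    and supp: "\<And>u. u \<in> {a..b} \<Longrightarrow> u \<notin> {l..r} \<Longrightarrow> \<phi> u = 0"
    and lr: "l \<le> r" and L: "0 \<le> \<Lambda>"
  shows "\<bar>d * (\<Sum>k=1..N. \<phi> (p k)) - integral {a..b} \<phi>\<bar>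
     \<le> real N * (e * S) + 2 * d * \<Lambda> * (r - l + 4 * d) + 2 * d * S"
proof -
  have e0: "0 \<le> e" using gap[of 0] by linarith
  have p_mono: "p i \<le> p j" if "i \<le> j" "j \<le> Suc N" for i j
    using that
  proof (induction j rule: dec_induct)
    case (step j)
    then show ?case using mono[of j] by simp
  qed simp
  have p_in: "p k \<in> {a..b}" if "k \<le> Suc N" for k
    using p_mono[of 0 k] p_mono[of k "Suc N"] that p0 pN by auto
  have S0: "0 \<le> S" using bound[OF p_in[of 0]] by (auto intro: order_trans[OF abs_ge_zero])
  have cont: "continuous_on {a..b} \<phi>"
    by (rule lipschitz_on_continuous_on[of \<Lambda>]) (auto simp: lipschitz_on_def dist_real_def lip L)
  have int: "\<phi> integrable_on {u..v}" if "a \<le> u" "v \<le> b" for u v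
    by (rule integrable_continuous_interval[OF continuous_on_subset[OF cont]]) (use that in auto)
  \<comment> \<open>Intervals that miss \<open>{l..r}\<close> contribute no error; the length of every other one is an increment
    of \<open>clamp\<close>, and these increments telescope.\<close>
  define clamp where "clamp u = min (r + 2 * d) (max (l - 2 * d) u)" for u
  have clamp_mono: "clamp u \<le> clamp v" if "u \<le> v" for u v
    using that by (auto simp: clamp_def)
  have split: "integral {a..p k} \<phi> = (\<Sum>j<k. integral {p j..p (Suc j)} \<phi>)" if "k \<le> Suc N" for k
    using that
  proof (induction k)
    case 0
    then show ?case by (simp add: p0)
  next
    case (Suc k)
    have "integral {a..p (Suc k)} \<phi> = integral {a..p k} \<phi> + integral {p k..p (Suc k)} \<phi>"
      by (rule Henstock_Kurzweil_Integration.integral_combine[symmetric])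
         (use Suc p_in[of k] p_in[of "Suc k"] mono[of k] int in auto)
    then show ?case using Suc by simp
  qed
  have step: "\<bar>d * \<phi> (p (Suc k)) - integral {p k..p (Suc k)} \<phi>\<bar>
      \<le> e * S + 2 * d * \<Lambda> * (clamp (p (Suc k)) - clamp (p k))" if k: "k < N" for k
  proof -
    define u v where "u = p k" and "v = p (Suc k)"
    have uv: "u \<le> v" "u \<in> {a..b}" "v \<in> {a..b}" and g: "\<bar>v - u - d\<bar> \<le> e"
      using k mono[of k] p_in[of k] p_in[of "Suc k"] gap[of k] by (auto simp: u_def v_def)
    have vu: "v - u \<le> 2 * d" using g e by linarith
    have i1: "\<phi> integrable_on {u..v}" using int uv by auto
    have eq: "d * \<phi> v - integral {u..v} \<phi> = (d - (v - u)) * \<phi> v + integral {u..v} (\<lambda>t. \<phi> v - \<phi> t)"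
      using i1 uv by (subst Henstock_Kurzweil_Integration.integral_diff) (auto simp: algebra_simps)
    have 1: "\<bar>(d - (v - u)) * \<phi> v\<bar> \<le> e * S"
      unfolding abs_mult using g bound uv e0 by (intro mult_mono) auto
    have 2: "\<bar>integral {u..v} (\<lambda>t. \<phi> v - \<phi> t)\<bar> \<le> 2 * d * \<Lambda> * (clamp v - clamp u)"
    proof (cases "v < l \<or> r < u")
      case True
      have "integral {u..v} (\<lambda>t. \<phi> v - \<phi> t) = integral {u..v} (\<lambda>_. 0)"
        by (rule Henstock_Kurzweil_Integration.integral_cong) (use True uv supp in auto)
      then show ?thesis using clamp_mono[OF uv(1)] L d by simp
    next
      case False
      have cl: "clamp v - clamp u = v - u" using False vu uv lr by (auto simp: clamp_def)
      have "norm (integral (cbox u v) (\<lambda>t. \<phi> v - \<phi> t)) \<le> 2 * d * \<Lambda> * measure lborel (cbox u v)"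
      proof (rule integrable_bound)
        show "0 \<le> 2 * d * \<Lambda>" using d L by simp
        show "(\<lambda>t. \<phi> v - \<phi> t) integrable_on cbox u v"
          using i1 by (intro Henstock_Kurzweil_Integration.integrable_diff) auto
        fix t assume t: "t \<in> cbox u v"
        then have "\<bar>\<phi> v - \<phi> t\<bar> \<le> \<Lambda> * \<bar>v - t\<bar>" using uv by (intro lip) auto
        also have "\<dots> \<le> \<Lambda> * (2 * d)" using t vu L by (intro mult_left_mono) auto
        finally show "norm (\<phi> v - \<phi> t) \<le> 2 * d * \<Lambda>" by (simp add: mult_ac)
      qed
      then show ?thesis using uv by (simp add: cl)
    qed
    show ?thesis using eq 1 2 unfolding u_def[symmetric] v_def[symmetric] by linarith
  qed
  \<comment> \<open>The nodes are the right end points of their cells, and the sum omits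
    \<open>b\<close> because it is not a design point. The last cell is therefore bounded by its
    length alone.\<close>
  have last: "\<bar>integral {p N..p (Suc N)} \<phi>\<bar> \<le> 2 * d * S"
  proof -
    have "norm (integral (cbox (p N) (p (Suc N))) \<phi>) \<le> S * measure lborel (cbox (p N) (p (Suc N)))"
    proof (rule integrable_bound[OF S0])
      show "\<phi> integrable_on cbox (p N) (p (Suc N))"
        using int[of "p N" "p (Suc N)"] p_in[of N] p_in[of "Suc N"] by auto
      show "norm (\<phi> t) \<le> S" if "t \<in> cbox (p N) (p (Suc N))" for t
        using that bound[of t] p_in[of N] p_in[of "Suc N"] by auto
    qed
    also have "\<dots> \<le> S * (2 * d)"
      using gap[of N] e mono[of N] S0 by (intro mult_left_mono) auto
    finally show ?thesis by (simp add: mult_ac)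
  qed
  have "integral {a..b} \<phi> = (\<Sum>j<N. integral {p j..p (Suc j)} \<phi>) + integral {p N..p (Suc N)} \<phi>"
    using split[of "Suc N"] pN by simp
  moreover have "d * (\<Sum>k=1..N. \<phi> (p k)) = (\<Sum>j<N. d * \<phi> (p (Suc j)))"
    by (simp add: sum_distrib_left sum.atLeast1_atMost_eq)
  ultimately have "d * (\<Sum>k=1..N. \<phi> (p k)) - integral {a..b} \<phi>
     = (\<Sum>j<N. d * \<phi> (p (Suc j)) - integral {p j..p (Suc j)} \<phi>) - integral {p N..p (Suc N)} \<phi>"
    by (simp add: sum_subtractf)
  then have "\<bar>d * (\<Sum>k=1..N. \<phi> (p k)) - integral {a..b} \<phi>\<bar>
     \<le> \<bar>\<Sum>j<N. d * \<phi> (p (Suc j)) - integral {p j..p (Suc j)} \<phi>\<bar> + \<bar>integral {p N..p (Suc N)} \<phi>\<bar>"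
    by linarith
  also have "\<bar>\<Sum>j<N. d * \<phi> (p (Suc j)) - integral {p j..p (Suc j)} \<phi>\<bar>
     \<le> (\<Sum>j<N. e * S + 2 * d * \<Lambda> * (clamp (p (Suc j)) - clamp (p j)))"
    by (rule order_trans[OF sum_abs sum_mono]) (use step in auto)
  also have "\<dots> = real N * (e * S) + 2 * d * \<Lambda> * (clamp (p N) - clamp (p 0))"
    by (simp add: sum.distrib sum_distrib_left[symmetric] sum_lessThan_telescope[of "\<lambda>j. clamp (p j)"])
  also have "\<dots> \<le> real N * (e * S) + 2 * d * \<Lambda> * (r - l + 4 * d)"
    using d L lr by (intro add_left_mono mult_left_mono) (auto simp: clamp_def)
  finally show ?thesis using last by linarith
qed

section \<open>Sums over the design points as Riemann sums\<close>

definition obs :: "(nat \<Rightarrow> nat \<Rightarrow> nat) \<Rightarrow> nat \<Rightarrow> (nat \<times> nat) set" where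
  "obs m n = Sigma {1..n} (\<lambda>i. {1..m n i})"

lemma finite_obs [simp]: "finite (obs m n)"
  by (simp add: obs_def)

lemma sum_obs: "(\<Sum>\<alpha>\<in>obs m n. f (fst \<alpha>) (snd \<alpha>)) = (\<Sum>i=1..n. \<Sum>j=1..m n i. f i j)"
  unfolding obs_def by (subst sum.Sigma) (auto simp: case_prod_beta)

lemma card_obs: "card (obs m n) = N_obs m n"
  by (simp add: obs_def N_obs_def)

lemma sum_list_concat: "sum_list (concat xss) = sum_list (map sum_list xss)"
  by (induction xss) auto

lemma sum_obs_eq_sum_list:
  fixes \<phi> :: "real \<Rightarrow> real"
  shows "(\<Sum>\<alpha>\<in>obs m n. \<phi> (X n (fst \<alpha>) (snd \<alpha>)))
    = sum_list (map \<phi> [X n i j. i \<leftarrow> [1..<Suc n], j \<leftarrow> [1..<Suc (m n i)]])"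
proof -
  have *: "sum_list (map f [1..<Suc k]) = (\<Sum>i=1..k. f i)" for f :: "nat \<Rightarrow> real" and k
    by (simp only: interv_sum_list_conv_sum_set_nat set_upt atLeastLessThanSuc_atLeastAtMost)
  show ?thesis
    unfolding sum_obs[where f="\<lambda>i j. \<phi> (X n i j)"] map_concat sum_list_concat map_map comp_def *[symmetric]
    by simp
qed

lemma length_ordered_design: "length (ordered_design a b m X n) = N_obs m n + 2"
proof -
  have "length [X n i j. i \<leftarrow> [1..<Suc n], j \<leftarrow> [1..<Suc (m n i)]] = (\<Sum>i\<leftarrow>[1..<Suc n]. m n i)"
    by (simp add: length_concat comp_def del: upt_Suc)
  also have "\<dots> = N_obs m n"
    unfolding N_obs_def
    by (simp only: interv_sum_list_conv_sum_set_nat set_upt atLeastLessThanSuc_atLeastAtMost)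
  finally show ?thesis by (simp add: ordered_design_def del: upt_Suc)
qed

lemma ordered_design_ends:
  "ordered_design a b m X n ! 0 = a" "ordered_design a b m X n ! Suc (N_obs m n) = b"
proof -
  have "ordered_design a b m X n ! (length (ordered_design a b m X n) - 1) = b"
    unfolding ordered_design_def by (subst last_conv_nth[symmetric]) auto
  then show "ordered_design a b m X n ! Suc (N_obs m n) = b"
    by (simp add: length_ordered_design)
qed (simp add: ordered_design_def)

lemma sum_obs_ordered_design:
  fixes \<phi> :: "real \<Rightarrow> real"
  shows "(\<Sum>\<alpha>\<in>obs m n. \<phi> (X n (fst \<alpha>) (snd \<alpha>)))
    = (\<Sum>k=1..N_obs m n. \<phi> (ordered_design a b m X n ! k))"
proof -
  define xs where "xs = [X n i j. i \<leftarrow> [1..<Suc n], j \<leftarrow> [1..<Suc (m n i)]]"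
  have od: "ordered_design a b m X n = a # sort xs @ [b]"
    by (simp only: ordered_design_def xs_def)
  have len: "length (sort xs) = N_obs m n"
    using length_ordered_design[of a b m X n] by (simp add: od)
  have "(\<Sum>\<alpha>\<in>obs m n. \<phi> (X n (fst \<alpha>) (snd \<alpha>))) = sum_list (map \<phi> xs)"
    by (simp only: sum_obs_eq_sum_list xs_def)
  also have "\<dots> = sum_list (map \<phi> (sort xs))"
    by (simp only: sum_mset_sum_list[symmetric] mset_map mset_sort)
  also have "\<dots> = (\<Sum>k<N_obs m n. \<phi> (sort xs ! k))"
    by (simp add: sum_list_sum_nth len[symmetric] lessThan_atLeast0)
  also have "\<dots> = (\<Sum>k<N_obs m n. \<phi> (ordered_design a b m X n ! Suc k))"
    by (rule sum.cong) (auto simp: od nth_append len[symmetric])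
  finally show ?thesis by (simp add: sum.atLeast1_atMost_eq)
qed

text \<open>Substitution \<open>u = x + c * v\<close>. The scaled support lies inside
  \<open>{a..b}\<close>, so an interior point \<open>x\<close> sees no boundary effect and enlarging
  the domain of integration adds only zeros.\<close>

lemma integral_scaled_kernel:
  fixes H g :: "real \<Rightarrow> real"
  assumes c: "c > 0" and R: "R > 0" and sub: "a \<le> x - c * R" "x + c * R \<le> b"
    and H: "continuous_on {- R..R} H" and g: "continuous_on {a..b} g"
    and supp: "\<And>v. R \<le> \<bar>v\<bar> \<Longrightarrow> H v = 0"
  shows "integral {a..b} (\<lambda>u. H ((u - x) / c) * g u) = c * integral {- R..R} (\<lambda>v. H v * g (x + c * v))"
proof -
  define I where "I = integral {- R..R} (\<lambda>v. H v * g (x + c * v))"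
  have in_ab: "x + c * v \<in> {a..b}" if "v \<in> {-R..R}" for v
  proof -
    have "\<bar>c * v\<bar> \<le> c * R" using that c by (auto simp: abs_mult intro!: mult_left_mono)
    then show ?thesis using sub by auto
  qed
  have "continuous_on {-R..R} (\<lambda>v. H v * g (x + c * v))"
    by (intro continuous_on_mult H continuous_on_compose2[OF g] continuous_intros) (use in_ab in auto)
  then have "((\<lambda>v. H v * g (x + c * v)) has_integral I) (cbox (- R) R)"
    unfolding I_def by (auto intro!: integrable_integral integrable_continuous_interval)
  from has_integral_affinity[OF this, of "1 / c" "- (x / c)"]
  have "((\<lambda>u. H (u / c - x / c) * g (x + c * (u / c - x / c))) has_integral (c * I))
      ((\<lambda>u. c * u + x) ` {- R..R})"
    using c by simp
  moreover have "(\<lambda>u. c * u + x) ` {- R..R} = {x - c * R..x + c * R}"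
    using c R image_affinity_atLeastAtMost[of c x "- R" R] by (simp add: add.commute)
  moreover have "(\<lambda>u. H (u / c - x / c) * g (x + c * (u / c - x / c))) = (\<lambda>u. H ((u - x) / c) * g u)"
    using c by (auto simp: fun_eq_iff diff_divide_distrib[symmetric])
  ultimately have "((\<lambda>u. H ((u - x) / c) * g u) has_integral (c * I)) {x - c * R..x + c * R}"
    by simp
  then have "((\<lambda>u. H ((u - x) / c) * g u) has_integral (c * I)) {a..b}"
  proof (rule has_integral_on_superset)
    fix u assume "u \<notin> {x - c * R..x + c * R}"
    then have "R \<le> \<bar>(u - x) / c\<bar>" using c by (auto simp: abs_if field_simps)
    then show "H ((u - x) / c) * g u = 0" using supp by simp
  qed (use sub in auto)
  then show ?thesis unfolding I_def by (rule integral_unique)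
qed

locale dense_design =
  fixes a b x :: real and m :: "nat \<Rightarrow> nat \<Rightarrow> nat" and X :: "nat \<Rightarrow> nat \<Rightarrow> nat \<Rightarrow> real"
    and bw :: "nat \<Rightarrow> real"
  assumes ab: "a < b" and x_in: "a < x" "x < b" and bw_pos: "\<And>n. bw n > 0"
    and bw_0: "bw \<longlonglongrightarrow> 0"
    and Nbw: "filterlim (\<lambda>n. real (N_obs m n) * bw n) at_top sequentially"
    and N_top: "filterlim (N_obs m) at_top sequentially"
    and X: "cond_X a b m X"
begin

abbreviation "N n \<equiv> real (N_obs m n)"

lemma X_in: "\<alpha> \<in> obs m n \<Longrightarrow> X n (fst \<alpha>) (snd \<alpha>) \<in> {a..b}"
  using X by (auto simp: cond_X_def obs_def)

lemma N_real_top: "filterlim N at_top sequentially"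
  by (rule filterlim_compose[OF filterlim_real_sequentially N_top])

lemma eventually_N_ge: "eventually (\<lambda>n. c \<le> N n) sequentially"
  using N_real_top by (simp add: filterlim_at_top)

lemma eventually_Nbw_ge: "eventually (\<lambda>n. c \<le> N n * bw n) sequentially"
  using Nbw by (simp add: filterlim_at_top)

lemma eventually_bw_le: "c > 0 \<Longrightarrow> eventually (\<lambda>n. bw n \<le> c) sequentially"
  by (rule eventually_mono[OF order_tendstoD(2)[OF bw_0]]) auto

lemma gap_bound:
  obtains C where "C \<ge> 0" "\<forall>\<^sub>F n in sequentially. \<forall>k\<le>N_obs m n.
    \<bar>ordered_design a b m X n ! Suc k - ordered_design a b m X n ! k - (b - a) / N n\<bar> \<le> C / (N n)\<^sup>2"
proof -
  let ?g = "\<lambda>n k. \<bar>ordered_design a b m X n ! Suc k - ordered_design a b m X n ! k - (b - a) / N n\<bar>"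
  have "(\<lambda>n. MAX k\<in>{0..N_obs m n}. ?g n k) \<in> O(\<lambda>n. 1 / (N n)\<^sup>2)"
    using X by (simp add: cond_X_def)
  then obtain C where C: "C > 0"
    and ev: "\<forall>\<^sub>F n in sequentially. norm (MAX k\<in>{0..N_obs m n}. ?g n k) \<le> C * norm (1 / (N n)\<^sup>2)"
    by (elim landau_o.bigE) auto
  have "\<forall>\<^sub>F n in sequentially. \<forall>k\<le>N_obs m n. ?g n k \<le> C / (N n)\<^sup>2"
    using ev
  proof eventually_elim
    case (elim n)
    show ?case
    proof (intro allI impI)
      fix k assume k: "k \<le> N_obs m n"
      have "?g n k \<le> (MAX k\<in>{0..N_obs m n}. ?g n k)"
        by (rule Max_ge) (use k in auto)
      also have "\<dots> \<le> C / (N n)\<^sup>2"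
        using elim by (simp add: abs_le_iff)
      finally show "?g n k \<le> C / (N n)\<^sup>2" .
    qed
  qed
  with C show thesis by (intro that[of C]) auto
qed

text \<open>One constant and one threshold in \<open>n\<close> serve every \<open>g\<close> with the
  given bounds; this matters because \<open>g\<close> will itself depend on \<open>n\<close> through
  the shift of the location. The error stays bounded while the main term has order
  \<open>N n * bw n\<close>: the Lipschitz constant of the scaled integrand grows like
  \<open>1 / bw n\<close>, but it acts only on a support of length of order
  \<open>bw n\<close>.\<close>

lemma kernel_sum_approx:
  fixes H :: "real \<Rightarrow> real"
  assumes R: "R > 0" and H_supp: "\<And>v. R \<le> \<bar>v\<bar> \<Longrightarrow> H v = 0"
    and H_bound: "\<And>v. \<bar>H v\<bar> \<le> SH" and H_lip: "\<And>u v. \<bar>H u - H v\<bar> \<le> LH * \<bar>u - v\<bar>"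
    and nonneg: "0 \<le> LH" "0 \<le> Sg" "0 \<le> Lg"
  shows "\<exists>C. \<forall>\<^sub>F n in sequentially. \<forall>g.
    (\<forall>u\<in>{a..b}. \<bar>g u\<bar> \<le> Sg) \<longrightarrow> (\<forall>u\<in>{a..b}. \<forall>v\<in>{a..b}. \<bar>g u - g v\<bar> \<le> Lg * \<bar>u - v\<bar>) \<longrightarrow>
    \<bar>(\<Sum>\<alpha>\<in>obs m n. K_bw H (bw n) (X n (fst \<alpha>) (snd \<alpha>) - x) * g (X n (fst \<alpha>) (snd \<alpha>)))
      - N n * bw n / (b - a) * integral {- R..R} (\<lambda>v. H v * g (x + bw n * v))\<bar> \<le> C"
proof -
  obtain C0 where C0: "C0 \<ge> 0" and gap: "\<forall>\<^sub>F n in sequentially. \<forall>k\<le>N_obs m n.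
    \<bar>ordered_design a b m X n ! Suc k - ordered_design a b m X n ! k - (b - a) / N n\<bar> \<le> C0 / (N n)\<^sup>2"
    by (rule gap_bound)
  define Q where "Q = SH * Lg + LH * Sg"
  have SH: "0 \<le> SH" using H_bound[of 0] by linarith
  have Q: "0 \<le> Q" unfolding Q_def using SH nonneg by simp
  define C where "C = C0 * (SH * Sg) / (b - a) + 2 * (Q * (2 * R + 4)) + 2 * (SH * Sg)"
  define r0 where "r0 = min (x - a) (b - x) / R"
  have r0: "r0 > 0" using x_in R by (simp add: r0_def)
  \<comment> \<open>\<open>N2\<close> bounds the deviation of a gap by the mesh
    \<open>d = (b - a) / N n\<close>, \<open>N3\<close> makes the mesh at most the bandwidth,
    \<open>N4\<close> absorbs the Lipschitz part of \<open>g\<close> into \<open>Q\<close>, and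
    \<open>N5\<close> keeps the scaled support inside \<open>{a..b}\<close>.\<close>
  have N1: "\<forall>\<^sub>F n in sequentially. 1 \<le> N n" by (rule eventually_N_ge)
  have N2: "\<forall>\<^sub>F n in sequentially. C0 / (b - a) \<le> N n" by (rule eventually_N_ge)
  have N3: "\<forall>\<^sub>F n in sequentially. b - a \<le> N n * bw n" by (rule eventually_Nbw_ge)
  have N4: "\<forall>\<^sub>F n in sequentially. bw n \<le> 1" by (rule eventually_bw_le) simp
  have N5: "\<forall>\<^sub>F n in sequentially. bw n \<le> r0" by (rule eventually_bw_le[OF r0])
  show ?thesis
  proof (rule exI[of _ C])
    show "\<forall>\<^sub>F n in sequentially. \<forall>g.
    (\<forall>u\<in>{a..b}. \<bar>g u\<bar> \<le> Sg) \<longrightarrow> (\<forall>u\<in>{a..b}. \<forall>v\<in>{a..b}. \<bar>g u - g v\<bar> \<le> Lg * \<bar>u - v\<bar>) \<longrightarrow>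
    \<bar>(\<Sum>\<alpha>\<in>obs m n. K_bw H (bw n) (X n (fst \<alpha>) (snd \<alpha>) - x) * g (X n (fst \<alpha>) (snd \<alpha>)))
      - N n * bw n / (b - a) * integral {- R..R} (\<lambda>v. H v * g (x + bw n * v))\<bar> \<le> C"
      using gap N1 N2 N3 N4 N5
    proof eventually_elim
      case (elim n)
      note gap_n = elim(1) and Nn = elim(2-6)
      show ?case
      proof (intro allI impI)
        fix g assume gS: "\<forall>u\<in>{a..b}. \<bar>g u\<bar> \<le> Sg"
          and gL: "\<forall>u\<in>{a..b}. \<forall>v\<in>{a..b}. \<bar>g u - g v\<bar> \<le> Lg * \<bar>u - v\<bar>"
        define c where "c = bw n"
        have c: "c > 0" using bw_pos by (simp add: c_def)
        define d where "d = (b - a) / N n"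
        have d: "d > 0" using ab Nn(1) by (simp add: d_def)
        define p where "p k = ordered_design a b m X n ! k" for k
        define \<phi> where "\<phi> u = H ((u - x) / c) * g u" for u
        define \<Lambda> where "\<Lambda> = SH * Lg + LH / c * Sg"
        have \<Lambda>0: "0 \<le> \<Lambda>" unfolding \<Lambda>_def using SH nonneg c by simp
        have ci: "c * R \<le> x - a" "c * R \<le> b - x"
          using Nn(5) R by (auto simp: c_def r0_def field_simps)
        have lip: "\<bar>\<phi> u - \<phi> v\<bar> \<le> \<Lambda> * \<bar>u - v\<bar>" if uv: "u \<in> {a..b}" "v \<in> {a..b}" for u v
        proof -
          have "\<phi> u - \<phi> v = H ((u - x) / c) * (g u - g v) + (H ((u - x) / c) - H ((v - x) / c)) * g v"
            by (simp add: \<phi>_def algebra_simps)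
          also have "\<bar>\<dots>\<bar> \<le> \<bar>H ((u - x) / c) * (g u - g v)\<bar> + \<bar>(H ((u - x) / c) - H ((v - x) / c)) * g v\<bar>"
            by (rule abs_triangle_ineq)
          also have "\<dots> \<le> SH * (Lg * \<bar>u - v\<bar>) + (LH * \<bar>(u - x) / c - (v - x) / c\<bar>) * Sg"
            unfolding abs_mult using uv gS gL SH nonneg
            by (intro add_mono mult_mono H_bound H_lip) auto
          also have "\<bar>(u - x) / c - (v - x) / c\<bar> = \<bar>u - v\<bar> / c"
            using c by (simp add: diff_divide_distrib[symmetric])
          finally show ?thesis by (simp add: \<Lambda>_def algebra_simps)
        qed
        have "\<bar>d * (\<Sum>k=1..N_obs m n. \<phi> (p k)) - integral {a..b} \<phi>\<bar>
          \<le> real (N_obs m n) * (C0 / (N n)\<^sup>2 * (SH * Sg)) + 2 * d * \<Lambda> * ((x + c * R) - (x - c * R) + 4 * d) + 2 * d * (SH * Sg)"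
        proof (rule riemann_sum_error)
          show "p 0 = a" "p (Suc (N_obs m n)) = b" by (simp_all add: p_def ordered_design_ends)
          show "p k \<le> p (Suc k)" if "k \<le> N_obs m n" for k
          proof -
            have "sorted_wrt (<) (ordered_design a b m X n)" using X by (simp add: cond_X_def)
            then have "p k < p (Suc k)" unfolding p_def
              by (rule sorted_wrt_nth_less) (use that in \<open>simp_all add: length_ordered_design\<close>)
            then show ?thesis by simp
          qed
          show "\<bar>p (Suc k) - p k - d\<bar> \<le> C0 / (N n)\<^sup>2" if "k \<le> N_obs m n" for k
            using gap_n that by (simp add: p_def d_def)
          show "C0 / (N n)\<^sup>2 \<le> d"
            using Nn(1,2) ab by (simp add: d_def power2_eq_square field_simps)
          show "\<bar>\<phi> u\<bar> \<le> SH * Sg" if "u \<in> {a..b}" for u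
            unfolding \<phi>_def abs_mult using gS that SH by (intro mult_mono H_bound) auto
          show "\<phi> u = 0" if "u \<in> {a..b}" "u \<notin> {x - c * R..x + c * R}" for u
          proof -
            have "R \<le> \<bar>(u - x) / c\<bar>" using that c by (auto simp: abs_if field_simps)
            then show ?thesis using H_supp by (simp add: \<phi>_def)
          qed
          show "x - c * R \<le> x + c * R" using c R by simp
        qed (use d lip \<Lambda>0 in auto)
        also have "\<dots> \<le> d * C"
        proof -
          have "real (N_obs m n) * (C0 / (N n)\<^sup>2 * (SH * Sg)) = d * (C0 * (SH * Sg) / (b - a))"
            using Nn(1) ab by (simp add: d_def power2_eq_square)
          moreover have "\<Lambda> * (2 * (c * R) + 4 * d) \<le> Q * (2 * R + 4)"
          proof -
            have "d \<le> c" using Nn(1,3) by (simp add: d_def c_def field_simps)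
            then have "\<Lambda> * (2 * (c * R) + 4 * d) \<le> \<Lambda> * (2 * (c * R) + 4 * c)"
              using \<Lambda>0 by (intro mult_left_mono) auto
            also have "\<dots> = (\<Lambda> * c) * (2 * R + 4)" by (simp add: algebra_simps)
            also have "\<Lambda> * c \<le> Q"
            proof -
              have "\<Lambda> * c = SH * Lg * c + LH * Sg" using c by (simp add: \<Lambda>_def algebra_simps)
              also have "\<dots> \<le> SH * Lg * 1 + LH * Sg"
                using Nn(4) SH nonneg by (intro add_right_mono mult_left_mono) (auto simp: c_def)
              finally show ?thesis by (simp add: Q_def)
            qed
            finally show ?thesis using R by (simp add: mult_right_mono)
          qed
          then have "d * (2 * (\<Lambda> * (2 * (c * R) + 4 * d))) \<le> d * (2 * (Q * (2 * R + 4)))"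
            using d by (intro mult_left_mono) auto
          moreover have "2 * d * \<Lambda> * ((x + c * R) - (x - c * R) + 4 * d) = d * (2 * (\<Lambda> * (2 * (c * R) + 4 * d)))"
            by (simp add: algebra_simps)
          moreover have "d * C = d * (C0 * (SH * Sg) / (b - a)) + d * (2 * (Q * (2 * R + 4))) + 2 * d * (SH * Sg)"
            by (simp add: C_def algebra_simps)
          ultimately show ?thesis by linarith
        qed
        finally have main: "\<bar>d * (\<Sum>k=1..N_obs m n. \<phi> (p k)) - integral {a..b} \<phi>\<bar> \<le> d * C" .
        have contg: "continuous_on {a..b} g"
          by (rule lipschitz_on_continuous_on[of Lg]) (use gL nonneg in \<open>auto simp: lipschitz_on_def dist_real_def\<close>)
        have contH: "continuous_on {-R..R} H"
          by (rule lipschitz_on_continuous_on[of LH]) (use H_lip nonneg in \<open>auto simp: lipschitz_on_def dist_real_def\<close>)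
        have int: "integral {a..b} \<phi> = c * integral {- R..R} (\<lambda>v. H v * g (x + c * v))"
          unfolding \<phi>_def by (rule integral_scaled_kernel[OF c R _ _ contH contg H_supp]) (use ci in auto)
        have sum: "(\<Sum>\<alpha>\<in>obs m n. K_bw H c (X n (fst \<alpha>) (snd \<alpha>) - x) * g (X n (fst \<alpha>) (snd \<alpha>)))
          = (\<Sum>k=1..N_obs m n. \<phi> (p k))" (is "?S = _")
          using sum_obs_ordered_design[where \<phi>=\<phi> and a=a and b=b and m=m and n=n and X=X] by (simp add: \<phi>_def K_bw_def p_def)
        have "d * (?S - c / d * integral {- R..R} (\<lambda>v. H v * g (x + c * v)))
           = d * ?S - integral {a..b} \<phi>"
          using d by (simp add: int algebra_simps)
        then have "\<bar>d * (?S - c / d * integral {- R..R} (\<lambda>v. H v * g (x + c * v)))\<bar> \<le> d * C"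
          using main unfolding sum by simp
        then have "\<bar>?S - c / d * integral {- R..R} (\<lambda>v. H v * g (x + c * v))\<bar> \<le> C"
          using d by (simp add: abs_mult)
        moreover have "c / d = N n * bw n / (b - a)"
          using ab by (simp add: c_def d_def)
        ultimately show "\<bar>(\<Sum>\<alpha>\<in>obs m n. K_bw H (bw n) (X n (fst \<alpha>) (snd \<alpha>) - x) * g (X n (fst \<alpha>) (snd \<alpha>)))
      - N n * bw n / (b - a) * integral {- R..R} (\<lambda>v. H v * g (x + bw n * v))\<bar> \<le> C"
          unfolding c_def by simp
      qed
    qed
  qed
qed

end

section \<open>Expansion of the local mean\<close>

text \<open>
  Expansions in a small increment \<open>h\<close> of the design point and a small shift \<open>\<Delta>\<close> of the
  location, modulo \<open>h ^ 4\<close>, \<open>\<Delta> * h\<^sup>2\<close> and \<open>\<Delta>\<^sup>2\<close>, which are negligible at the scale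
  \<open>h = O(b\<^sub>n)\<close>, \<open>\<Delta> = O(b\<^sub>n\<^sup>2 + (N\<^sub>n b\<^sub>n) powr (-1/2))\<close>.
\<close>

definition expands ::
  "(real \<Rightarrow> real \<Rightarrow> real) \<Rightarrow> real \<Rightarrow> real \<Rightarrow> real \<Rightarrow> real \<Rightarrow> real \<Rightarrow> real \<Rightarrow> bool" where
  "expands g a0 a1 a2 a3 b0 b1 \<longleftrightarrow> (\<exists>C r. 0 < r \<and> (\<forall>h \<Delta>. \<bar>h\<bar> \<le> r \<and> \<bar>\<Delta>\<bar> \<le> r \<longrightarrow>
     \<bar>g h \<Delta> - (a0 + a1 * h + a2 * h ^ 2 + a3 * h ^ 3 + \<Delta> * (b0 + b1 * h))\<bar>
       \<le> C * (h ^ 4 + \<bar>\<Delta>\<bar> * h\<^sup>2 + \<Delta>\<^sup>2)))"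

lemma expandsE:
  assumes "expands g a0 a1 a2 a3 b0 b1"
  obtains C r where "0 < r" "r \<le> 1" "0 \<le> C"
    "\<And>h \<Delta>. \<bar>h\<bar> \<le> r \<Longrightarrow> \<bar>\<Delta>\<bar> \<le> r \<Longrightarrow>
     \<bar>g h \<Delta> - (a0 + a1 * h + a2 * h ^ 2 + a3 * h ^ 3 + \<Delta> * (b0 + b1 * h))\<bar>
       \<le> C * (h ^ 4 + \<bar>\<Delta>\<bar> * h\<^sup>2 + \<Delta>\<^sup>2)"
proof -
  obtain C r where r: "0 < r" and *: "\<And>h \<Delta>. \<bar>h\<bar> \<le> r \<Longrightarrow> \<bar>\<Delta>\<bar> \<le> r \<Longrightarrow>
     \<bar>g h \<Delta> - (a0 + a1 * h + a2 * h ^ 2 + a3 * h ^ 3 + \<Delta> * (b0 + b1 * h))\<bar>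
       \<le> C * (h ^ 4 + \<bar>\<Delta>\<bar> * h\<^sup>2 + \<Delta>\<^sup>2)"
    using assms unfolding expands_def by blast
  show thesis
  proof (rule that[of "min r 1" "max C 0"])
    fix h \<Delta> :: real assume "\<bar>h\<bar> \<le> min r 1" "\<bar>\<Delta>\<bar> \<le> min r 1"
    then have "\<bar>g h \<Delta> - (a0 + a1 * h + a2 * h ^ 2 + a3 * h ^ 3 + \<Delta> * (b0 + b1 * h))\<bar>
       \<le> C * (h ^ 4 + \<bar>\<Delta>\<bar> * h\<^sup>2 + \<Delta>\<^sup>2)" by (intro *) auto
    also have "\<dots> \<le> max C 0 * (h ^ 4 + \<bar>\<Delta>\<bar> * h\<^sup>2 + \<Delta>\<^sup>2)"
      by (intro mult_right_mono) auto
    finally show "\<bar>g h \<Delta> - (a0 + a1 * h + a2 * h ^ 2 + a3 * h ^ 3 + \<Delta> * (b0 + b1 * h))\<bar>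
       \<le> max C 0 * (h ^ 4 + \<bar>\<Delta>\<bar> * h\<^sup>2 + \<Delta>\<^sup>2)" .
  qed (use r in auto)
qed

lemma expandsI:
  assumes "0 < r" "\<And>h \<Delta>. \<bar>h\<bar> \<le> r \<Longrightarrow> \<bar>\<Delta>\<bar> \<le> r \<Longrightarrow>
     \<bar>g h \<Delta> - (a0 + a1 * h + a2 * h ^ 2 + a3 * h ^ 3 + \<Delta> * (b0 + b1 * h))\<bar>
       \<le> C * (h ^ 4 + \<bar>\<Delta>\<bar> * h\<^sup>2 + \<Delta>\<^sup>2)"
  shows "expands g a0 a1 a2 a3 b0 b1"
  using assms unfolding expands_def by blast

lemma expands_cong:
  assumes "expands f a0 a1 a2 a3 b0 b1" "\<And>h \<Delta>. f h \<Delta> = f' h \<Delta>"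
    "a0 = a0'" "a1 = a1'" "b0 = b0'" "b1 = b1'"
  shows "expands f' a0' a1' a2 a3 b0' b1'"
  using assms unfolding expands_def by simp

lemma expands_taylor:
  assumes "0 < r" and "\<And>h. \<bar>h\<bar> \<le> r \<Longrightarrow> \<bar>g h - (a0 + a1 * h + a2 * h ^ 2 + a3 * h ^ 3)\<bar> \<le> C * h ^ 4"
  shows "expands (\<lambda>h \<Delta>. g h) a0 a1 a2 a3 0 0"
proof (rule expandsI[of r _ _ _ _ _ _ _ "max C 0"])
  fix h \<Delta> :: real assume h: "\<bar>h\<bar> \<le> r"
  have "C * h ^ 4 \<le> max C 0 * (h ^ 4 + (\<bar>\<Delta>\<bar> * h\<^sup>2 + \<Delta>\<^sup>2))"
    by (intro mult_mono) auto
  with assms(2)[OF h] show "\<bar>g h - (a0 + a1 * h + a2 * h ^ 2 + a3 * h ^ 3 + \<Delta> * (0 + 0 * h))\<bar>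
       \<le> max C 0 * (h ^ 4 + \<bar>\<Delta>\<bar> * h\<^sup>2 + \<Delta>\<^sup>2)" by (simp add: add.assoc)
qed (use assms in auto)

lemma expands_const: "expands (\<lambda>h \<Delta>. c) c 0 0 0 0 0"
  by (rule expands_taylor[of 1 _ _ _ _ _ 0]) auto

lemma expands_shift: "expands (\<lambda>h \<Delta>. \<Delta>) 0 0 0 0 1 0"
  by (rule expandsI[of 1 _ _ _ _ _ _ _ 0]) auto

lemma expands_add:
  assumes "expands f a0 a1 a2 a3 b0 b1" "expands g a0' a1' a2' a3' b0' b1'"
  shows "expands (\<lambda>h \<Delta>. f h \<Delta> + g h \<Delta>) (a0 + a0') (a1 + a1') (a2 + a2') (a3 + a3') (b0 + b0') (b1 + b1')"
proof -
  obtain C r where r: "0 < r" and 1: "\<And>h \<Delta>. \<bar>h\<bar> \<le> r \<Longrightarrow> \<bar>\<Delta>\<bar> \<le> r \<Longrightarrow>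
     \<bar>f h \<Delta> - (a0 + a1 * h + a2 * h ^ 2 + a3 * h ^ 3 + \<Delta> * (b0 + b1 * h))\<bar>
       \<le> C * (h ^ 4 + \<bar>\<Delta>\<bar> * h\<^sup>2 + \<Delta>\<^sup>2)"
    by (rule expandsE[OF assms(1)]) blast
  obtain C' r' where r': "0 < r'" and 2: "\<And>h \<Delta>. \<bar>h\<bar> \<le> r' \<Longrightarrow> \<bar>\<Delta>\<bar> \<le> r' \<Longrightarrow>
     \<bar>g h \<Delta> - (a0' + a1' * h + a2' * h ^ 2 + a3' * h ^ 3 + \<Delta> * (b0' + b1' * h))\<bar>
       \<le> C' * (h ^ 4 + \<bar>\<Delta>\<bar> * h\<^sup>2 + \<Delta>\<^sup>2)"
    by (rule expandsE[OF assms(2)]) blast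
  show ?thesis
  proof (rule expandsI[of "min r r'" _ _ _ _ _ _ _ "C + C'"])
    fix h \<Delta> :: real assume "\<bar>h\<bar> \<le> min r r'" "\<bar>\<Delta>\<bar> \<le> min r r'"
    then have *: "\<bar>h\<bar> \<le> r" "\<bar>\<Delta>\<bar> \<le> r" "\<bar>h\<bar> \<le> r'" "\<bar>\<Delta>\<bar> \<le> r'" by auto
    show "\<bar>f h \<Delta> + g h \<Delta> - (a0 + a0' + (a1 + a1') * h + (a2 + a2') * h ^ 2 + (a3 + a3') * h ^ 3
        + \<Delta> * (b0 + b0' + (b1 + b1') * h))\<bar> \<le> (C + C') * (h ^ 4 + \<bar>\<Delta>\<bar> * h\<^sup>2 + \<Delta>\<^sup>2)"
      using 1[OF *(1,2)] 2[OF *(3,4)] unfolding distrib_left distrib_right by linarith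
  qed (use r r' in auto)
qed

lemma abs_add5_le:
  fixes x1 :: real
  assumes "\<bar>x1\<bar> \<le> y1" "\<bar>x2\<bar> \<le> y2" "\<bar>x3\<bar> \<le> y3" "\<bar>x4\<bar> \<le> y4" "\<bar>x5\<bar> \<le> y5"
  shows "\<bar>x1 + x2 + x3 + (x4 + x5)\<bar> \<le> y1 + y2 + y3 + (y4 + y5)"
  by (intro order_trans[OF abs_triangle_ineq add_mono] assms)

lemma abs_poly_le:
  fixes h \<Delta> :: real
  assumes "\<bar>h\<bar> \<le> 1" "\<bar>\<Delta>\<bar> \<le> 1"
  shows "\<bar>a0 + a1 * h + a2 * h ^ 2 + a3 * h ^ 3 + \<Delta> * (b0 + b1 * h)\<bar>
    \<le> \<bar>a0\<bar> + \<bar>a1\<bar> + \<bar>a2\<bar> + \<bar>a3\<bar> + \<bar>b0\<bar> + \<bar>b1\<bar>"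
proof -
  have le: "\<bar>c * y\<bar> \<le> \<bar>c\<bar>" if "\<bar>y\<bar> \<le> 1" for c y :: real
    using mult_left_mono[OF that, of "\<bar>c\<bar>"] by (simp add: abs_mult)
  have "\<bar>h ^ 2\<bar> \<le> 1" "\<bar>h ^ 3\<bar> \<le> 1" "\<bar>\<Delta> * h\<bar> \<le> 1"
    using assms unfolding power_abs abs_mult
    by (simp_all only: power_le_one mult_le_one abs_ge_zero)
  then have *: "\<bar>a1 * h + a2 * h ^ 2 + a3 * h ^ 3 + (b0 * \<Delta> + b1 * (\<Delta> * h))\<bar>
     \<le> \<bar>a1\<bar> + \<bar>a2\<bar> + \<bar>a3\<bar> + (\<bar>b0\<bar> + \<bar>b1\<bar>)"
    using assms by (intro abs_add5_le le) auto
  have "\<bar>a0 + (a1 * h + a2 * h ^ 2 + a3 * h ^ 3 + (b0 * \<Delta> + b1 * (\<Delta> * h)))\<bar>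
     \<le> \<bar>a0\<bar> + (\<bar>a1\<bar> + \<bar>a2\<bar> + \<bar>a3\<bar> + (\<bar>b0\<bar> + \<bar>b1\<bar>))"
    by (rule order_trans[OF abs_triangle_ineq add_left_mono[OF *]])
  then show ?thesis by (simp add: algebra_simps)
qed

text \<open>Expansions multiply like polynomials modulo the ideal generated by \<open>h^4\<close>,
  \<open>\<Delta> * h^2\<close> and \<open>\<Delta>^2\<close>. The bounds \<open>d0\<close>,
  \<open>d1\<close>, \<open>d2\<close> control the cofactors of these three generators in the
  discarded part of the product.\<close>

lemma expands_mult:
  assumes "expands f a0 a1 a2 a3 b0 b1" "expands g a0' a1' a2' a3' b0' b1'"
  shows "expands (\<lambda>h \<Delta>. f h \<Delta> * g h \<Delta>) (a0 * a0') (a0 * a1' + a1 * a0')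
    (a0 * a2' + a1 * a1' + a2 * a0') (a0 * a3' + a1 * a2' + a2 * a1' + a3 * a0')
    (b0 * a0' + a0 * b0') (b1 * a0' + b0 * a1' + a0 * b1' + a1 * b0')"
proof -
  define P where "P h \<Delta> = a0 + a1 * h + a2 * h ^ 2 + a3 * h ^ 3 + \<Delta> * (b0 + b1 * h)" for h \<Delta>
  define Q where "Q h \<Delta> = a0' + a1' * h + a2' * h ^ 2 + a3' * h ^ 3 + \<Delta> * (b0' + b1' * h)" for h \<Delta>
  define T where "T h \<Delta> = a0 * a0' + (a0 * a1' + a1 * a0') * h
    + (a0 * a2' + a1 * a1' + a2 * a0') * h ^ 2 + (a0 * a3' + a1 * a2' + a2 * a1' + a3 * a0') * h ^ 3
    + \<Delta> * ((b0 * a0' + a0 * b0') + (b1 * a0' + b0 * a1' + a0 * b1' + a1 * b0') * h)" for h \<Delta>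
  define E where "E h \<Delta> = h ^ 4 + \<bar>\<Delta>\<bar> * h\<^sup>2 + \<Delta>\<^sup>2" for h \<Delta> :: real
  obtain C r where r: "0 < r" "r \<le> 1" and C: "0 \<le> C"
    and 1: "\<And>h \<Delta>. \<bar>h\<bar> \<le> r \<Longrightarrow> \<bar>\<Delta>\<bar> \<le> r \<Longrightarrow> \<bar>f h \<Delta> - P h \<Delta>\<bar> \<le> C * E h \<Delta>"
    unfolding P_def E_def by (rule expandsE[OF assms(1)]) blast
  obtain C' r' where r': "0 < r'" "r' \<le> 1" and C': "0 \<le> C'"
    and 2: "\<And>h \<Delta>. \<bar>h\<bar> \<le> r' \<Longrightarrow> \<bar>\<Delta>\<bar> \<le> r' \<Longrightarrow> \<bar>g h \<Delta> - Q h \<Delta>\<bar> \<le> C' * E h \<Delta>"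
    unfolding Q_def E_def by (rule expandsE[OF assms(2)]) blast
  define SP where "SP = \<bar>a0\<bar> + \<bar>a1\<bar> + \<bar>a2\<bar> + \<bar>a3\<bar> + \<bar>b0\<bar> + \<bar>b1\<bar>"
  define SQ where "SQ = \<bar>a0'\<bar> + \<bar>a1'\<bar> + \<bar>a2'\<bar> + \<bar>a3'\<bar> + \<bar>b0'\<bar> + \<bar>b1'\<bar>"
  define d0 where "d0 = \<bar>a1 * a3' + a2 * a2' + a3 * a1'\<bar> + \<bar>a2 * a3' + a3 * a2'\<bar> + \<bar>a3 * a3'\<bar>"
  define d1 where "d1 = \<bar>a1 * b1' + b1 * a1' + a2 * b0' + b0 * a2'\<bar>
      + \<bar>a2 * b1' + b1 * a2' + a3 * b0' + b0 * a3'\<bar> + \<bar>a3 * b1' + b1 * a3'\<bar>"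
  define d2 where "d2 = \<bar>b0 * b0'\<bar> + \<bar>b0 * b1' + b1 * b0'\<bar> + \<bar>b1 * b1'\<bar>"
  have "\<bar>f h \<Delta> * g h \<Delta> - T h \<Delta>\<bar> \<le> (C * (SQ + 3 * C') + SP * C' + (d0 + d1 + d2)) * E h \<Delta>"
    if h: "\<bar>h\<bar> \<le> min r r'" and \<Delta>: "\<bar>\<Delta>\<bar> \<le> min r r'" for h \<Delta>
  proof -
    have le1: "\<bar>h\<bar> \<le> 1" "\<bar>\<Delta>\<bar> \<le> 1" using h \<Delta> r r' by auto
    have E0: "0 \<le> E h \<Delta>" by (simp add: E_def)
    have E3: "E h \<Delta> \<le> 3"
    proof -
      have "\<bar>h\<bar> ^ 4 \<le> 1" "\<bar>h\<bar> ^ 2 \<le> 1" "\<bar>\<Delta>\<bar> ^ 2 \<le> 1"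
        using le1 by (simp_all only: power_le_one abs_ge_zero)
      then have "h ^ 4 \<le> 1" "\<bar>\<Delta>\<bar> * h\<^sup>2 \<le> 1" "\<Delta>\<^sup>2 \<le> 1" using le1 by (auto intro!: mult_le_one)
      then show ?thesis by (simp add: E_def)
    qed
    have fP: "\<bar>f h \<Delta> - P h \<Delta>\<bar> \<le> C * E h \<Delta>" and gQ: "\<bar>g h \<Delta> - Q h \<Delta>\<bar> \<le> C' * E h \<Delta>"
      using 1 2 h \<Delta> by auto
    have bP: "\<bar>P h \<Delta>\<bar> \<le> SP" and bQ: "\<bar>Q h \<Delta>\<bar> \<le> SQ"
      unfolding P_def Q_def SP_def SQ_def by (rule abs_poly_le[OF le1])+
    have "C' * E h \<Delta> \<le> C' * 3" using C' E3 by (rule mult_left_mono[rotated])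
    then have bg: "\<bar>g h \<Delta>\<bar> \<le> SQ + 3 * C'" using gQ bQ by linarith
    have quad: "\<bar>u + v * h + w * h\<^sup>2\<bar> \<le> \<bar>u\<bar> + \<bar>v\<bar> + \<bar>w\<bar>" for u v w
      using abs_poly_le[OF le1, of u v w 0 0 0] by simp
    \<comment> \<open>These are the exact cofactors:
      \<open>P * Q - T = h^4 * q0 + \<Delta> * h^2 * q1 + \<Delta>^2 * q2\<close>.\<close>
    define q0 q1 q2 where "q0 = (a1 * a3' + a2 * a2' + a3 * a1') + (a2 * a3' + a3 * a2') * h + (a3 * a3') * h\<^sup>2"
      and "q1 = (a1 * b1' + b1 * a1' + a2 * b0' + b0 * a2')
             + (a2 * b1' + b1 * a2' + a3 * b0' + b0 * a3') * h + (a3 * b1' + b1 * a3') * h\<^sup>2"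
      and "q2 = b0 * b0' + (b0 * b1' + b1 * b0') * h + (b1 * b1') * h\<^sup>2"
    have q: "\<bar>q0\<bar> \<le> d0" "\<bar>q1\<bar> \<le> d1" "\<bar>q2\<bar> \<le> d2"
      unfolding q0_def q1_def q2_def d0_def d1_def d2_def by (rule quad)+
    have m: "\<bar>y * z\<bar> \<le> \<bar>y\<bar> * d" if "\<bar>z\<bar> \<le> d" for y z d :: real
      unfolding abs_mult using that by (rule mult_left_mono) simp
    have PQ: "P h \<Delta> * Q h \<Delta> - T h \<Delta> = h ^ 4 * q0 + (\<Delta> * h\<^sup>2) * q1 + \<Delta>\<^sup>2 * q2"
      unfolding P_def Q_def T_def q0_def q1_def q2_def by (simp add: eval_nat_numeral algebra_simps)
    have "\<bar>P h \<Delta> * Q h \<Delta> - T h \<Delta>\<bar> \<le> \<bar>h ^ 4\<bar> * d0 + \<bar>\<Delta> * h\<^sup>2\<bar> * d1 + \<bar>\<Delta>\<^sup>2\<bar> * d2"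
      using m[OF q(1), of "h ^ 4"] m[OF q(2), of "\<Delta> * h\<^sup>2"] m[OF q(3), of "\<Delta>\<^sup>2"] unfolding PQ by linarith
    also have "\<dots> = h ^ 4 * d0 + (\<bar>\<Delta>\<bar> * h\<^sup>2) * d1 + \<Delta>\<^sup>2 * d2"
      by (simp add: abs_mult)
    also have "\<dots> \<le> E h \<Delta> * d0 + E h \<Delta> * d1 + E h \<Delta> * d2"
      by (intro add_mono mult_right_mono) (auto simp: E_def d0_def d1_def d2_def)
    finally have PQT: "\<bar>P h \<Delta> * Q h \<Delta> - T h \<Delta>\<bar> \<le> (d0 + d1 + d2) * E h \<Delta>"
      by (simp add: algebra_simps)
    have "f h \<Delta> * g h \<Delta> - T h \<Delta> = (f h \<Delta> - P h \<Delta>) * g h \<Delta> + P h \<Delta> * (g h \<Delta> - Q h \<Delta>) + (P h \<Delta> * Q h \<Delta> - T h \<Delta>)"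
      by (simp add: algebra_simps)
    then have "\<bar>f h \<Delta> * g h \<Delta> - T h \<Delta>\<bar> \<le> \<bar>f h \<Delta> - P h \<Delta>\<bar> * \<bar>g h \<Delta>\<bar> + \<bar>P h \<Delta>\<bar> * \<bar>g h \<Delta> - Q h \<Delta>\<bar> + \<bar>P h \<Delta> * Q h \<Delta> - T h \<Delta>\<bar>"
      unfolding abs_mult[symmetric] by linarith
    also have "\<dots> \<le> (C * E h \<Delta>) * (SQ + 3 * C') + SP * (C' * E h \<Delta>) + (d0 + d1 + d2) * E h \<Delta>"
      using fP gQ bP bg PQT E0 C C' order_trans[OF abs_ge_zero bP] by (intro add_mono mult_mono) auto
    finally show ?thesis by (simp add: algebra_simps)
  qed
  then show ?thesis
    unfolding T_def E_def using r r' by (intro expandsI[of "min r r'"]) auto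
qed

lemma expands_scale:
  assumes "expands f a0 a1 a2 a3 b0 b1"
  shows "expands (\<lambda>h \<Delta>. c * f h \<Delta>) (c * a0) (c * a1) (c * a2) (c * a3) (c * b0) (c * b1)"
  using expands_mult[OF expands_const[of c] assms] by simp

text \<open>The inner function has no constant term, so it is at most
  \<open>L * (\<bar>h\<bar> + \<bar>\<Delta>\<bar>)\<close> near the origin. Its fourth power is
  then at most \<open>8 * L ^ 4 * (h ^ 4 + \<Delta> ^ 4)\<close>, and
  \<open>\<Delta> ^ 4 \<le> \<Delta>^2\<close> for small \<Delta>, so a quartic remainder is
  negligible in the sense of \<open>expands\<close>.\<close>

lemma expands_remainder:
  assumes "expands c 0 c1 c2 c3 b0 b1" and "0 < r0" and \<rho>: "\<And>y. \<bar>y\<bar> \<le> r0 \<Longrightarrow> \<bar>\<rho> y\<bar> \<le> C0 * y ^ 4"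
  shows "expands (\<lambda>h \<Delta>. \<rho> (c h \<Delta>)) 0 0 0 0 0 0"
proof -
  obtain C r where r: "0 < r" "r \<le> 1" and C: "0 \<le> C" and 1: "\<And>h \<Delta>. \<bar>h\<bar> \<le> r \<Longrightarrow> \<bar>\<Delta>\<bar> \<le> r \<Longrightarrow>
     \<bar>c h \<Delta> - (0 + c1 * h + c2 * h ^ 2 + c3 * h ^ 3 + \<Delta> * (b0 + b1 * h))\<bar>
       \<le> C * (h ^ 4 + \<bar>\<Delta>\<bar> * h\<^sup>2 + \<Delta>\<^sup>2)"
    by (rule expandsE[OF assms(1)]) blast
  define L where "L = \<bar>c1\<bar> + \<bar>c2\<bar> + \<bar>c3\<bar> + \<bar>b0\<bar> + \<bar>b1\<bar> + 3 * C + 1"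
  have L: "L > 0" using C by (simp add: L_def)
  have lin: "\<bar>c h \<Delta>\<bar> \<le> L * (\<bar>h\<bar> + \<bar>\<Delta>\<bar>)" if "\<bar>h\<bar> \<le> r" "\<bar>\<Delta>\<bar> \<le> r" for h \<Delta>
  proof -
    have le1: "\<bar>h\<bar> \<le> 1" "\<bar>\<Delta>\<bar> \<le> 1" using that r by auto
    have pw: "\<bar>y\<bar> ^ k \<le> \<bar>y\<bar>" if "\<bar>y\<bar> \<le> 1" "1 \<le> k" for y :: real and k
      using power_decreasing[of 1 k "\<bar>y\<bar>"] that by simp
    define z where "z = \<bar>h\<bar> + \<bar>\<Delta>\<bar>"
    have z0: "0 \<le> z" by (simp add: z_def)
    have t: "\<bar>u * y\<bar> \<le> \<bar>u\<bar> * z" if "\<bar>y\<bar> \<le> z" for u y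
      unfolding abs_mult using that by (rule mult_left_mono) simp
    have h2: "\<bar>h ^ 2\<bar> \<le> z" "\<bar>h ^ 3\<bar> \<le> z" "\<bar>h ^ 4\<bar> \<le> z"
      using pw[OF le1(1), of 2] pw[OF le1(1), of 3] pw[OF le1(1), of 4] by (simp_all add: z_def power_abs)
    have hz: "\<bar>h\<bar> \<le> z" "\<bar>\<Delta>\<bar> \<le> z" by (simp_all add: z_def)
    have d2: "\<bar>\<Delta>\<^sup>2\<bar> \<le> z" using pw[OF le1(2), of 2] by (simp add: z_def)
    have dh: "\<bar>\<Delta> * h\<bar> \<le> z" "\<bar>\<bar>\<Delta>\<bar> * h\<^sup>2\<bar> \<le> z"
    proof -
      have "\<bar>\<Delta>\<bar> * \<bar>h\<bar> \<le> \<bar>\<Delta>\<bar> * 1" by (rule mult_left_mono) (use le1 in auto)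
      then show "\<bar>\<Delta> * h\<bar> \<le> z" unfolding abs_mult z_def by linarith
      have "\<bar>\<Delta>\<bar> * \<bar>h\<^sup>2\<bar> \<le> \<bar>\<Delta>\<bar> * 1" by (rule mult_left_mono) (use pw[OF le1(1), of 2] le1 in \<open>auto simp: abs_le_square_iff[of h 1, simplified] power_le_one\<close>)
      then show "\<bar>\<bar>\<Delta>\<bar> * h\<^sup>2\<bar> \<le> z" unfolding abs_mult z_def by linarith
    qed
    have 5: "\<bar>c1 * h + c2 * h ^ 2 + c3 * h ^ 3 + (b0 * \<Delta> + b1 * (\<Delta> * h))\<bar>
       \<le> \<bar>c1\<bar> * z + \<bar>c2\<bar> * z + \<bar>c3\<bar> * z + (\<bar>b0\<bar> * z + \<bar>b1\<bar> * z)"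
      by (rule abs_add5_le[OF t[OF hz(1)] t[OF h2(1)] t[OF h2(2)] t[OF hz(2)] t[OF dh(1)]])
    have eq: "0 + c1 * h + c2 * h ^ 2 + c3 * h ^ 3 + \<Delta> * (b0 + b1 * h)
       = c1 * h + c2 * h ^ 2 + c3 * h ^ 3 + (b0 * \<Delta> + b1 * (\<Delta> * h))" by (simp add: algebra_simps)
    have "C * (h ^ 4 + \<bar>\<Delta>\<bar> * h\<^sup>2 + \<Delta>\<^sup>2) \<le> C * (3 * z)"
    proof (rule mult_left_mono[OF _ C])
      have "h ^ 4 + \<bar>\<Delta>\<bar> * h\<^sup>2 + \<Delta>\<^sup>2 \<le> z + z + z"
        by (rule add_mono[OF add_mono[OF abs_le_D1[OF h2(3)] abs_le_D1[OF dh(2)]] abs_le_D1[OF d2]])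
      also have "z + z + z = 3 * z" by simp
      finally show "h ^ 4 + \<bar>\<Delta>\<bar> * h\<^sup>2 + \<Delta>\<^sup>2 \<le> 3 * z" .
    qed
    then have e: "\<bar>c h \<Delta> - (c1 * h + c2 * h ^ 2 + c3 * h ^ 3 + (b0 * \<Delta> + b1 * (\<Delta> * h)))\<bar> \<le> C * (3 * z)"
      using 1[OF that] unfolding eq by (rule order_trans[rotated])
    have tri: "\<bar>u\<bar> \<le> e + y" if "\<bar>u - w\<bar> \<le> e" "\<bar>w\<bar> \<le> y" for u w e y :: real
      using that by linarith
    have "\<bar>c h \<Delta>\<bar> \<le> C * (3 * z) + (\<bar>c1\<bar> * z + \<bar>c2\<bar> * z + \<bar>c3\<bar> * z + (\<bar>b0\<bar> * z + \<bar>b1\<bar> * z))"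
      by (rule tri[OF e 5])
    also have "\<dots> = L * z - z" by (simp add: L_def algebra_simps)
    also have "\<dots> \<le> L * z" using z0 by simp
    finally show ?thesis by (simp add: z_def)
  qed
  define r1 where "r1 = min r (r0 / (2 * L))"
  show ?thesis
  proof (rule expandsI[of r1 _ _ _ _ _ _ _ "\<bar>C0\<bar> * (L ^ 4 * 8)"])
    show "0 < r1" using r L \<open>0 < r0\<close> by (simp add: r1_def)
    fix h \<Delta> assume h: "\<bar>h\<bar> \<le> r1" and \<Delta>: "\<bar>\<Delta>\<bar> \<le> r1"
    have hr: "\<bar>h\<bar> \<le> r" "\<bar>\<Delta>\<bar> \<le> r" using h \<Delta> by (auto simp: r1_def)
    note l = lin[OF hr]
    have "L * (\<bar>h\<bar> + \<bar>\<Delta>\<bar>) \<le> L * (r0 / L)"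
    proof (rule mult_left_mono)
      have "\<bar>h\<bar> \<le> r0 / (2 * L)" "\<bar>\<Delta>\<bar> \<le> r0 / (2 * L)" using h \<Delta> by (auto simp: r1_def)
      moreover have "r0 / L = r0 / (2 * L) + r0 / (2 * L)" using L by (simp add: field_simps)
      ultimately show "\<bar>h\<bar> + \<bar>\<Delta>\<bar> \<le> r0 / L" by linarith
    qed (use L in simp)
    then have "\<bar>c h \<Delta>\<bar> \<le> r0" using l L by simp
    then have "\<bar>\<rho> (c h \<Delta>)\<bar> \<le> C0 * c h \<Delta> ^ 4" by (rule \<rho>)
    also have "\<dots> \<le> \<bar>C0\<bar> * \<bar>c h \<Delta>\<bar> ^ 4" by (simp add: mult_right_mono)
    also have "\<dots> \<le> \<bar>C0\<bar> * (L * (\<bar>h\<bar> + \<bar>\<Delta>\<bar>)) ^ 4"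
      by (intro mult_left_mono power_mono l) auto
    also have "(L * (\<bar>h\<bar> + \<bar>\<Delta>\<bar>)) ^ 4 \<le> L ^ 4 * (8 * (h ^ 4 + \<bar>\<Delta>\<bar> * h\<^sup>2 + \<Delta>\<^sup>2))"
    proof -
      have sq: "(u + v) ^ 2 \<le> 2 * (u ^ 2 + v ^ 2)" for u v :: real
        using sum_squares_bound[of u v] by (simp add: power2_sum)
      have "((\<bar>h\<bar> + \<bar>\<Delta>\<bar>) ^ 2) ^ 2 \<le> (2 * (\<bar>h\<bar> ^ 2 + \<bar>\<Delta>\<bar> ^ 2)) ^ 2"
        by (rule power_mono[OF sq]) simp
      also have "\<dots> = 4 * (h ^ 2 + \<Delta> ^ 2) ^ 2" unfolding power_mult_distrib by simp
      also have "\<dots> \<le> 4 * (2 * ((h ^ 2) ^ 2 + (\<Delta> ^ 2) ^ 2))"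
        by (rule mult_left_mono[OF sq]) simp
      finally have 4: "(\<bar>h\<bar> + \<bar>\<Delta>\<bar>) ^ 4 \<le> 8 * (h ^ 4 + \<Delta> ^ 4)" by simp
      have "\<Delta> ^ 4 = \<Delta>\<^sup>2 * \<Delta>\<^sup>2" by (simp add: eval_nat_numeral)
      also have "\<dots> \<le> \<Delta>\<^sup>2 * 1"
        using hr r by (intro mult_left_mono) (auto simp: abs_square_le_1)
      finally have d4: "\<Delta> ^ 4 \<le> \<Delta>\<^sup>2" by simp
      have nn: "0 \<le> \<bar>\<Delta>\<bar> * h\<^sup>2" by simp
      have "8 * (h ^ 4 + \<Delta> ^ 4) \<le> 8 * (h ^ 4 + \<bar>\<Delta>\<bar> * h\<^sup>2 + \<Delta>\<^sup>2)"
        using d4 nn by (intro mult_left_mono) linarith+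
      with 4 show ?thesis unfolding power_mult_distrib
        using L by (intro mult_left_mono) auto
    qed
    finally have "\<bar>\<rho> (c h \<Delta>)\<bar> \<le> \<bar>C0\<bar> * (L ^ 4 * 8) * (h ^ 4 + \<bar>\<Delta>\<bar> * h\<^sup>2 + \<Delta>\<^sup>2)"
      by (simp add: mult.assoc mult_left_mono)
    then show "\<bar>\<rho> (c h \<Delta>) - (0 + 0 * h + 0 * h ^ 2 + 0 * h ^ 3 + \<Delta> * (0 + 0 * h))\<bar>
       \<le> \<bar>C0\<bar> * (L ^ 4 * 8) * (h ^ 4 + \<bar>\<Delta>\<bar> * h\<^sup>2 + \<Delta>\<^sup>2)" by simp
  qed
qed

text \<open>The cubic Taylor polynomial of the outer function is evaluated by the product rule, and
  its quartic remainder is negligible. In the cube only \<open>c1 ^ 3 * h ^ 3\<close> survives,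
  because a term with \<Delta> also carries \<open>h^2\<close> or another \<Delta>.\<close>

lemma expands_compose:
  assumes c: "expands c 0 c1 c2 c3 b0 b1" and "0 < r0"
    and F: "\<And>y. \<bar>y\<bar> \<le> r0 \<Longrightarrow> \<bar>F y - (F0 + F1 * y + F2 * y ^ 2 + F3 * y ^ 3)\<bar> \<le> C0 * y ^ 4"
  shows "expands (\<lambda>h \<Delta>. F (c h \<Delta>)) F0 (F1 * c1) (F1 * c2 + F2 * c1\<^sup>2)
    (F1 * c3 + 2 * F2 * c1 * c2 + F3 * c1 ^ 3) (F1 * b0) (F1 * b1 + 2 * F2 * c1 * b0)"
proof -
  define \<rho> where "\<rho> y = F y - (F0 + F1 * y + F2 * y ^ 2 + F3 * y ^ 3)" for y
  have r: "expands (\<lambda>h \<Delta>. \<rho> (c h \<Delta>)) 0 0 0 0 0 0"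
    by (rule expands_remainder[OF c \<open>0 < r0\<close>]) (use F in \<open>simp add: \<rho>_def\<close>)
  have c2: "expands (\<lambda>h \<Delta>. c h \<Delta> * c h \<Delta>) 0 0 (c1\<^sup>2) (2 * c1 * c2) 0 (2 * c1 * b0)"
    using expands_mult[OF c c] by (simp add: power2_eq_square algebra_simps)
  have c3: "expands (\<lambda>h \<Delta>. c h \<Delta> * (c h \<Delta> * c h \<Delta>)) 0 0 0 (c1 ^ 3) 0 0"
    using expands_mult[OF c c2] by (simp add: power2_eq_square power3_eq_cube mult.assoc)
  have "expands (\<lambda>h \<Delta>. (F0 + F1 * c h \<Delta>) + (F2 * (c h \<Delta> * c h \<Delta>) + F3 * (c h \<Delta> * (c h \<Delta> * c h \<Delta>))) + \<rho> (c h \<Delta>))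
    F0 (F1 * c1) (F1 * c2 + F2 * c1\<^sup>2)
    (F1 * c3 + 2 * F2 * c1 * c2 + F3 * c1 ^ 3) (F1 * b0) (F1 * b1 + 2 * F2 * c1 * b0)"
    using expands_add[OF expands_add[OF expands_add[OF expands_const[of F0] expands_scale[OF c, of F1]]
      expands_add[OF expands_scale[OF c2, of F2] expands_scale[OF c3, of F3]]] r]
    by (simp add: algebra_simps)
  moreover have "(\<lambda>h \<Delta>. (F0 + F1 * c h \<Delta>) + (F2 * (c h \<Delta> * c h \<Delta>) + F3 * (c h \<Delta> * (c h \<Delta> * c h \<Delta>))) + \<rho> (c h \<Delta>))
     = (\<lambda>h \<Delta>. F (c h \<Delta>))"
    by (simp add: \<rho>_def fun_eq_iff power2_eq_square power3_eq_cube)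
  ultimately show ?thesis by simp
qed

text \<open>Geometric expansion of \<open>1 / (1 + z)\<close> at \<open>z = s / s0 - 1\<close>. The
  coefficients \<open>p2\<close> and \<open>p3\<close> can stay anonymous: the reciprocal will be
  multiplied by a factor without constant term, so the \<open>h^2\<close> coefficient of the product
  sees only the first two coefficients of the reciprocal.\<close>

lemma expands_inverse:
  assumes s: "expands s s0 s1 s2 s3 0 0" and "s0 \<noteq> 0"
  shows "\<exists>p2 p3. expands (\<lambda>h \<Delta>. 1 / s h \<Delta>) (1 / s0) (- s1 / s0\<^sup>2) p2 p3 0 0"
proof -
  have y: "expands (\<lambda>h \<Delta>. 1 / s0 * s h \<Delta> + - 1) 0 (s1 / s0) (s2 / s0) (s3 / s0) 0 0"
    using expands_add[OF expands_scale[OF s, of "1 / s0"] expands_const[of "- 1"]] \<open>s0 \<noteq> 0\<close> by simp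
  have rem: "\<bar>1 / (1 + z) - (1 + (- 1) * z + 1 * z ^ 2 + (- 1) * z ^ 3)\<bar> \<le> 2 * z ^ 4" if "\<bar>z\<bar> \<le> 1 / 2" for z :: real
  proof -
    have z: "1 / 2 \<le> 1 + z" using that by linarith
    have eq: "1 / (1 + z) - (1 + (- 1) * z + 1 * z ^ 2 + (- 1) * z ^ 3) = z ^ 4 / (1 + z)"
      using z by (simp add: field_simps eval_nat_numeral)
    have "z ^ 4 / (1 + z) \<le> z ^ 4 / (1 / 2)" using z by (intro divide_left_mono) auto
    then show ?thesis unfolding eq using z by simp
  qed
  have "expands (\<lambda>h \<Delta>. 1 / s0 * (1 / (1 + (1 / s0 * s h \<Delta> + - 1)))) (1 / s0 * 1) (1 / s0 * (- 1 * (s1 / s0)))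
     (1 / s0 * (- 1 * (s2 / s0) + 1 * (s1 / s0)\<^sup>2))
     (1 / s0 * (- 1 * (s3 / s0) + 2 * 1 * (s1 / s0) * (s2 / s0) + - 1 * (s1 / s0) ^ 3)) (1 / s0 * (- 1 * 0)) (1 / s0 * (- 1 * 0 + 2 * 1 * (s1 / s0) * 0))"
    by (rule expands_scale[OF expands_compose[OF y, of "1 / 2", OF _ rem]]) auto
  note e = this
  show ?thesis
    by (intro exI, rule expands_cong[OF e]) (use \<open>s0 \<noteq> 0\<close> in \<open>simp_all add: power2_eq_square\<close>)
qed

text \<open>The Lagrange form of the remainder asks only for a bound on the fourth derivative, not
  for its continuity. At interior points derivatives within \<open>{a..b}\<close> are two-sided,
  which identifies the coefficients of orders one and two with \<open>deriv\<close>; the cubic one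
  may remain unnamed.\<close>

lemma bounded_C_taylor:
  assumes f: "bounded_C 4 {a..b} f" and x: "a < x" "x < b"
  obtains c3 C r where "0 < r"
    "\<And>h. \<bar>h\<bar> \<le> r \<Longrightarrow>
      \<bar>f (x + h) - (f x + deriv f x * h + deriv (deriv f) x / 2 * h ^ 2 + c3 * h ^ 3)\<bar> \<le> C * h ^ 4"
proof -
  obtain D where D0: "D 0 = f"
    and D: "\<And>k t. k < 4 \<Longrightarrow> t \<in> {a..b} \<Longrightarrow> (D k has_real_derivative D (Suc k) t) (at t within {a..b})"
    and bd: "bounded (D 4 ` {a..b})"
    using f unfolding bounded_C_def by auto
  have D': "(D k has_real_derivative D (Suc k) t) (at t)" if "k < 4" "a < t" "t < b" for k t
    using D[of k t] that by (simp add: at_within_Icc_at)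
  have d1: "deriv f t = D 1 t" if "a < t" "t < b" for t
    using DERIV_imp_deriv[OF D'[of 0 t]] that by (simp add: D0)
  \<comment> \<open>The second derivative needs \<open>deriv f = D 1\<close> on a whole
    neighbourhood of \<open>x\<close>, not just at the point.\<close>
  have "eventually (\<lambda>t. t \<in> {a<..<b}) (nhds x)"
    using x by (intro eventually_nhds_in_open) auto
  then have "eventually (\<lambda>t. deriv f t = D 1 t) (nhds x)"
    by eventually_elim (use d1 in auto)
  then have "deriv (deriv f) x = deriv (D 1) x" by (rule deriv_cong_ev) simp
  also have "\<dots> = D 2 x" using DERIV_imp_deriv[OF D'[of 1 x]] x by (simp add: numeral_2_eq_2)
  finally have d2: "deriv (deriv f) x = D 2 x" .
  obtain B where "\<forall>z\<in>D 4 ` {a..b}. norm z \<le> B"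
    using bd unfolding bounded_iff by blast
  then have B: "\<bar>D 4 t\<bar> \<le> B" if "t \<in> {a..b}" for t
    using that by simp
  define r where "r = min (x - a) (b - x) / 2"
  have r0: "0 < r" using x by (simp add: r_def)
  have half: "a < x - y / 2" "x + y / 2 < b" if "y \<le> x - a" "y \<le> b - x" for y
    using x that by (simp_all add: field_simps)
  have r: "a < x - r" "x + r < b"
    unfolding r_def by (rule half; simp)+
  show thesis
  proof (rule that[of r "D 3 x / 6" "B / 24"])
    fix h :: real assume h: "\<bar>h\<bar> \<le> r"
    show "\<bar>f (x + h) - (f x + deriv f x * h + deriv (deriv f) x / 2 * h ^ 2 + D 3 x / 6 * h ^ 3)\<bar> \<le> B / 24 * h ^ 4"
    proof (cases "h = 0")
      case False
      have "\<exists>t. (if x + h < x then x + h < t \<and> t < x else x < t \<and> t < x + h) \<and>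
        f (x + h) = (\<Sum>m<4. D m x / fact m * (x + h - x) ^ m) + D 4 t / fact 4 * (x + h - x) ^ 4"
      proof (rule Taylor[of 4 D f "x - r" "x + r"])
        show "\<forall>m t. m < 4 \<and> x - r \<le> t \<and> t \<le> x + r \<longrightarrow> DERIV (D m) t :> D (Suc m) t"
        proof (intro allI impI, elim conjE)
          fix k t assume "k < (4::nat)" "x - r \<le> t" "t \<le> x + r"
          then show "DERIV (D k) t :> D (Suc k) t"
            by (intro D') (use r in linarith)+
        qed
        show "x - r \<le> x + h" "x + h \<le> x + r" using h by (simp_all add: abs_le_iff)
      qed (use r0 False D0 in simp_all)
      then obtain t where t: "if x + h < x then x + h < t \<and> t < x else x < t \<and> t < x + h"
        and eq: "f (x + h) = (\<Sum>m<4. D m x / fact m * h ^ m) + D 4 t / fact 4 * h ^ 4"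
        by auto
      have "t \<in> {a..b}" using t h r unfolding atLeastAtMost_iff by (cases "x + h < x") auto
      then have Bt: "\<bar>D 4 t\<bar> \<le> B" by (rule B)
      have "f (x + h) - (f x + deriv f x * h + deriv (deriv f) x / 2 * h ^ 2 + D 3 x / 6 * h ^ 3) = D 4 t / 24 * h ^ 4"
        unfolding eq d2 d1[OF x] by (simp add: eval_nat_numeral D0 fact_numeral)
      then have "\<bar>f (x + h) - (f x + deriv f x * h + deriv (deriv f) x / 2 * h ^ 2 + D 3 x / 6 * h ^ 3)\<bar> = \<bar>D 4 t\<bar> / 24 * h ^ 4"
        by (simp only: abs_mult abs_divide) simp
      also have "\<dots> \<le> B / 24 * h ^ 4" using Bt by (intro mult_right_mono) simp_all
      finally show ?thesis .
    qed simp
  qed (use r0 in auto)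
qed

text \<open>This is the origin of \<open>rho_mu\<close>. In the composite, the linear Taylor term of
  \<open>F\<close> multiplies the curvature of \<mu> and the cross term of \<mu> and
  \<open>s\<close>, and the quadratic term multiplies the squared slope
  \<open>(\<mu>' / s)^2\<close>. Factoring \<open>- F'(0) / (2 * s x)\<close> out of their sum
  leaves \<open>rho_mu\<close>.\<close>

lemma expands_location:
  assumes \<mu>: "bounded_C 4 {a..b} \<mu>" and s: "bounded_C 4 {a..b} s" and x: "a < x" "x < b"
    and F: "bounded_C 4 {- 1..1} F" and s0: "s x \<noteq> 0" and f0: "deriv F 0 \<noteq> 0"
  shows "\<exists>a1 a3 b1. expands (\<lambda>h \<Delta>. F ((\<mu> x + \<Delta> - \<mu> (x + h)) / s (x + h)) - F 0)
    0 a1 (- (deriv F 0 / s x) * (rho_mu \<mu> s (deriv F) x / 2)) a3 (deriv F 0 / s x) b1"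
proof -
  obtain m3 C1 r1 where "0 < r1" "\<And>h. \<bar>h\<bar> \<le> r1 \<Longrightarrow>
      \<bar>\<mu> (x + h) - (\<mu> x + deriv \<mu> x * h + deriv (deriv \<mu>) x / 2 * h ^ 2 + m3 * h ^ 3)\<bar> \<le> C1 * h ^ 4"
    by (rule bounded_C_taylor[OF \<mu> x]) blast
  from expands_taylor[OF this] have E\<mu>: "expands (\<lambda>h \<Delta>. \<mu> (x + h)) (\<mu> x) (deriv \<mu> x) (deriv (deriv \<mu>) x / 2) m3 0 0"
    by simp
  obtain s3 C2 r2 where "0 < r2" "\<And>h. \<bar>h\<bar> \<le> r2 \<Longrightarrow>
      \<bar>s (x + h) - (s x + deriv s x * h + deriv (deriv s) x / 2 * h ^ 2 + s3 * h ^ 3)\<bar> \<le> C2 * h ^ 4"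
    by (rule bounded_C_taylor[OF s x]) blast
  from expands_taylor[OF this] have "expands (\<lambda>h \<Delta>. s (x + h)) (s x) (deriv s x) (deriv (deriv s) x / 2) s3 0 0"
    by simp
  from expands_inverse[OF this s0] obtain p2 p3
    where Ep: "expands (\<lambda>h \<Delta>. 1 / s (x + h)) (1 / s x) (- deriv s x / (s x)\<^sup>2) p2 p3 0 0" by blast
  obtain F3 C3 r3 where r3: "0 < r3" and F3: "\<And>h. \<bar>h\<bar> \<le> r3 \<Longrightarrow>
      \<bar>F (0 + h) - (F 0 + deriv F 0 * h + deriv (deriv F) 0 / 2 * h ^ 2 + F3 * h ^ 3)\<bar> \<le> C3 * h ^ 4"
    by (rule bounded_C_taylor[OF F, of 0]) (simp, simp, blast)
  have F': "\<bar>(F y - F 0) - (0 + deriv F 0 * y + deriv (deriv F) 0 / 2 * y ^ 2 + F3 * y ^ 3)\<bar> \<le> C3 * y ^ 4"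
    if "\<bar>y\<bar> \<le> r3" for y
    using F3[OF that] by (simp add: algebra_simps)
  have "expands (\<lambda>h \<Delta>. \<Delta> + - 1 * (\<mu> (x + h) + - \<mu> x)) 0 (- deriv \<mu> x) (- (deriv (deriv \<mu>) x / 2)) (- m3) 1 0"
    using expands_add[OF expands_shift expands_scale[OF expands_add[OF E\<mu> expands_const[of "- \<mu> x"]], of "- 1"]]
    by simp
  from expands_mult[OF this Ep]
  obtain c3 b1 where "expands (\<lambda>h \<Delta>. (\<Delta> + - 1 * (\<mu> (x + h) + - \<mu> x)) * (1 / s (x + h)))
     0 (- deriv \<mu> x / s x) (deriv \<mu> x * deriv s x / (s x)\<^sup>2 - deriv (deriv \<mu>) x / (2 * s x)) c3 (1 / s x) b1"
    by (simp add: algebra_simps)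
  moreover have "(\<lambda>h \<Delta>. (\<Delta> + - 1 * (\<mu> (x + h) + - \<mu> x)) * (1 / s (x + h))) = (\<lambda>h \<Delta>. (\<mu> x + \<Delta> - \<mu> (x + h)) / s (x + h))"
    by (simp add: fun_eq_iff add.commute)
  ultimately have Ec: "expands (\<lambda>h \<Delta>. (\<mu> x + \<Delta> - \<mu> (x + h)) / s (x + h))
     0 (- deriv \<mu> x / s x) (deriv \<mu> x * deriv s x / (s x)\<^sup>2 - deriv (deriv \<mu>) x / (2 * s x)) c3 (1 / s x) b1"
    by simp
  from expands_compose[OF Ec r3, of "\<lambda>y. F y - F 0", OF F']
  have "expands (\<lambda>h \<Delta>. F ((\<mu> x + \<Delta> - \<mu> (x + h)) / s (x + h)) - F 0) 0
    (deriv F 0 * (- deriv \<mu> x / s x))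
    (deriv F 0 * (deriv \<mu> x * deriv s x / (s x)\<^sup>2 - deriv (deriv \<mu>) x / (2 * s x))
       + deriv (deriv F) 0 / 2 * (- deriv \<mu> x / s x)\<^sup>2)
    (deriv F 0 * c3 + 2 * (deriv (deriv F) 0 / 2) * (- deriv \<mu> x / s x)
        * (deriv \<mu> x * deriv s x / (s x)\<^sup>2 - deriv (deriv \<mu>) x / (2 * s x)) + F3 * (- deriv \<mu> x / s x) ^ 3)
    (deriv F 0 * (1 / s x)) (deriv F 0 * b1 + 2 * (deriv (deriv F) 0 / 2) * (- deriv \<mu> x / s x) * (1 / s x))"
    by simp
  moreover have "deriv F 0 * (deriv \<mu> x * deriv s x / (s x)\<^sup>2 - deriv (deriv \<mu>) x / (2 * s x))
       + deriv (deriv F) 0 / 2 * (- deriv \<mu> x / s x)\<^sup>2 = - (deriv F 0 / s x) * (rho_mu \<mu> s (deriv F) x / 2)"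
    using s0 f0 by (simp add: rho_mu_def power2_eq_square field_simps)
  ultimately show ?thesis by auto
qed

text \<open>By symmetry of \<open>K\<close> the odd moments vanish, and with them the
  \<open>h\<close>, \<open>h^3\<close> and \<open>\<Delta> * h\<close> terms. What remains is the
  second moment with coefficient \<open>a2\<close> and the total mass 1 with coefficient
  \<open>b0\<close>. The pointwise error passes through the integral because \<open>K\<close> is a
  probability density.\<close>

lemma kernel_expansion:
  fixes K :: "real \<Rightarrow> real"
  assumes g: "expands g 0 a1 a2 a3 b0 b1" and R: "0 < R"
    and contK: "continuous_on {- R..R} K" and nonneg: "\<And>v. 0 \<le> K v"
    and K1: "integral {- R..R} K = 1" and sym: "\<And>v. K (- v) = K v"
    and contg: "\<And>\<Delta>. \<bar>\<Delta>\<bar> \<le> rg \<Longrightarrow> continuous_on {- rg..rg} (\<lambda>h. g h \<Delta>)" and rg: "0 < rg"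
  shows "\<exists>C r. 0 < r \<and> (\<forall>c \<Delta>. 0 < c \<and> c \<le> r \<and> \<bar>\<Delta>\<bar> \<le> r \<longrightarrow>
    \<bar>integral {- R..R} (\<lambda>v. K v * g (c * v) \<Delta>) - (a2 * c\<^sup>2 * integral {- R..R} (\<lambda>v. v\<^sup>2 * K v) + b0 * \<Delta>)\<bar>
      \<le> C * (c ^ 4 + \<bar>\<Delta>\<bar> * c\<^sup>2 + \<Delta>\<^sup>2))"
proof -
  obtain C r where r: "0 < r" "r \<le> 1" and C: "0 \<le> C" and 1: "\<And>h \<Delta>. \<bar>h\<bar> \<le> r \<Longrightarrow> \<bar>\<Delta>\<bar> \<le> r \<Longrightarrow>
     \<bar>g h \<Delta> - (0 + a1 * h + a2 * h ^ 2 + a3 * h ^ 3 + \<Delta> * (b0 + b1 * h))\<bar>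
       \<le> C * (h ^ 4 + \<bar>\<Delta>\<bar> * h\<^sup>2 + \<Delta>\<^sup>2)"
    by (rule expandsE[OF g]) blast
  have odd: "integral {- R..R} (\<lambda>v. v ^ k * K v) = 0" if "odd k" for k
  proof -
    have "integral {- R..R} (\<lambda>v. v ^ k * K v) = integral {- R..R} (\<lambda>v. (- v) ^ k * K (- v))"
      using Henstock_Kurzweil_Integration.integral_reflect_real[of R "- R" "\<lambda>v. v ^ k * K v"] by simp
    also have "\<dots> = - integral {- R..R} (\<lambda>v. v ^ k * K v)"
      using that by (simp add: sym)
    finally show ?thesis by simp
  qed
  have ik: "(\<lambda>v. v ^ k * K v) integrable_on {- R..R}" for k
    by (intro integrable_continuous_interval continuous_intros contK)
  \<comment> \<open>\<open>S\<close> dominates \<open>v^4\<close>, \<open>v^2\<close> and 1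
    simultaneously on the support. The radius \<open>r'\<close> below is chosen so that
    \<open>c * v\<close> stays where both the expansion and the continuity of \<open>g\<close> are
    available.\<close>
  define S where "S = R ^ 4 + R\<^sup>2 + 1"
  define r' where "r' = min r rg / (R + 1)"
  have r'0: "0 < r'" using r rg R by (simp add: r'_def)
  have "\<bar>integral {- R..R} (\<lambda>v. K v * g (c * v) \<Delta>) - (a2 * c\<^sup>2 * integral {- R..R} (\<lambda>v. v\<^sup>2 * K v) + b0 * \<Delta>)\<bar>
      \<le> C * S * (c ^ 4 + \<bar>\<Delta>\<bar> * c\<^sup>2 + \<Delta>\<^sup>2)"
    if c: "0 < c" "c \<le> r'" and \<Delta>: "\<bar>\<Delta>\<bar> \<le> min r' (min r rg)" for c \<Delta>
  proof -
    define P where "P v = a1 * (c * v) + a2 * (c * v) ^ 2 + a3 * (c * v) ^ 3 + \<Delta> * (b0 + b1 * (c * v))" for v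
    define E where "E = c ^ 4 + \<bar>\<Delta>\<bar> * c\<^sup>2 + \<Delta>\<^sup>2"
    have cR: "c * R \<le> min r rg"
    proof -
      have "c * R \<le> r' * (R + 1)" using c R by (intro mult_mono) auto
      also have "\<dots> = min r rg" using R by (simp add: r'_def)
      finally show ?thesis .
    qed
    have cv: "\<bar>c * v\<bar> \<le> r" "c * v \<in> {- rg..rg}" if "v \<in> {- R..R}" for v
    proof -
      have "\<bar>c * v\<bar> \<le> c * R" using that c by (auto simp: abs_mult intro!: mult_left_mono)
      then show "\<bar>c * v\<bar> \<le> r" "c * v \<in> {- rg..rg}" using cR by auto
    qed
    have KP: "((\<lambda>v. K v * P v) has_integral (a2 * c\<^sup>2 * integral {- R..R} (\<lambda>v. v\<^sup>2 * K v) + b0 * \<Delta>)) {- R..R}"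
    proof -
      have h: "((\<lambda>v. v ^ k * K v) has_integral integral {- R..R} (\<lambda>v. v ^ k * K v)) {- R..R}" for k
        by (rule integrable_integral[OF ik])
      have h1: "((\<lambda>v. v ^ 1 * K v) has_integral 0) {- R..R}" using h[of 1] odd[of 1] by simp
      have h3: "((\<lambda>v. v ^ 3 * K v) has_integral 0) {- R..R}" using h[of 3] odd[of 3] by simp
      have h0: "((\<lambda>v. v ^ 0 * K v) has_integral 1) {- R..R}" using h[of 0] K1 by simp
      have "((\<lambda>v. (a1 * c + \<Delta> * b1 * c) * (v ^ 1 * K v) + a2 * c\<^sup>2 * (v ^ 2 * K v) + a3 * c ^ 3 * (v ^ 3 * K v) + b0 * \<Delta> * (v ^ 0 * K v))
         has_integral ((a1 * c + \<Delta> * b1 * c) * 0 + a2 * c\<^sup>2 * integral {- R..R} (\<lambda>v. v ^ 2 * K v) + a3 * c ^ 3 * 0 + b0 * \<Delta> * 1)) {- R..R}"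
        by (intro has_integral_add has_integral_mult_right h1 h h3 h0)
      moreover have "(\<lambda>v. (a1 * c + \<Delta> * b1 * c) * (v ^ 1 * K v) + a2 * c\<^sup>2 * (v ^ 2 * K v) + a3 * c ^ 3 * (v ^ 3 * K v) + b0 * \<Delta> * (v ^ 0 * K v))
          = (\<lambda>v. K v * P v)"
        by (simp add: fun_eq_iff P_def algebra_simps power_mult_distrib)
      ultimately show ?thesis by simp
    qed
    have ig: "(\<lambda>v. K v * g (c * v) \<Delta>) integrable_on {- R..R}"
    proof (rule integrable_continuous_interval, rule continuous_on_mult[OF contK])
      have "continuous_on {- rg..rg} (\<lambda>h. g h \<Delta>)" by (rule contg) (use \<Delta> in auto)
      then show "continuous_on {- R..R} (\<lambda>v. g (c * v) \<Delta>)"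
        by (rule continuous_on_compose2) (use cv in \<open>auto intro!: continuous_intros\<close>)
    qed
    have iK: "K integrable_on {- R..R}" using ik[of 0] by simp
    have "norm (integral {- R..R} (\<lambda>v. K v * g (c * v) \<Delta> - K v * P v)) \<le> integral {- R..R} (\<lambda>v. (C * S * E) * K v)"
    proof (rule integral_norm_bound_integral)
      show "(\<lambda>v. K v * g (c * v) \<Delta> - K v * P v) integrable_on {- R..R}"
        using ig KP by (intro Henstock_Kurzweil_Integration.integrable_diff) (auto simp: integrable_on_def)
      show "(\<lambda>v. (C * S * E) * K v) integrable_on {- R..R}"
        using integrable_on_cmult_left[OF iK, of "C * S * E"] by simp
      fix v assume v: "v \<in> {- R..R}"
      have "\<bar>g (c * v) \<Delta> - P v\<bar> \<le> C * ((c * v) ^ 4 + \<bar>\<Delta>\<bar> * (c * v)\<^sup>2 + \<Delta>\<^sup>2)"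
        using 1[OF cv(1)[OF v]] \<Delta> by (simp add: P_def)
      also have "\<dots> \<le> C * (S * E)"
      proof (rule mult_left_mono[OF _ C])
        have v2: "v\<^sup>2 \<le> R\<^sup>2" using v R by (auto simp: abs_le_square_iff[symmetric])
        have v4: "v ^ 4 \<le> R ^ 4"
          using power_mono[OF v2, of 2] by simp
        have S1: "R ^ 4 \<le> S" "R\<^sup>2 \<le> S" "1 \<le> S" by (auto simp: S_def)
        have "c ^ 4 * v ^ 4 \<le> c ^ 4 * S" "(\<bar>\<Delta>\<bar> * c\<^sup>2) * v\<^sup>2 \<le> (\<bar>\<Delta>\<bar> * c\<^sup>2) * S" "\<Delta>\<^sup>2 * 1 \<le> \<Delta>\<^sup>2 * S"
          using v2 v4 S1 by (intro mult_left_mono order_trans[OF v4] order_trans[OF v2] S1; simp)+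
        then show "(c * v) ^ 4 + \<bar>\<Delta>\<bar> * (c * v)\<^sup>2 + \<Delta>\<^sup>2 \<le> S * E"
          by (simp add: E_def power_mult_distrib algebra_simps)
      qed
      finally have "K v * \<bar>g (c * v) \<Delta> - P v\<bar> \<le> K v * (C * (S * E))"
        by (rule mult_left_mono) (rule nonneg)
      then show "norm (K v * g (c * v) \<Delta> - K v * P v) \<le> (C * S * E) * K v"
        by (simp add: right_diff_distrib[symmetric] abs_mult nonneg mult_ac)
    qed
    also have "integral {- R..R} (\<lambda>v. (C * S * E) * K v) = C * S * E"
      using K1 by simp
    also have "integral {- R..R} (\<lambda>v. K v * g (c * v) \<Delta> - K v * P v)
      = integral {- R..R} (\<lambda>v. K v * g (c * v) \<Delta>) - (a2 * c\<^sup>2 * integral {- R..R} (\<lambda>v. v\<^sup>2 * K v) + b0 * \<Delta>)"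
      using KP ig by (subst Henstock_Kurzweil_Integration.integral_diff) (auto simp: integrable_on_def integral_unique)
    finally show ?thesis by (simp add: E_def)
  qed
  then show ?thesis
    using r'0 r rg by (intro exI[of _ "C * S"] exI[of _ "min r' (min r rg)"]) auto
qed

section \<open>Freezing remote innovations\<close>

definition innovations :: "(int \<Rightarrow> int \<Rightarrow> 'w \<Rightarrow> real) \<Rightarrow> (int \<Rightarrow> 'w \<Rightarrow> real) \<Rightarrow> ((int \<times> int) + int) \<Rightarrow> 'w \<Rightarrow> real" where
  "innovations \<epsilon> \<epsilon>' = case_sum (\<lambda>(i, j). \<epsilon> i j) \<epsilon>'"

definition splice :: "nat \<Rightarrow> (int \<Rightarrow> real) \<Rightarrow> (int \<Rightarrow> real) \<Rightarrow> int \<Rightarrow> real" where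
  "splice k u y = (\<lambda>l. if \<bar>l\<bar> \<le> int k then u l else y l)"

definition err_trunc ::
  "((int \<Rightarrow> real) \<Rightarrow> real) \<Rightarrow> (int \<Rightarrow> int \<Rightarrow> 'w \<Rightarrow> real) \<Rightarrow> (int \<Rightarrow> real) \<Rightarrow> nat \<Rightarrow> int \<Rightarrow> int \<Rightarrow> 'w \<Rightarrow> real" where
  "err_trunc G \<epsilon> y k i j \<omega> = G (splice k (\<lambda>l. \<epsilon> i (j + l) \<omega>) y)"

abbreviation "paths \<equiv> PiM (UNIV :: int set) (\<lambda>_. borel :: real measure)"

lemma splice_measurable [measurable]:
  "(\<lambda>p. splice k (fst p) (snd p)) \<in> measurable (paths \<Otimes>\<^sub>M paths) paths"
proof (rule measurable_PiM_single')
  fix l :: int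
  show "(\<lambda>p. splice k (fst p) (snd p) l) \<in> borel_measurable (paths \<Otimes>\<^sub>M paths)"
  proof (cases "\<bar>l\<bar> \<le> int k")
    case True
    then show ?thesis
      using measurable_compose[OF measurable_fst measurable_component_singleton[of l UNIV]]
      by (simp add: splice_def)
  next
    case False
    then show ?thesis
      using measurable_compose[OF measurable_snd measurable_component_singleton[of l UNIV]]
      by (simp add: splice_def)
  qed
qed auto

lemma splice_measurable1 [measurable]: "(\<lambda>u. splice k u y) \<in> measurable paths paths"
proof -
  have "(\<lambda>u. (u, y)) \<in> measurable paths (paths \<Otimes>\<^sub>M paths)"
    by (rule measurable_Pair2') (simp add: space_PiM)
  from measurable_compose[OF this splice_measurable] show ?thesis by simp
qed

lemma depends_on_err_trunc:
  assumes G: "G \<in> borel_measurable paths"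
  shows "depends_on (innovations \<epsilon> \<epsilon>') ((\<lambda>l. Inl (i, j + l)) ` {- int k..int k}) (err_trunc G \<epsilon> y k i j)"
proof -
  let ?A = "(\<lambda>l. Inl (i, j + l)) ` {- int k..int k} :: ((int \<times> int) + int) set"
  have mem: "Inl (i, j + l) \<in> ?A \<longleftrightarrow> \<bar>l\<bar> \<le> int k" for l
    by (auto simp: image_iff abs_le_iff)
  define h where "h r = G (splice k (\<lambda>l. r (Inl (i, j + l))) y)" for r :: "((int \<times> int) + int) \<Rightarrow> real"
  have "(\<lambda>r. splice k (\<lambda>l. r (Inl (i, j + l))) y) \<in> measurable (PiM ?A (\<lambda>_. borel)) paths"
  proof (rule measurable_PiM_single')
    fix l :: int
    show "(\<lambda>r. splice k (\<lambda>l. r (Inl (i, j + l))) y l) \<in> borel_measurable (PiM ?A (\<lambda>_. borel))"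
    proof (cases "\<bar>l\<bar> \<le> int k")
      case True
      then have "Inl (i, j + l) \<in> ?A" by (simp add: mem)
      then show ?thesis using True by (simp add: splice_def)
    qed (simp add: splice_def)
  qed auto
  from measurable_compose[OF this G] have "h \<in> borel_measurable (PiM ?A (\<lambda>_. borel))"
    by (simp add: h_def[abs_def])
  moreover have "err_trunc G \<epsilon> y k i j \<omega> = h (restrict (\<lambda>z. innovations \<epsilon> \<epsilon>' z \<omega>) ?A)" for \<omega>
    unfolding err_trunc_def h_def splice_def by (intro arg_cong[of _ _ G] ext) (simp add: innovations_def mem)
  ultimately show ?thesis unfolding depends_on_def by blast
qed

text \<open>Independence is tested on finite subfamilies, and an injection carries finite
  subfamilies of the new family to finite subfamilies of the old one. It is used to read a single
  recentred row out of the joint family of all innovations.\<close>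

lemma (in prob_space) indep_vars_reindex_UNIV:
  assumes f: "inj f" and X: "indep_vars (\<lambda>_. N) X UNIV"
  shows "indep_vars (\<lambda>_. N) (\<lambda>k. X (f k)) UNIV"
proof -
  define F where "F i = {X i -` A \<inter> space M |A. A \<in> sets N}" for i
  have rv: "\<And>i. random_variable N (X i)" and F: "indep_sets F UNIV"
    using X by (auto simp: indep_vars_def2 F_def[abs_def])
  have "indep_sets (\<lambda>k. F (f k)) UNIV"
  proof (rule indep_setsI)
    show "F (f k) \<subseteq> events" for k using F by (auto simp: indep_sets_def)
    fix A J assume J: "J \<noteq> {}" "finite J" and A: "\<forall>j\<in>J. A j \<in> F (f j)"
    define A' where "A' z = A (inv f z)" for z
    have inv: "A' (f j) = A j" for j by (simp add: A'_def f)
    have "prob (\<Inter>z\<in>f ` J. A' z) = (\<Prod>z\<in>f ` J. prob (A' z))"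
      by (rule indep_setsD[OF F]) (use J A inv in auto)
    also have "\<dots> = (\<Prod>j\<in>J. prob (A j))"
      by (subst prod.reindex) (use f in \<open>auto simp: inv inj_on_def\<close>)
    finally show "prob (\<Inter>j\<in>J. A j) = (\<Prod>j\<in>J. prob (A j))" by (simp add: inv)
  qed
  then show ?thesis using rv by (simp add: indep_vars_def2 F_def[abs_def])
qed

locale error_process = prob_space M for M :: "'w measure" +
  fixes \<epsilon> :: "int \<Rightarrow> int \<Rightarrow> 'w \<Rightarrow> real" and \<epsilon>' :: "int \<Rightarrow> 'w \<Rightarrow> real" and G :: "(int \<Rightarrow> real) \<Rightarrow> real"
  assumes iid: "iid_innovations M \<epsilon> \<epsilon>'"
    and G [measurable]: "G \<in> borel_measurable paths"
    and D: "cond_D M G \<epsilon> \<epsilon>'"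
begin

lemma indep_innovations: "indep_vars (\<lambda>_. borel) (innovations \<epsilon> \<epsilon>') UNIV"
  using iid by (simp add: iid_innovations_def innovations_def)

lemma innovations_measurable [measurable]: "innovations \<epsilon> \<epsilon>' z \<in> borel_measurable M"
  using indep_innovations by (simp add: indep_vars_def)

lemma \<epsilon>_measurable [measurable]: "\<epsilon> i j \<in> borel_measurable M"
  using innovations_measurable[of "Inl (i, j)"] by (simp add: innovations_def)

lemma \<epsilon>'_measurable [measurable]: "\<epsilon>' j \<in> borel_measurable M"
  using innovations_measurable[of "Inr j"] by (simp add: innovations_def)

lemma path_measurable [measurable]: "(\<lambda>\<omega> l. \<epsilon> i (j + l) \<omega>) \<in> measurable M paths"
  by (rule measurable_PiM_single') auto

lemma path'_measurable [measurable]: "(\<lambda>\<omega> l. \<epsilon>' l \<omega>) \<in> measurable M paths"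
  by (rule measurable_PiM_single') auto

text \<open>The right-hand side does not depend on \<open>i\<close> and \<open>j\<close>. This is
  the stationarity that gives all errors the same law and later lets one frozen tail serve all
  sites.\<close>

lemma distr_path: "distr M paths (\<lambda>\<omega> l. \<epsilon> i (j + l) \<omega>) = PiM UNIV (\<lambda>_. distr M borel (\<epsilon> 0 0))"
proof -
  have inj: "inj (\<lambda>l. Inl (i, j + l) :: (int \<times> int) + int)" by (auto simp: inj_on_def)
  have "indep_vars (\<lambda>_. borel) (\<lambda>l. innovations \<epsilon> \<epsilon>' (Inl (i, j + l))) (UNIV :: int set)"
    by (rule indep_vars_reindex_UNIV[OF inj indep_innovations])
  then have "indep_vars (\<lambda>_. borel) (\<lambda>l. \<epsilon> i (j + l)) (UNIV :: int set)"
    by (simp add: innovations_def)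
  then have "distr M paths (\<lambda>\<omega>. \<lambda>l\<in>UNIV. \<epsilon> i (j + l) \<omega>) = PiM UNIV (\<lambda>l. distr M borel (\<epsilon> i (j + l)))"
    by (subst (asm) indep_vars_iff_distr_eq_PiM) auto
  moreover have "distr M borel (\<epsilon> i (j + l)) = distr M borel (\<epsilon> 0 0)" for l
    using iid unfolding iid_innovations_def by blast
  ultimately show ?thesis by (simp add: restrict_UNIV)
qed

lemma distr_path_eq: "distr M paths (\<lambda>\<omega> l. \<epsilon> i (j + l) \<omega>) = distr M paths (\<lambda>\<omega> l. \<epsilon> 0 l \<omega>)"
  using distr_path[of i j] distr_path[of 0 0] by simp

lemma err_measurable [measurable]: "err G \<epsilon> i j \<in> borel_measurable M"
  unfolding err_def[abs_def] by measurable

lemma err_trunc_measurable [measurable]: "err_trunc G \<epsilon> y k i j \<in> borel_measurable M"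
  unfolding err_trunc_def[abs_def] by measurable

lemma distr_err: "distr M borel (err G \<epsilon> i j) = distr M borel (err G \<epsilon> 0 0)"
proof -
  have eq: "distr M borel (err G \<epsilon> i j) = distr (distr M paths (\<lambda>\<omega> l. \<epsilon> i (j + l) \<omega>)) borel G" for i j
    by (subst distr_distr) (auto simp: comp_def err_def[abs_def])
  show ?thesis
    unfolding eq[of i j] eq[of 0 0] distr_path_eq[of i j] by simp
qed

lemma prob_err_le: "prob {\<omega> \<in> space M. err G \<epsilon> i j \<omega> \<le> c} = F_err M G \<epsilon> c"
proof -
  have "F_err M G \<epsilon> c = measure (distr M borel (err G \<epsilon> i j)) {..c}"
    by (simp add: F_err_def cdf_def distr_err[of i j])
  also have "\<dots> = prob (err G \<epsilon> i j -` {..c} \<inter> space M)" by (rule measure_distr) auto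
  finally show ?thesis by (simp add: vimage_def Int_def conj_commute)
qed

lemma indep_paths: "indep_var paths (\<lambda>\<omega> l. \<epsilon> 0 l \<omega>) paths (\<lambda>\<omega> l. \<epsilon>' l \<omega>)"
proof -
  let ?A = "range (\<lambda>l. Inl (0, l)) :: ((int \<times> int) + int) set" and ?B = "range Inr :: ((int \<times> int) + int) set"
  have "indep_var (PiM ?A (\<lambda>_. borel)) (\<lambda>\<omega>. restrict (\<lambda>z. innovations \<epsilon> \<epsilon>' z \<omega>) ?A)
      (PiM ?B (\<lambda>_. borel)) (\<lambda>\<omega>. restrict (\<lambda>z. innovations \<epsilon> \<epsilon>' z \<omega>) ?B)"
    by (rule indep_var_restrict[OF indep_innovations]) auto
  moreover have "(\<lambda>r l. r (Inl (0, l))) \<in> measurable (PiM ?A (\<lambda>_. borel :: real measure)) paths"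
    by (rule measurable_PiM_single') auto
  moreover have "(\<lambda>r l. r (Inr l)) \<in> measurable (PiM ?B (\<lambda>_. borel :: real measure)) paths"
    by (rule measurable_PiM_single') auto
  ultimately have "indep_var paths ((\<lambda>r l. r (Inl (0, l))) \<circ> (\<lambda>\<omega>. restrict (\<lambda>z. innovations \<epsilon> \<epsilon>' z \<omega>) ?A))
      paths ((\<lambda>r l. r (Inr l)) \<circ> (\<lambda>\<omega>. restrict (\<lambda>z. innovations \<epsilon> \<epsilon>' z \<omega>) ?B))"
    by (rule indep_var_compose)
  then show ?thesis by (simp add: comp_def innovations_def)
qed

text \<open>
  By Fubini, the coupled tail may be frozen at a deterministic sequence \<open>y\<close>; the truncated
  errors then depend on finitely many innovations of the original array only.
\<close>

lemma frozen_tail_exists: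
  obtains y where "\<And>i j. prob {\<omega> \<in> space M. \<bar>err G \<epsilon> i j \<omega> - err_trunc G \<epsilon> y k i j \<omega>\<bar> > \<eta>}
    \<le> prob {\<omega> \<in> space M. \<bar>err G \<epsilon> 0 0 \<omega> - err_coupled G \<epsilon> \<epsilon>' k \<omega>\<bar> > \<eta>}"
proof -
  define U where "U = distr M paths (\<lambda>\<omega> l. \<epsilon> 0 l \<omega>)"
  define V where "V = distr M paths (\<lambda>\<omega> l. \<epsilon>' l \<omega>)"
  have m0: "(\<lambda>\<omega> l. \<epsilon> 0 l \<omega>) \<in> measurable M paths" using path_measurable[of 0 0] by simp
  interpret U: prob_space U unfolding U_def using m0 by (rule prob_space_distr)
  interpret V: prob_space V unfolding V_def by (rule prob_space_distr) simp
  interpret UV: pair_prob_space U V ..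
  have sets [simp, measurable_cong]: "sets U = sets paths" "sets V = sets paths"
    and space [simp]: "space U = UNIV" "space V = UNIV"
    by (simp_all add: U_def V_def space_PiM)
  define B where "B = {p \<in> space (U \<Otimes>\<^sub>M V). \<bar>G (fst p) - G (splice k (fst p) (snd p))\<bar> > \<eta>}"
  have sp: "(\<lambda>p. splice k (fst p) (snd p)) \<in> measurable (U \<Otimes>\<^sub>M V) paths"
    using splice_measurable by (simp cong: measurable_cong_sets add: sets_pair_measure_cong[OF sets])
  have B [measurable]: "B \<in> sets (U \<Otimes>\<^sub>M V)"
    unfolding B_def using measurable_compose[OF sp G] by measurable
  \<comment> \<open>\<open>f y\<close> is the conditional probability of a large coupling error when
    the independent tail equals \<open>y\<close>; averaging it over the law \<open>V\<close> of the
    tail returns the coupling probability.\<close>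
  define f where "f y = measure U {u. \<bar>G u - G (splice k u y)\<bar> > \<eta>}" for y
  have slice: "(\<lambda>u. (u, y)) -` B = {u. \<bar>G u - G (splice k u y)\<bar> > \<eta>}" for y
    by (auto simp: B_def space_pair_measure)
  have f_meas: "f \<in> borel_measurable V"
  proof -
    have "(\<lambda>y. emeasure U ((\<lambda>u. (u, y)) -` B)) \<in> borel_measurable V"
      by (rule UV.measurable_emeasure_Pair2[OF B])
    then show ?thesis unfolding f_def[abs_def] slice measure_def by measurable
  qed
  have f_int: "integrable V f"
    by (rule V.integrable_const_bound[of _ 1]) (use f_meas in \<open>auto simp: f_def\<close>)
  have p: "prob {\<omega> \<in> space M. \<bar>err G \<epsilon> 0 0 \<omega> - err_coupled G \<epsilon> \<epsilon>' k \<omega>\<bar> > \<eta>} = (\<integral>y. f y \<partial>V)"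
  proof -
    have coupled: "err_coupled G \<epsilon> \<epsilon>' k \<omega> = G (splice k (\<lambda>l. \<epsilon> 0 l \<omega>) (\<lambda>l. \<epsilon>' l \<omega>))" for \<omega>
      by (simp add: err_coupled_def splice_def)
    have pair: "U \<Otimes>\<^sub>M V = distr M (paths \<Otimes>\<^sub>M paths) (\<lambda>\<omega>. (\<lambda>l. \<epsilon> 0 l \<omega>, \<lambda>l. \<epsilon>' l \<omega>))"
      unfolding U_def V_def using indep_paths by (simp add: indep_var_distribution_eq)
    have "emeasure (U \<Otimes>\<^sub>M V) B = emeasure M ((\<lambda>\<omega>. (\<lambda>l. \<epsilon> 0 l \<omega>, \<lambda>l. \<epsilon>' l \<omega>)) -` B \<inter> space M)"
      using B m0 unfolding pair by (subst emeasure_distr) auto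
    also have "(\<lambda>\<omega>. (\<lambda>l. \<epsilon> 0 l \<omega>, \<lambda>l. \<epsilon>' l \<omega>)) -` B \<inter> space M
       = {\<omega> \<in> space M. \<bar>err G \<epsilon> 0 0 \<omega> - err_coupled G \<epsilon> \<epsilon>' k \<omega>\<bar> > \<eta>}"
      by (auto simp: B_def space_pair_measure err_def coupled)
    finally have "ennreal (prob {\<omega> \<in> space M. \<bar>err G \<epsilon> 0 0 \<omega> - err_coupled G \<epsilon> \<epsilon>' k \<omega>\<bar> > \<eta>})
       = emeasure (U \<Otimes>\<^sub>M V) B" by (simp add: emeasure_eq_measure)
    also have "\<dots> = (\<integral>\<^sup>+y. ennreal (f y) \<partial>V)"
      by (subst UV.emeasure_pair_measure_alt2[OF B]) (simp add: slice f_def U.emeasure_eq_measure)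
    also have "\<dots> = ennreal (\<integral>y. f y \<partial>V)"
      by (rule nn_integral_eq_integral[OF f_int]) (simp add: f_def)
    finally have eq: "ennreal (prob {\<omega> \<in> space M. \<bar>err G \<epsilon> 0 0 \<omega> - err_coupled G \<epsilon> \<epsilon>' k \<omega>\<bar> > \<eta>})
       = ennreal (\<integral>y. f y \<partial>V)" .
    have "0 \<le> (\<integral>y. f y \<partial>V)"
      by (intro Bochner_Integration.integral_nonneg) (simp add: f_def)
    with eq show ?thesis by (subst (asm) ennreal_inj) auto
  qed
  \<comment> \<open>A function cannot exceed its mean everywhere under a probability
    measure.\<close>
  have "\<exists>y. f y \<le> (\<integral>y. f y \<partial>V)"
  proof (rule ccontr)
    assume "\<not> (\<exists>y. f y \<le> (\<integral>y. f y \<partial>V))"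
    then have "AE y in V. (\<integral>y. f y \<partial>V) < f y" by (intro AE_I2) (auto simp: not_le)
    from V.expectation_greater[OF f_int this] show False by simp
  qed
  then obtain y where y: "f y \<le> (\<integral>y. f y \<partial>V)" by blast
  show thesis
  proof (rule that[of y])
    fix i j
    have set: "{u. \<bar>G u - G (splice k u y)\<bar> > \<eta>} \<in> sets paths"
    proof -
      have "{u \<in> space paths. \<bar>G u - G (splice k u y)\<bar> > \<eta>} \<in> sets paths" by measurable
      then show ?thesis by (simp add: space_PiM)
    qed
    \<comment> \<open>The law of the recentred path is the same at every site, so \<open>y\<close>
      depends on \<open>k\<close> and \<eta> but not on \<open>i\<close> and
      \<open>j\<close>.\<close>
    have "f y = measure (distr M paths (\<lambda>\<omega> l. \<epsilon> i (j + l) \<omega>)) {u. \<bar>G u - G (splice k u y)\<bar> > \<eta>}"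
      by (simp add: f_def U_def distr_path_eq)
    also have "\<dots> = prob ((\<lambda>\<omega> l. \<epsilon> i (j + l) \<omega>) -` {u. \<bar>G u - G (splice k u y)\<bar> > \<eta>} \<inter> space M)"
      by (rule measure_distr[OF path_measurable set])
    also have "(\<lambda>\<omega> l. \<epsilon> i (j + l) \<omega>) -` {u. \<bar>G u - G (splice k u y)\<bar> > \<eta>} \<inter> space M
       = {\<omega> \<in> space M. \<bar>err G \<epsilon> i j \<omega> - err_trunc G \<epsilon> y k i j \<omega>\<bar> > \<eta>}"
      by (auto simp: err_def err_trunc_def)
    finally show "prob {\<omega> \<in> space M. \<bar>err G \<epsilon> i j \<omega> - err_trunc G \<epsilon> y k i j \<omega>\<bar> > \<eta>}
        \<le> prob {\<omega> \<in> space M. \<bar>err G \<epsilon> 0 0 \<omega> - err_coupled G \<epsilon> \<epsilon>' k \<omega>\<bar> > \<eta>}"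
      using y p by linarith
  qed
qed

text \<open>Markov's inequality with the decay rate split in half: at threshold
  \<open>\<rho> powr (k / 2)\<close> the moment bound of order \<open>\<rho> powr (q * k)\<close>
  loses \<open>\<rho> powr (q * k / 2)\<close> and keeps the same amount. Taking \<open>r\<close> as
  the larger of the two resulting bases lets one number describe both the threshold and the
  probability.\<close>

lemma prob_coupling_bound:
  obtains C r where "0 \<le> C" "0 < r" "r < 1"
    "\<forall>\<^sub>F k in sequentially.
      prob {\<omega> \<in> space M. \<bar>err G \<epsilon> 0 0 \<omega> - err_coupled G \<epsilon> \<epsilon>' k \<omega>\<bar> > r ^ k} \<le> C * r ^ k"
proof -
  obtain q \<rho> where q: "q > 0" and \<rho>: "0 < \<rho>" "\<rho> < 1"
    and int: "\<forall>\<^sub>F k in sequentially.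
           integrable M (\<lambda>\<omega>. \<bar>err G \<epsilon> 0 0 \<omega> - err_coupled G \<epsilon> \<epsilon>' k \<omega>\<bar> powr q)"
    and O: "(\<lambda>k. Lq_norm M q (\<lambda>\<omega>. err G \<epsilon> 0 0 \<omega> - err_coupled G \<epsilon> \<epsilon>' k \<omega>)) \<in> O(\<lambda>k. \<rho> ^ k)"
    using D unfolding cond_D_def by blast
  obtain C where C: "C > 0" and ev: "\<forall>\<^sub>F k in sequentially.
      norm (Lq_norm M q (\<lambda>\<omega>. err G \<epsilon> 0 0 \<omega> - err_coupled G \<epsilon> \<epsilon>' k \<omega>)) \<le> C * norm (\<rho> ^ k)"
    using O by (elim landau_o.bigE) auto
  define r where "r = max (\<rho> powr (1 / 2)) (\<rho> powr (q / 2))"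
  have r: "0 < r" "r < 1"
    using \<rho> q powr_less_mono2[of "1 / 2" \<rho> 1] powr_less_mono2[of "q / 2" \<rho> 1] by (auto simp: r_def less_max_iff_disj)
  have "\<forall>\<^sub>F k in sequentially.
      prob {\<omega> \<in> space M. \<bar>err G \<epsilon> 0 0 \<omega> - err_coupled G \<epsilon> \<epsilon>' k \<omega>\<bar> > r ^ k} \<le> C powr q * r ^ k"
    using int ev
  proof eventually_elim
    case (elim k)
    have pw: "(x ^ n) powr p = (x powr p) ^ n" if "0 < x" for x p :: real and n
      using that by (simp add: powr_powr powr_realpow[symmetric] mult.commute)
    define Z where "Z \<omega> = \<bar>err G \<epsilon> 0 0 \<omega> - err_coupled G \<epsilon> \<epsilon>' k \<omega>\<bar> powr q" for \<omega>
    have Z: "integrable M Z" using elim(1) unfolding Z_def[abs_def] .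
    have Z0: "0 \<le> integral\<^sup>L M Z" by (intro Bochner_Integration.integral_nonneg) (simp add: Z_def)
    have "(integral\<^sup>L M Z) powr (1 / q) \<le> C * \<rho> ^ k"
      using elim(2) \<rho> by (simp add: Lq_norm_def Z_def[abs_def])
    then have "((integral\<^sup>L M Z) powr (1 / q)) powr q \<le> (C * \<rho> ^ k) powr q"
      using q by (intro powr_mono2) auto
    then have EZ: "integral\<^sup>L M Z \<le> C powr q * (\<rho> powr q) ^ k"
      using q Z0 C \<rho> by (simp add: powr_powr powr_mult pw del: powr_power)
    define \<eta> where "\<eta> = (\<rho> powr (1 / 2)) ^ k"
    have \<eta>: "0 < \<eta>" "\<eta> \<le> r ^ k" using \<rho> by (auto simp: \<eta>_def r_def intro!: power_mono)
    have \<eta>q: "\<eta> powr q = (\<rho> powr (q / 2)) ^ k"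
      using \<rho> pw[of "\<rho> powr (1 / 2)" k q] by (simp add: \<eta>_def powr_powr mult.commute)
    have "prob {\<omega> \<in> space M. \<bar>err G \<epsilon> 0 0 \<omega> - err_coupled G \<epsilon> \<epsilon>' k \<omega>\<bar> > r ^ k}
       \<le> prob {\<omega> \<in> space M. Z \<omega> \<ge> \<eta> powr q}"
    proof (rule finite_measure_mono)
      show "{\<omega> \<in> space M. \<bar>err G \<epsilon> 0 0 \<omega> - err_coupled G \<epsilon> \<epsilon>' k \<omega>\<bar> > r ^ k} \<subseteq> {\<omega> \<in> space M. Z \<omega> \<ge> \<eta> powr q}"
        using \<eta> q by (auto simp: Z_def intro!: powr_mono2)
      show "{\<omega> \<in> space M. Z \<omega> \<ge> \<eta> powr q} \<in> sets M"
        using borel_measurable_integrable[OF Z] by measurable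
    qed
    also have "\<dots> \<le> integral\<^sup>L M Z / \<eta> powr q"
      by (rule integral_Markov_inequality_measure[OF Z sets.empty_sets]) (use \<eta> in \<open>auto simp: Z_def\<close>)
    also have "\<dots> \<le> C powr q * (\<rho> powr q) ^ k / \<eta> powr q"
      using EZ by (intro divide_right_mono) auto
    also have "\<dots> = C powr q * (\<rho> powr (q / 2)) ^ k"
    proof -
      have "(\<rho> powr q) ^ k = (\<rho> powr (q / 2)) ^ k * (\<rho> powr (q / 2)) ^ k"
        using \<rho> by (simp add: power_mult_distrib[symmetric] powr_add[symmetric])
      then show ?thesis using \<rho> by (simp add: \<eta>q)
    qed
    also have "\<dots> \<le> C powr q * r ^ k"
      by (intro mult_left_mono power_mono) (auto simp: r_def)
    finally show ?case .
  qed
  with r show thesis by (intro that[of "C powr q" r]) auto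
qed

text \<open>The two indicators can differ only if the errors are more than \<open>r ^ k\<close>
  apart or the original error lies close to \<open>c\<close>. The second event is enclosed in an
  interval of length \<open>3 * r ^ k\<close>, whose probability the Lipschitz property of
  \<open>F_err\<close> bounds by \<open>L * 3 * r ^ k\<close>. The bound is uniform in
  \<open>c\<close>, as the thresholds will vary with the design point and with
  \<open>n\<close>.\<close>

lemma truncation:
  assumes lip: "\<And>u v. \<bar>F_err M G \<epsilon> u - F_err M G \<epsilon> v\<bar> \<le> L * \<bar>u - v\<bar>"
  obtains C r where "0 \<le> C" "0 < r" "r < 1"
    "\<forall>\<^sub>F k in sequentially. \<exists>y. \<forall>i j c.
      prob {\<omega> \<in> space M. (err G \<epsilon> i j \<omega> \<le> c) \<noteq> (err_trunc G \<epsilon> y k i j \<omega> \<le> c)} \<le> C * r ^ k"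
proof -
  obtain C r where C: "0 \<le> C" and r: "0 < r" "r < 1" and ev:
    "\<forall>\<^sub>F k in sequentially.
      prob {\<omega> \<in> space M. \<bar>err G \<epsilon> 0 0 \<omega> - err_coupled G \<epsilon> \<epsilon>' k \<omega>\<bar> > r ^ k} \<le> C * r ^ k"
    by (rule prob_coupling_bound)
  have L: "0 \<le> L" using lip[of 1 0] by auto
  show thesis
  proof (rule that[of "C + L * 3" r])
    show "\<forall>\<^sub>F k in sequentially. \<exists>y. \<forall>i j c.
      prob {\<omega> \<in> space M. (err G \<epsilon> i j \<omega> \<le> c) \<noteq> (err_trunc G \<epsilon> y k i j \<omega> \<le> c)} \<le> (C + L * 3) * r ^ k"
      using ev
    proof eventually_elim
      case (elim k)
      obtain y where y: "\<And>i j. prob {\<omega> \<in> space M. \<bar>err G \<epsilon> i j \<omega> - err_trunc G \<epsilon> y k i j \<omega>\<bar> > r ^ k}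
          \<le> prob {\<omega> \<in> space M. \<bar>err G \<epsilon> 0 0 \<omega> - err_coupled G \<epsilon> \<epsilon>' k \<omega>\<bar> > r ^ k}"
        by (rule frozen_tail_exists[of "r ^ k" k]) blast
      show ?case
      proof (intro exI[of _ y] allI)
        fix i j c
        let ?e = "err G \<epsilon> i j" and ?t = "err_trunc G \<epsilon> y k i j"
        have rk: "0 < r ^ k" using r by simp
        have "{\<omega> \<in> space M. (?e \<omega> \<le> c) \<noteq> (?t \<omega> \<le> c)}
           \<subseteq> {\<omega> \<in> space M. \<bar>?e \<omega> - ?t \<omega>\<bar> > r ^ k} \<union>
             ({\<omega> \<in> space M. ?e \<omega> \<le> c + r ^ k} - {\<omega> \<in> space M. ?e \<omega> \<le> c - 2 * r ^ k})" (is "_ \<subseteq> ?A \<union> (?B - ?C)")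
        proof (rule subsetI, rule ccontr)
          fix \<omega> assume \<omega>: "\<omega> \<in> {\<omega> \<in> space M. (?e \<omega> \<le> c) \<noteq> (?t \<omega> \<le> c)}" and n: "\<omega> \<notin> ?A \<union> (?B - ?C)"
          then have "\<bar>?e \<omega> - ?t \<omega>\<bar> \<le> r ^ k" and "?e \<omega> > c + r ^ k \<or> ?e \<omega> \<le> c - 2 * r ^ k" by auto
          with \<omega> rk show False by (auto simp: abs_le_iff)
        qed
        then have "prob {\<omega> \<in> space M. (?e \<omega> \<le> c) \<noteq> (?t \<omega> \<le> c)} \<le> prob (?A \<union> (?B - ?C))"
          by (intro finite_measure_mono) measurable
        also have "\<dots> \<le> prob ?A + prob (?B - ?C)"
          by (rule measure_Un_le) measurable
        also have "prob (?B - ?C) = prob ?B - prob ?C"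
          by (rule finite_measure_Diff) (use rk in \<open>auto\<close>)
        also have "prob ?B - prob ?C \<le> L * (3 * r ^ k)"
        proof -
          have "prob ?B - prob ?C \<le> \<bar>F_err M G \<epsilon> (c + r ^ k) - F_err M G \<epsilon> (c - 2 * r ^ k)\<bar>"
            unfolding prob_err_le by simp
          also have "\<dots> \<le> L * \<bar>(c + r ^ k) - (c - 2 * r ^ k)\<bar>" by (rule lip)
          also have "\<bar>(c + r ^ k) - (c - 2 * r ^ k)\<bar> = 3 * r ^ k" using rk by simp
          finally show ?thesis .
        qed
        finally show "prob {\<omega> \<in> space M. (?e \<omega> \<le> c) \<noteq> (?t \<omega> \<le> c)} \<le> (C + L * 3) * r ^ k"
          using y[of i j] elim by (simp add: algebra_simps)
      qed
    qed
  qed (use C r L in auto)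
qed

end

section \<open>Limits of the mean and of the variance\<close>

lemma lborel_integral_eq_integral:
  fixes f :: "real \<Rightarrow> real"
  assumes "continuous_on {- R..R} f" "\<And>v. R \<le> \<bar>v\<bar> \<Longrightarrow> f v = 0"
  shows "(\<integral>v. f v \<partial>lborel) = integral {- R..R} f"
proof -
  have "set_integrable lborel {- R..R} f" by (rule borel_integrable_atLeastAtMost'[OF assms(1)])
  then have "(LINT v:{- R..R}|lborel. f v) = integral {- R..R} f"
    by (rule set_borel_integral_eq_integral(2))
  moreover have "(LINT v:{- R..R}|lborel. f v) = (\<integral>v. f v \<partial>lborel)"
    unfolding set_lebesgue_integral_def
  proof (rule Bochner_Integration.integral_cong[OF refl])
    fix v show "indicator {- R..R} v *\<^sub>R f v = f v"
      using assms(2)[of v] by (cases "\<bar>v\<bar> \<le> R") (auto simp: indicator_def abs_le_iff)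
  qed
  ultimately show ?thesis by simp
qed

lemma bounded_deriv_lipschitz:
  fixes f :: "real \<Rightarrow> real"
  assumes "\<And>t. t \<in> S \<Longrightarrow> (f has_real_derivative f' t) (at t within S)" and "convex S"
    and "\<And>t. t \<in> S \<Longrightarrow> \<bar>f' t\<bar> \<le> B" and "u \<in> S" "v \<in> S"
  shows "\<bar>f u - f v\<bar> \<le> B * \<bar>u - v\<bar>"
  using field_differentiable_bound[OF assms(2,1), of B u v] assms(3-5) by auto

lemma bounded_C_lipschitz:
  assumes "bounded_C (Suc r) S f" "convex S"
  obtains L B where "0 \<le> L" "0 \<le> B" "\<And>u. u \<in> S \<Longrightarrow> \<bar>f u\<bar> \<le> B"
    "\<And>u v. u \<in> S \<Longrightarrow> v \<in> S \<Longrightarrow> \<bar>f u - f v\<bar> \<le> L * \<bar>u - v\<bar>"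
proof -
  obtain D where D0: "D 0 = f"
    and D_all: "\<forall>k<Suc r. \<forall>t\<in>S. (D k has_real_derivative D (Suc k) t) (at t within S)"
    and bd_all: "\<forall>k\<le>Suc r. bounded (D k ` S)"
    using assms(1) unfolding bounded_C_def by blast
  have D: "(f has_real_derivative D 1 t) (at t within S)" if "t \<in> S" for t
    using D_all[rule_format, of 0 t] that by (simp add: D0)
  have bd: "bounded (D 0 ` S)" "bounded (D 1 ` S)"
    using bd_all[rule_format, of 0] bd_all[rule_format, of 1] by simp_all
  obtain B where B: "0 < B" "\<forall>z\<in>D 0 ` S. norm z \<le> B" using bd(1) unfolding bounded_pos by blast
  obtain L where L: "0 < L" "\<forall>z\<in>D 1 ` S. norm z \<le> L" using bd(2) unfolding bounded_pos by blast
  show thesis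
  proof (rule that[of L B])
    show "\<bar>f u\<bar> \<le> B" if "u \<in> S" for u using B that by (auto simp: D0)
    show "\<bar>f u - f v\<bar> \<le> L * \<bar>u - v\<bar>" if "u \<in> S" "v \<in> S" for u v
      by (rule bounded_deriv_lipschitz[OF D assms(2) _ that]) (use L in auto)
  qed (use L B in auto)
qed

lemma cond_K_facts:
  assumes "cond_K K"
  obtains R SK LK where "0 < R" "0 \<le> LK" "\<And>v. R \<le> \<bar>v\<bar> \<Longrightarrow> K v = 0" "\<And>v. \<bar>K v\<bar> \<le> SK"
    "\<And>u v. \<bar>K u - K v\<bar> \<le> LK * \<bar>u - v\<bar>"
    "integral {- R..R} K = 1" "integral {- R..R} (\<lambda>v. v\<^sup>2 * K v) = 2 * psi_K K"
    "integral {- R..R} (\<lambda>v. (K v)\<^sup>2) = phi_K K" "0 < phi_K K"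
proof -
  obtain B where B: "0 < B" "\<forall>v\<in>{u. K u \<noteq> 0}. norm v \<le> B"
    using assms unfolding cond_K_def bounded_pos by blast
  obtain LK where LK: "0 < LK" "\<forall>z\<in>range (deriv K). norm z \<le> LK"
    using assms unfolding cond_K_def bounded_pos by blast
  \<comment> \<open>The added 1 makes \<open>K\<close> vanish at the end points as well, since
    \<open>B\<close> is only a bound for the support.\<close>
  define R where "R = B + 1"
  have R: "0 < R" using B by (simp add: R_def)
  have supp: "K v = 0" if "R \<le> \<bar>v\<bar>" for v
  proof (rule ccontr)
    assume "K v \<noteq> 0"
    then have "\<bar>v\<bar> \<le> B" using B by auto
    then show False using that by (simp add: R_def)
  qed
  have lip: "\<bar>K u - K v\<bar> \<le> LK * \<bar>u - v\<bar>" for u v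
  proof (rule bounded_deriv_lipschitz[of UNIV K "deriv K"])
    show "(K has_real_derivative deriv K t) (at t within UNIV)" for t
      using assms by (simp add: cond_K_def field_differentiable_derivI real_differentiable_def DERIV_deriv_iff_real_differentiable)
  qed (use LK in auto)
  have cont: "continuous_on S K" for S
    by (rule lipschitz_on_continuous_on[of LK]) (use lip LK in \<open>auto simp: lipschitz_on_def dist_real_def\<close>)
  \<comment> \<open>A Lipschitz function that vanishes at \<open>R\<close> is bounded on
    \<open>{- R..R}\<close> by its constant times the length \<open>2 * R\<close>.\<close>
  have bound: "\<bar>K v\<bar> \<le> LK * (2 * R)" for v
  proof (cases "\<bar>v\<bar> \<le> R")
    case True
    have "\<bar>K v - K R\<bar> \<le> LK * \<bar>v - R\<bar>" by (rule lip)
    also have "\<dots> \<le> LK * (2 * R)" using True LK by (intro mult_left_mono) auto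
    finally show ?thesis using supp[of R] by simp
  next
    case False
    then show ?thesis using supp LK R by simp
  qed
  have K1: "integral {- R..R} K = 1"
    using lborel_integral_eq_integral[of R K, OF cont supp] assms
      has_bochner_integral_integral_eq[of lborel K 1]
    by (simp add: cond_K_def)
  have K2: "integral {- R..R} (\<lambda>v. v\<^sup>2 * K v) = 2 * psi_K K"
    unfolding psi_K_def by (subst lborel_integral_eq_integral[of R]) (auto intro!: continuous_intros cont simp: supp)
  have K3: "integral {- R..R} (\<lambda>v. (K v)\<^sup>2) = phi_K K"
    unfolding phi_K_def by (subst lborel_integral_eq_integral[of R]) (auto intro!: continuous_intros cont simp: supp)
  have "0 < phi_K K"
  proof -
    \<comment> \<open>Compare \<open>K\<close> with the uniform density \<open>c\<close> on \<open>{- R..R}\<close>.\<close>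
    define c where "c = 1 / (2 * R)"
    have "0 \<le> integral {- R..R} (\<lambda>v. (K v - c)\<^sup>2)"
      by (intro Henstock_Kurzweil_Integration.integral_nonneg integrable_continuous_interval continuous_intros cont) auto
    also have "((\<lambda>v. (K v)\<^sup>2 - 2 * c * K v + c\<^sup>2) has_integral (phi_K K - 2 * c * 1 + (R - (- R)) *\<^sub>R c\<^sup>2)) {- R..R}"
      unfolding K3[symmetric] K1[symmetric]
      by (intro has_integral_add has_integral_diff has_integral_mult_right integrable_integral
          integrable_continuous_interval continuous_intros cont has_integral_const_real[THEN has_integral_eq_rhs])
         (use R in auto)
    then have "integral {- R..R} (\<lambda>v. (K v - c)\<^sup>2) = phi_K K - 2 * c + 2 * R * c\<^sup>2"
      by (simp add: integral_unique power2_diff algebra_simps)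
    also have "\<dots> = phi_K K - 1 / (2 * R)" using R by (simp add: c_def power2_eq_square field_simps)
    finally have "1 / (2 * R) \<le> phi_K K" by simp
    moreover have "0 < 1 / (2 * R)" using R by simp
    ultimately show ?thesis by linarith
  qed
  then show thesis using R LK supp bound lip K1 K2 K3 by (intro that[of R LK "LK * (2 * R)"]) auto
qed

text \<open>The deterministic half of the argument: \<open>F\<close> is an arbitrary Lipschitz
  function with values in the unit interval, to be instantiated by \<open>F_err\<close>. Smoothness
  is asked on \<open>{- 1..1}\<close> because \<open>F\<close> is expanded only around its median
  0.\<close>

locale lad_model = dense_design a b x m X bw
  for a b x :: real and m X bw +
  fixes K \<mu> s F :: "real \<Rightarrow> real" and L :: real
  assumes K: "cond_K K"
    and \<mu>: "bounded_C 4 {a..b} \<mu>" and s: "bounded_C 4 {a..b} s" and s_pos: "(INF t\<in>{a..b}. s t) > 0"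
    and F_C: "bounded_C 4 {- 1..1} F" and F_lip: "\<And>u v. \<bar>F u - F v\<bar> \<le> L * \<bar>u - v\<bar>"
    and F_0: "F 0 = 1 / 2" and F_bounds: "\<And>u. 0 \<le> F u" "\<And>u. F u \<le> 1" and f0: "deriv F 0 > 0"
    and Nb9: "(\<lambda>n. N n * bw n ^ 9) \<longlonglongrightarrow> 0"
begin

definition w :: "nat \<Rightarrow> nat \<times> nat \<Rightarrow> real" where
  "w n \<alpha> = K_bw K (bw n) (X n (fst \<alpha>) (snd \<alpha>) - x)"

text \<open>At a design point \<open>u\<close> with \<open>s u > 0\<close>, an observation is at
  most \<open>\<mu> x + \<Delta>\<close> exactly when its error is at most
  \<open>level \<Delta> u\<close>.\<close>

definition level :: "real \<Rightarrow> real \<Rightarrow> real" where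
  "level \<Delta> u = (\<mu> x + \<Delta> - \<mu> u) / s u"

definition shift :: "real \<Rightarrow> nat \<Rightarrow> real" where
  "shift t n = psi_K K * rho_mu \<mu> s (deriv F) x * (bw n)\<^sup>2 + t / sqrt (N n * bw n)"

definition cut :: "real \<Rightarrow> nat \<Rightarrow> nat \<times> nat \<Rightarrow> real" where
  "cut t n \<alpha> = level (shift t n) (X n (fst \<alpha>) (snd \<alpha>))"

lemma w_nonneg: "0 \<le> w n \<alpha>"
  using K by (simp add: w_def K_bw_def cond_K_def)

lemma L_nonneg: "0 \<le> L"
  using F_lip[of 1 0] by auto

lemma x_mem: "x \<in> {a..b}"
  using x_in by auto

lemma s_lower:
  obtains \<sigma>0 where "0 < \<sigma>0" "\<And>u. u \<in> {a..b} \<Longrightarrow> \<sigma>0 \<le> s u"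
proof (rule that[OF s_pos])
  have 4: "4 = Suc 3" by simp
  obtain L1 B where "0 \<le> L1" "0 \<le> B" and B: "\<And>u. u \<in> {a..b} \<Longrightarrow> \<bar>s u\<bar> \<le> B"
    and "\<And>u v. u \<in> {a..b} \<Longrightarrow> v \<in> {a..b} \<Longrightarrow> \<bar>s u - s v\<bar> \<le> L1 * \<bar>u - v\<bar>"
    by (rule bounded_C_lipschitz[OF s[unfolded 4] convex_real_interval(5)]) blast
  have "- B \<le> s u" if "u \<in> {a..b}" for u
    using B[OF that] by linarith
  then have "bdd_below (s ` {a..b})" by (rule bdd_belowI2)
  then show "(INF t\<in>{a..b}. s t) \<le> s u" if "u \<in> {a..b}" for u
    using that by (rule cINF_lower)
qed

lemma s_gt_0: "u \<in> {a..b} \<Longrightarrow> 0 < s u"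
  by (rule s_lower) (rule less_le_trans)

text \<open>The constant is uniform over \<bar>\<Delta>\<bar> \<le> 1, as required when \<Delta> is
  a shift that moves with \<open>n\<close>.\<close>

lemma level_lipschitz:
  obtains Lc where "0 \<le> Lc" "\<And>\<Delta> u v. \<bar>\<Delta>\<bar> \<le> 1 \<Longrightarrow> u \<in> {a..b} \<Longrightarrow> v \<in> {a..b} \<Longrightarrow>
    \<bar>level \<Delta> u - level \<Delta> v\<bar> \<le> Lc * \<bar>u - v\<bar>"
proof -
  have 4: "4 = Suc 3" by simp
  obtain \<sigma>0 where \<sigma>0: "0 < \<sigma>0" and s_ge: "\<And>u. u \<in> {a..b} \<Longrightarrow> \<sigma>0 \<le> s u" using s_lower by blast
  obtain L1 B1 where L1: "0 \<le> L1" "0 \<le> B1" and \<mu>B: "\<And>u. u \<in> {a..b} \<Longrightarrow> \<bar>\<mu> u\<bar> \<le> B1"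
    and \<mu>L: "\<And>u v. u \<in> {a..b} \<Longrightarrow> v \<in> {a..b} \<Longrightarrow> \<bar>\<mu> u - \<mu> v\<bar> \<le> L1 * \<bar>u - v\<bar>"
    by (rule bounded_C_lipschitz[OF \<mu>[unfolded 4] convex_real_interval(5)]) blast
  obtain L2 B2 where L2: "0 \<le> L2" "0 \<le> B2" and sB: "\<And>u. u \<in> {a..b} \<Longrightarrow> \<bar>s u\<bar> \<le> B2"
    and sL: "\<And>u v. u \<in> {a..b} \<Longrightarrow> v \<in> {a..b} \<Longrightarrow> \<bar>s u - s v\<bar> \<le> L2 * \<bar>u - v\<bar>"
    by (rule bounded_C_lipschitz[OF s[unfolded 4] convex_real_interval(5)]) blast
  show thesis
  proof (rule that[of "L1 / \<sigma>0 + (2 * B1 + 1) * (L2 / (\<sigma>0 * \<sigma>0))"])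
    show "0 \<le> L1 / \<sigma>0 + (2 * B1 + 1) * (L2 / (\<sigma>0 * \<sigma>0))" using L1 L2 \<sigma>0 by simp
    fix \<Delta> u v assume \<Delta>: "\<bar>\<Delta>\<bar> \<le> (1::real)" and u: "u \<in> {a..b}" and v: "v \<in> {a..b}"
    have su: "\<sigma>0 \<le> s u" "\<sigma>0 \<le> s v" using s_ge u v by auto
    then have su0: "0 < s u" "0 < s v" using \<sigma>0 by auto
    have "level \<Delta> u - level \<Delta> v = (\<mu> v - \<mu> u) / s u + (\<mu> x + \<Delta> - \<mu> v) * ((s v - s u) / (s u * s v))"
      using su0 by (simp add: level_def field_simps)
    then have "\<bar>level \<Delta> u - level \<Delta> v\<bar> \<le> \<bar>(\<mu> v - \<mu> u) / s u\<bar> + \<bar>(\<mu> x + \<Delta> - \<mu> v) * ((s v - s u) / (s u * s v))\<bar>"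
      by (simp only: abs_triangle_ineq)
    also have "\<bar>(\<mu> v - \<mu> u) / s u\<bar> \<le> (L1 * \<bar>u - v\<bar>) / \<sigma>0"
      unfolding abs_divide using \<mu>L[OF v u] su su0 \<sigma>0 L1
      by (intro frac_le) (auto simp: abs_minus_commute)
    also have "\<bar>(\<mu> x + \<Delta> - \<mu> v) * ((s v - s u) / (s u * s v))\<bar> \<le> (2 * B1 + 1) * ((L2 * \<bar>u - v\<bar>) / (\<sigma>0 * \<sigma>0))"
      unfolding abs_mult abs_divide
    proof (intro mult_mono frac_le)
      show "\<bar>\<mu> x + \<Delta> - \<mu> v\<bar> \<le> 2 * B1 + 1" using \<mu>B[OF x_mem] \<mu>B[OF v] \<Delta> by linarith
      show "\<bar>s v - s u\<bar> \<le> L2 * \<bar>u - v\<bar>" using sL[OF v u] by (simp add: abs_minus_commute)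
    qed (use su su0 \<sigma>0 L1 L2 in auto)
    finally show "\<bar>level \<Delta> u - level \<Delta> v\<bar> \<le> (L1 / \<sigma>0 + (2 * B1 + 1) * (L2 / (\<sigma>0 * \<sigma>0))) * \<bar>u - v\<bar>"
      by (simp add: algebra_simps add_divide_distrib)
  qed
qed

lemma shift_tendsto_0: "shift t \<longlonglongrightarrow> 0"
proof -
  have "(\<lambda>n. t / sqrt (N n * bw n)) \<longlonglongrightarrow> 0"
    by (intro tendsto_divide_0[OF tendsto_const] filterlim_at_top_imp_at_infinity
        filterlim_compose[OF sqrt_at_top Nbw])
  moreover have "(\<lambda>n. psi_K K * rho_mu \<mu> s (deriv F) x * (bw n)\<^sup>2) \<longlonglongrightarrow> 0"
    using bw_0 by (auto intro!: tendsto_eq_intros)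
  ultimately show ?thesis
    unfolding shift_def[abs_def] by (rule tendsto_add_zero[rotated])
qed

text \<open>The expression equals \<open>sqrt (N n * bw n ^ 9)\<close>. Thus the condition on the
  ninth power of the bandwidth says precisely that a bias of fourth order disappears at the scale of
  the limit theorem.\<close>

lemma sqrt_Nbw_bw4: "(\<lambda>n. sqrt (N n * bw n) * bw n ^ 4) \<longlonglongrightarrow> 0"
proof -
  have "sqrt (N n * bw n) * bw n ^ 4 = sqrt (N n * bw n ^ 9)" for n
  proof -
    have "bw n ^ 4 = sqrt ((bw n ^ 4)\<^sup>2)"
      by (rule real_sqrt_unique[symmetric]) (use bw_pos[of n] in auto)
    then have "sqrt (N n * bw n) * bw n ^ 4 = sqrt (N n * bw n * (bw n ^ 4)\<^sup>2)"
      by (metis real_sqrt_mult)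
    also have "N n * bw n * (bw n ^ 4)\<^sup>2 = N n * bw n ^ 9"
      by (simp add: eval_nat_numeral algebra_simps)
    finally show ?thesis .
  qed
  moreover have "(\<lambda>n. sqrt (N n * bw n ^ 9)) \<longlonglongrightarrow> sqrt 0"
    by (intro tendsto_real_sqrt Nb9)
  ultimately show ?thesis by simp
qed

lemma inverse_sqrt_Nbw: "(\<lambda>n. 1 / sqrt (N n * bw n)) \<longlonglongrightarrow> 0"
  by (intro tendsto_divide_0[OF tendsto_const] filterlim_at_top_imp_at_infinity
        filterlim_compose[OF sqrt_at_top Nbw])

text \<open>The Riemann error is bounded, hence negligible after division by
  \<open>sqrt (N n * bw n)\<close>. The kernel expansion of the integral leaves the drift
  \<open>deriv F 0 / s x * t / sqrt (N n * bw n)\<close>, whose prefactor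
  \<open>N n * bw n / (b - a)\<close> is of exactly the order that makes the normalised mean
  converge.\<close>

lemma mean_limit:
  "(\<lambda>n. (\<Sum>\<alpha>\<in>obs m n. w n \<alpha> * (F (cut t n \<alpha>) - 1 / 2)) / sqrt (N n * bw n))
     \<longlonglongrightarrow> t * deriv F 0 / (s x * (b - a))"
proof -
  obtain R SK LK where R: "0 < R" and LK: "0 \<le> LK" and supp: "\<And>v. R \<le> \<bar>v\<bar> \<Longrightarrow> K v = 0"
    and SK: "\<And>v. \<bar>K v\<bar> \<le> SK" and Klip: "\<And>u v. \<bar>K u - K v\<bar> \<le> LK * \<bar>u - v\<bar>"
    and K1: "integral {- R..R} K = 1" and K2: "integral {- R..R} (\<lambda>v. v\<^sup>2 * K v) = 2 * psi_K K"
    by (rule cond_K_facts[OF K]) blast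
  obtain Lc where Lc: "0 \<le> Lc" and lev: "\<And>\<Delta> u v. \<bar>\<Delta>\<bar> \<le> 1 \<Longrightarrow> u \<in> {a..b} \<Longrightarrow> v \<in> {a..b} \<Longrightarrow>
    \<bar>level \<Delta> u - level \<Delta> v\<bar> \<le> Lc * \<bar>u - v\<bar>"
    by (rule level_lipschitz) blast
  define g where "g \<Delta> u = F (level \<Delta> u) - 1 / 2" for \<Delta> u
  have g_bd: "\<bar>g \<Delta> u\<bar> \<le> 1" for \<Delta> u
    using F_bounds[of "level \<Delta> u"] by (auto simp: g_def abs_le_iff)
  have g_lip: "\<bar>g \<Delta> u - g \<Delta> v\<bar> \<le> (L * Lc) * \<bar>u - v\<bar>" if "\<bar>\<Delta>\<bar> \<le> 1" "u \<in> {a..b}" "v \<in> {a..b}" for \<Delta> u v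
  proof -
    have "\<bar>g \<Delta> u - g \<Delta> v\<bar> \<le> L * \<bar>level \<Delta> u - level \<Delta> v\<bar>" using F_lip by (simp add: g_def)
    also have "\<dots> \<le> L * (Lc * \<bar>u - v\<bar>)" by (intro mult_left_mono lev that L_nonneg)
    finally show ?thesis by (simp add: mult.assoc)
  qed
  have LLc: "0 \<le> L * Lc" using L_nonneg Lc by simp
  have sx: "0 < s x" by (rule s_gt_0[OF x_mem])
  define \<rho> where "\<rho> = rho_mu \<mu> s (deriv F) x"
  define \<kappa> where "\<kappa> = deriv F 0 / s x"
  have "\<exists>a1 a3 b1. expands (\<lambda>h \<Delta>. F ((\<mu> x + \<Delta> - \<mu> (x + h)) / s (x + h)) - F 0)
    0 a1 (- (deriv F 0 / s x) * (rho_mu \<mu> s (deriv F) x / 2)) a3 (deriv F 0 / s x) b1"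
    by (rule expands_location[OF \<mu> s x_in F_C]) (use sx f0 in auto)
  then obtain a1 a3 b1 where ex: "expands (\<lambda>h \<Delta>. g \<Delta> (x + h)) 0 a1 (- \<kappa> * (\<rho> / 2)) a3 \<kappa> b1"
    unfolding g_def level_def F_0 \<rho>_def \<kappa>_def by blast
  define rg where "rg = min 1 (min (x - a) (b - x))"
  have rg: "0 < rg" using x_in by (simp add: rg_def)
  have contg: "continuous_on {- rg..rg} (\<lambda>h. g \<Delta> (x + h))" if "\<bar>\<Delta>\<bar> \<le> rg" for \<Delta>
  proof (rule lipschitz_on_continuous_on[of "L * Lc"], rule lipschitz_onI)
    fix h k assume hk: "h \<in> {- rg..rg}" "k \<in> {- rg..rg}"
    have "\<bar>g \<Delta> (x + h) - g \<Delta> (x + k)\<bar> \<le> (L * Lc) * \<bar>(x + h) - (x + k)\<bar>"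
      by (rule g_lip) (use hk that in \<open>auto simp: rg_def\<close>)
    then show "dist (g \<Delta> (x + h)) (g \<Delta> (x + k)) \<le> L * Lc * dist h k" by (simp add: dist_real_def)
  qed (rule LLc)
  have contK: "continuous_on {- R..R} K"
    by (rule lipschitz_on_continuous_on[of LK]) (use Klip LK in \<open>auto simp: lipschitz_on_def dist_real_def\<close>)
  have Ks: "\<And>v. 0 \<le> K v" "\<And>v. K (- v) = K v" using K by (auto simp: cond_K_def)
  obtain C1 r where r: "0 < r" and C1: "\<And>c \<Delta>. 0 < c \<Longrightarrow> c \<le> r \<Longrightarrow> \<bar>\<Delta>\<bar> \<le> r \<Longrightarrow>
    \<bar>integral {- R..R} (\<lambda>v. K v * g \<Delta> (x + c * v)) - (- \<kappa> * (\<rho> / 2) * c\<^sup>2 * integral {- R..R} (\<lambda>v. v\<^sup>2 * K v) + \<kappa> * \<Delta>)\<bar>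
      \<le> C1 * (c ^ 4 + \<bar>\<Delta>\<bar> * c\<^sup>2 + \<Delta>\<^sup>2)"
    using kernel_expansion[OF ex R contK Ks(1) K1 Ks(2) contg rg] by blast
  obtain C2 where C2: "\<forall>\<^sub>F n in sequentially. \<forall>g.
    (\<forall>u\<in>{a..b}. \<bar>g u\<bar> \<le> 1) \<longrightarrow> (\<forall>u\<in>{a..b}. \<forall>v\<in>{a..b}. \<bar>g u - g v\<bar> \<le> L * Lc * \<bar>u - v\<bar>) \<longrightarrow>
    \<bar>(\<Sum>\<alpha>\<in>obs m n. K_bw K (bw n) (X n (fst \<alpha>) (snd \<alpha>) - x) * g (X n (fst \<alpha>) (snd \<alpha>)))
      - N n * bw n / (b - a) * integral {- R..R} (\<lambda>v. K v * g (x + bw n * v))\<bar> \<le> C2"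
    using kernel_sum_approx[OF R supp SK Klip LK _ LLc, of 1] by auto
  define \<Delta> where "\<Delta> = shift t"
  define q where "q n = sqrt (N n * bw n)" for n
  define S where "S n = (\<Sum>\<alpha>\<in>obs m n. w n \<alpha> * (F (cut t n \<alpha>) - 1 / 2))" for n
  have ev\<Delta>: "\<forall>\<^sub>F n in sequentially. \<bar>\<Delta> n\<bar> \<le> e" if "0 < e" for e
    using tendstoD[OF shift_tendsto_0[of t] that] by (simp add: \<Delta>_def dist_real_def eventually_mono less_imp_le)
  have q2: "q n * q n = N n * bw n" for n using bw_pos[of n] by (simp add: q_def)
  have q_lim: "(\<lambda>n. 1 / q n) \<longlonglongrightarrow> 0" unfolding q_def by (rule inverse_sqrt_Nbw)
  have qb4: "(\<lambda>n. q n * bw n ^ 4) \<longlonglongrightarrow> 0" unfolding q_def by (rule sqrt_Nbw_bw4)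
  \<comment> \<open>The first term is the Riemann error. The others are \<open>q n\<close> times the
    remainder \<open>bw n ^ 4 + \<bar>\<Delta> n\<bar> * (bw n)\<^sup>2 + (\<Delta>
    n)\<^sup>2\<close>, with the bias part and the \<open>t\<close> part of
    \<open>\<Delta> n\<close> estimated separately.\<close>
  define err where "err n = C2 * (1 / q n)
     + \<bar>C1\<bar> / (b - a) * (q n * bw n ^ 4 + (\<bar>psi_K K * \<rho>\<bar> * (q n * bw n ^ 4) + \<bar>t\<bar> * (bw n)\<^sup>2)
        + (2 * (psi_K K * \<rho>)\<^sup>2 * (q n * bw n ^ 4) + 2 * t\<^sup>2 * (1 / q n)))" for n
  have "(\<lambda>n. S n / q n) \<longlonglongrightarrow> t * \<kappa> / (b - a)"
  proof (rule LIM_zero_cancel, rule Lim_null_comparison)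
    show "err \<longlonglongrightarrow> 0"
    proof -
      have "(\<lambda>n. c1 * u n + c2 * (y n + (c3 * y n + c4 * (bw n)\<^sup>2) + (c5 * y n + c6 * u n))) \<longlonglongrightarrow> 0"
        if "u \<longlonglongrightarrow> 0" "y \<longlonglongrightarrow> 0" for u y and c1 c2 c3 c4 c5 c6 :: real
        using that bw_0 by (auto intro!: tendsto_eq_intros)
      from this[OF q_lim qb4] show ?thesis unfolding err_def[abs_def] .
    qed
    show "\<forall>\<^sub>F n in sequentially. norm (S n / q n - t * \<kappa> / (b - a)) \<le> err n"
      using C2 ev\<Delta>[OF zero_less_one] ev\<Delta>[OF r] eventually_bw_le[OF r] eventually_Nbw_ge[of 1]
    proof eventually_elim
      case (elim n)
      have b: "0 < bw n" by (rule bw_pos)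
      have qp: "0 < q n" using elim(5) by (simp add: q_def)
      define J where "J = integral {- R..R} (\<lambda>v. K v * g (\<Delta> n) (x + bw n * v))"
      define E where "E = bw n ^ 4 + \<bar>\<Delta> n\<bar> * (bw n)\<^sup>2 + (\<Delta> n)\<^sup>2"
      have \<Delta>_eq: "\<Delta> n = psi_K K * \<rho> * (bw n)\<^sup>2 + t * (1 / q n)"
        by (simp add: \<Delta>_def shift_def \<rho>_def q_def)
      have "\<bar>(\<Sum>\<alpha>\<in>obs m n. K_bw K (bw n) (X n (fst \<alpha>) (snd \<alpha>) - x) * g (\<Delta> n) (X n (fst \<alpha>) (snd \<alpha>)))
        - N n * bw n / (b - a) * J\<bar> \<le> C2"
        unfolding J_def using elim(1) g_bd g_lip elim(2) by blast
      then have 1: "\<bar>S n - (q n * q n) / (b - a) * J\<bar> \<le> C2"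
        by (simp add: S_def w_def cut_def g_def \<Delta>_def q2)
      have "\<bar>J - (- \<kappa> * (\<rho> / 2) * (bw n)\<^sup>2 * (2 * psi_K K) + \<kappa> * \<Delta> n)\<bar> \<le> C1 * E"
        using C1[OF b elim(4) elim(3)] by (simp add: J_def E_def K2)
      \<comment> \<open>The cancellation of the bias: the second moment of \<open>K\<close> is
        \<open>2 * psi_K K\<close>, and its factor 2 meets the 1/2 in the quadratic coefficient of
        the expansion.\<close>
      moreover have "- \<kappa> * (\<rho> / 2) * (bw n)\<^sup>2 * (2 * psi_K K) + \<kappa> * \<Delta> n = \<kappa> * t / q n"
        by (simp add: \<Delta>_eq algebra_simps)
      moreover have "C1 * E \<le> \<bar>C1\<bar> * E"
        by (rule mult_right_mono[OF abs_ge_self]) (simp add: E_def)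
      ultimately have 2: "\<bar>J - \<kappa> * t / q n\<bar> \<le> \<bar>C1\<bar> * E"
        by linarith
      have "S n / q n - t * \<kappa> / (b - a) = (S n - (q n * q n) / (b - a) * J) / q n + q n / (b - a) * (J - \<kappa> * t / q n)"
      proof -
        have "S0 / q0 - t * \<kappa> / d = (S0 - (q0 * q0) / d * J) / q0 + q0 / d * (J - \<kappa> * t / q0)"
          if "0 < q0" "d \<noteq> 0" for S0 q0 d :: real
          using that by (simp add: field_simps)
        from this[OF qp] show ?thesis using ab by simp
      qed
      then have "\<bar>S n / q n - t * \<kappa> / (b - a)\<bar>
          \<le> \<bar>(S n - (q n * q n) / (b - a) * J) / q n\<bar> + \<bar>q n / (b - a) * (J - \<kappa> * t / q n)\<bar>"
        by (simp only: abs_triangle_ineq)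
      also have "\<bar>(S n - (q n * q n) / (b - a) * J) / q n\<bar> \<le> C2 * (1 / q n)"
        using 1 qp by (simp add: abs_divide divide_right_mono)
      also have "\<bar>q n / (b - a) * (J - \<kappa> * t / q n)\<bar> \<le> q n / (b - a) * (\<bar>C1\<bar> * E)"
        using 2 qp ab by (simp add: abs_mult mult_left_mono divide_right_mono)
      also have "q n / (b - a) * (\<bar>C1\<bar> * E) = \<bar>C1\<bar> / (b - a) * (q n * E)" by simp
      also have "\<dots> \<le> \<bar>C1\<bar> / (b - a) * (q n * bw n ^ 4 + (\<bar>psi_K K * \<rho>\<bar> * (q n * bw n ^ 4) + \<bar>t\<bar> * (bw n)\<^sup>2)
        + (2 * (psi_K K * \<rho>)\<^sup>2 * (q n * bw n ^ 4) + 2 * t\<^sup>2 * (1 / q n)))"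
      proof (rule mult_left_mono)
        have "\<bar>\<Delta> n\<bar> \<le> \<bar>psi_K K * \<rho>\<bar> * (bw n)\<^sup>2 + \<bar>t\<bar> * (1 / q n)"
          unfolding \<Delta>_eq using abs_triangle_ineq[of "psi_K K * \<rho> * (bw n)\<^sup>2" "t * (1 / q n)"] qp
          by (simp add: abs_mult)
        then have "q n * (\<bar>\<Delta> n\<bar> * (bw n)\<^sup>2) \<le> q n * ((\<bar>psi_K K * \<rho>\<bar> * (bw n)\<^sup>2 + \<bar>t\<bar> * (1 / q n)) * (bw n)\<^sup>2)"
          using qp by (intro mult_left_mono mult_right_mono) auto
        also have "\<dots> = \<bar>psi_K K * \<rho>\<bar> * (q n * bw n ^ 4) + \<bar>t\<bar> * (bw n)\<^sup>2"
          using qp by (simp add: field_simps eval_nat_numeral)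
        finally have A: "q n * (\<bar>\<Delta> n\<bar> * (bw n)\<^sup>2) \<le> \<dots>" .
        have sq: "(u + v)\<^sup>2 \<le> 2 * u\<^sup>2 + 2 * v\<^sup>2" for u v :: real
          using sum_squares_bound[of u v] by (simp add: power2_sum)
        have "q n * (\<Delta> n)\<^sup>2 \<le> q n * (2 * (psi_K K * \<rho> * (bw n)\<^sup>2)\<^sup>2 + 2 * (t * (1 / q n))\<^sup>2)"
          unfolding \<Delta>_eq using qp by (intro mult_left_mono sq) auto
        also have "\<dots> = 2 * (psi_K K * \<rho>)\<^sup>2 * (q n * bw n ^ 4) + 2 * t\<^sup>2 * (1 / q n)"
          using qp by (simp add: field_simps eval_nat_numeral)
        finally have B: "q n * (\<Delta> n)\<^sup>2 \<le> \<dots>" .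
        show "q n * E \<le> q n * bw n ^ 4 + (\<bar>psi_K K * \<rho>\<bar> * (q n * bw n ^ 4) + \<bar>t\<bar> * (bw n)\<^sup>2)
        + (2 * (psi_K K * \<rho>)\<^sup>2 * (q n * bw n ^ 4) + 2 * t\<^sup>2 * (1 / q n))"
          using A B by (simp add: E_def distrib_left)
      qed (use ab in simp)
      finally show "norm (S n / q n - t * \<kappa> / (b - a)) \<le> err n"
        by (simp add: err_def)
    qed
  qed
  then show ?thesis unfolding S_def q_def \<kappa>_def by (simp add: field_simps)
qed

end

context lad_model
begin

lemma sum_w_bound:
  obtains C where "0 < C" "\<forall>\<^sub>F n in sequentially. (\<Sum>\<alpha>\<in>obs m n. w n \<alpha>) \<le> C * (N n * bw n)"
proof -
  obtain R SK LK where R: "0 < R" and LK: "0 \<le> LK" and supp: "\<And>v. R \<le> \<bar>v\<bar> \<Longrightarrow> K v = 0"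
    and SK: "\<And>v. \<bar>K v\<bar> \<le> SK" and Klip: "\<And>u v. \<bar>K u - K v\<bar> \<le> LK * \<bar>u - v\<bar>"
    and K1: "integral {- R..R} K = 1"
    by (rule cond_K_facts[OF K]) blast
  obtain C2 where C2: "\<forall>\<^sub>F n in sequentially. \<forall>g.
    (\<forall>u\<in>{a..b}. \<bar>g u\<bar> \<le> 1) \<longrightarrow> (\<forall>u\<in>{a..b}. \<forall>v\<in>{a..b}. \<bar>g u - g v\<bar> \<le> 0 * \<bar>u - v\<bar>) \<longrightarrow>
    \<bar>(\<Sum>\<alpha>\<in>obs m n. K_bw K (bw n) (X n (fst \<alpha>) (snd \<alpha>) - x) * g (X n (fst \<alpha>) (snd \<alpha>)))
      - N n * bw n / (b - a) * integral {- R..R} (\<lambda>v. K v * g (x + bw n * v))\<bar> \<le> C2"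
    using kernel_sum_approx[OF R supp SK Klip LK, of 1 0] by auto
  show thesis
  proof (rule that[of "\<bar>C2\<bar> + 1 / (b - a)"])
    show "0 < \<bar>C2\<bar> + 1 / (b - a)" using ab by (intro add_nonneg_pos) auto
    show "\<forall>\<^sub>F n in sequentially. (\<Sum>\<alpha>\<in>obs m n. w n \<alpha>) \<le> (\<bar>C2\<bar> + 1 / (b - a)) * (N n * bw n)"
      using C2 eventually_Nbw_ge[of 1]
    proof eventually_elim
      case (elim n)
      have "\<bar>(\<Sum>\<alpha>\<in>obs m n. w n \<alpha>) - N n * bw n / (b - a)\<bar> \<le> C2"
        using elim(1)[rule_format, of "\<lambda>_. 1"] by (simp add: w_def K1)
      moreover have "\<bar>C2\<bar> * 1 \<le> \<bar>C2\<bar> * (N n * bw n)" using elim(2) by (intro mult_left_mono) auto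
      ultimately show ?case by (simp add: distrib_right)
    qed
  qed
qed

text \<open>The square of \<open>K\<close> is again a bounded Lipschitz function with the same
  support, so the Riemann approximation applies to it with constant \<open>g\<close>.\<close>

lemma sum_w2_limit: "(\<lambda>n. (\<Sum>\<alpha>\<in>obs m n. (w n \<alpha>)\<^sup>2) / (N n * bw n)) \<longlonglongrightarrow> phi_K K / (b - a)"
proof -
  obtain R SK LK where R: "0 < R" and LK: "0 \<le> LK" and supp: "\<And>v. R \<le> \<bar>v\<bar> \<Longrightarrow> K v = 0"
    and SK: "\<And>v. \<bar>K v\<bar> \<le> SK" and Klip: "\<And>u v. \<bar>K u - K v\<bar> \<le> LK * \<bar>u - v\<bar>"
    and K3: "integral {- R..R} (\<lambda>v. (K v)\<^sup>2) = phi_K K"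
    by (rule cond_K_facts[OF K]) blast
  have SK0: "0 \<le> SK" using SK[of 0] by linarith
  have sq_lip: "\<bar>(K u)\<^sup>2 - (K v)\<^sup>2\<bar> \<le> (2 * SK * LK) * \<bar>u - v\<bar>" for u v
  proof -
    have "\<bar>(K u)\<^sup>2 - (K v)\<^sup>2\<bar> = \<bar>K u + K v\<bar> * \<bar>K u - K v\<bar>"
      by (simp add: power2_eq_square algebra_simps abs_mult[symmetric])
    also have "\<dots> \<le> (2 * SK) * (LK * \<bar>u - v\<bar>)"
      using SK[of u] SK[of v] SK0 by (intro mult_mono Klip) auto
    finally show ?thesis by simp
  qed
  have sq_bound: "\<bar>(K v)\<^sup>2\<bar> \<le> SK\<^sup>2" for v
    using power_mono[OF SK[of v], of 2] by simp
  obtain C2 where C2: "\<forall>\<^sub>F n in sequentially. \<forall>g.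
    (\<forall>u\<in>{a..b}. \<bar>g u\<bar> \<le> 1) \<longrightarrow> (\<forall>u\<in>{a..b}. \<forall>v\<in>{a..b}. \<bar>g u - g v\<bar> \<le> 0 * \<bar>u - v\<bar>) \<longrightarrow>
    \<bar>(\<Sum>\<alpha>\<in>obs m n. K_bw (\<lambda>v. (K v)\<^sup>2) (bw n) (X n (fst \<alpha>) (snd \<alpha>) - x) * g (X n (fst \<alpha>) (snd \<alpha>)))
      - N n * bw n / (b - a) * integral {- R..R} (\<lambda>v. (K v)\<^sup>2 * g (x + bw n * v))\<bar> \<le> C2"
    using kernel_sum_approx[OF R _ sq_bound sq_lip, of 1 0] supp SK0 LK by auto
  have lim: "(\<lambda>n. C2 * (1 / (N n * bw n))) \<longlonglongrightarrow> 0"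
    by (intro tendsto_mult_right_zero tendsto_divide_0[OF tendsto_const] filterlim_at_top_imp_at_infinity Nbw)
  show ?thesis
  proof (rule LIM_zero_cancel, rule Lim_null_comparison[OF _ lim])
    show "\<forall>\<^sub>F n in sequentially. norm ((\<Sum>\<alpha>\<in>obs m n. (w n \<alpha>)\<^sup>2) / (N n * bw n) - phi_K K / (b - a)) \<le> C2 * (1 / (N n * bw n))"
      using C2 eventually_Nbw_ge[of 1]
    proof eventually_elim
      case (elim n)
      have "\<bar>(\<Sum>\<alpha>\<in>obs m n. (w n \<alpha>)\<^sup>2) - N n * bw n / (b - a) * phi_K K\<bar> \<le> C2"
        using elim(1)[rule_format, of "\<lambda>_. 1"] by (simp add: w_def K_bw_def K3)
      then have "\<bar>((\<Sum>\<alpha>\<in>obs m n. (w n \<alpha>)\<^sup>2) - N n * bw n / (b - a) * phi_K K) / (N n * bw n)\<bar> \<le> C2 / (N n * bw n)"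
        using elim(2) unfolding abs_divide by (simp add: divide_right_mono)
      moreover have "(S - q / d * p) / q = S / q - p / d" if "1 \<le> q" for S q d p :: real
        using that by (simp add: diff_divide_distrib)
      note this[OF elim(2)]
      ultimately show ?case by (simp only: real_norm_def mult_1_right times_divide_eq_right)
    qed
  qed
qed

text \<open>A nonzero weight forces the design point within \<open>R * bw n\<close> of
  \<open>x\<close>. There the threshold is uniformly close to 0, so the probability is close to
  \<open>F 0 = 1 / 2\<close> and the Bernoulli variance to 1/4. The family \<open>p\<close> stands
  for the truncated probabilities, which agree with \<open>F\<close> at the threshold only up to
  \<open>e n\<close>.\<close>

lemma variance_limit:
  assumes p: "\<forall>\<^sub>F n in sequentially. \<forall>\<alpha>\<in>obs m n. \<bar>p n \<alpha> - F (cut t n \<alpha>)\<bar> \<le> e n"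
    and e: "e \<longlonglongrightarrow> 0" and p01: "\<And>n \<alpha>. 0 \<le> p n \<alpha>" "\<And>n \<alpha>. p n \<alpha> \<le> 1"
  shows "(\<lambda>n. (\<Sum>\<alpha>\<in>obs m n. (w n \<alpha>)\<^sup>2 * (p n \<alpha> * (1 - p n \<alpha>))) / (N n * bw n)) \<longlonglongrightarrow> phi_K K / (4 * (b - a))"
proof -
  obtain R SK LK where R: "0 < R" and supp: "\<And>v. R \<le> \<bar>v\<bar> \<Longrightarrow> K v = 0"
    by (rule cond_K_facts[OF K]) blast
  obtain Lc where Lc: "0 \<le> Lc" and lev: "\<And>\<Delta> u v. \<bar>\<Delta>\<bar> \<le> 1 \<Longrightarrow> u \<in> {a..b} \<Longrightarrow> v \<in> {a..b} \<Longrightarrow>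
    \<bar>level \<Delta> u - level \<Delta> v\<bar> \<le> Lc * \<bar>u - v\<bar>"
    by (rule level_lipschitz) blast
  define B where "B n = e n + L * (\<bar>shift t n / s x\<bar> + Lc * (R * bw n))" for n
  define W where "W n = (\<Sum>\<alpha>\<in>obs m n. (w n \<alpha>)\<^sup>2) / (N n * bw n)" for n
  have sx: "0 < s x" by (rule s_gt_0[OF x_mem])
  have sh: "(\<lambda>n. \<bar>shift t n / s x\<bar>) \<longlonglongrightarrow> 0"
    using shift_tendsto_0[of t] sx by (auto intro!: tendsto_eq_intros)
  have B: "B \<longlonglongrightarrow> 0"
    unfolding B_def[abs_def] using e bw_0 sh
    by (auto intro!: tendsto_add_zero tendsto_mult_right_zero)
  have W: "W \<longlonglongrightarrow> phi_K K / (b - a)" unfolding W_def[abs_def] by (rule sum_w2_limit)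
  have BW: "(\<lambda>n. B n * W n) \<longlonglongrightarrow> 0" using tendsto_mult[OF B W] by simp
  have "(\<lambda>n. (\<Sum>\<alpha>\<in>obs m n. (w n \<alpha>)\<^sup>2 * (p n \<alpha> * (1 - p n \<alpha>))) / (N n * bw n) - W n / 4) \<longlonglongrightarrow> 0"
  proof (rule Lim_null_comparison[OF _ BW])
    have ev1: "\<forall>\<^sub>F n in sequentially. \<bar>shift t n\<bar> \<le> 1"
      using tendstoD[OF shift_tendsto_0[of t], of 1] by (simp add: dist_real_def eventually_mono less_imp_le)
    show "\<forall>\<^sub>F n in sequentially. norm ((\<Sum>\<alpha>\<in>obs m n. (w n \<alpha>)\<^sup>2 * (p n \<alpha> * (1 - p n \<alpha>))) / (N n * bw n) - W n / 4) \<le> B n * W n"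
      using p ev1 eventually_Nbw_ge[of 1]
    proof eventually_elim
      case (elim n)
      have bound: "(w n \<alpha>)\<^sup>2 * \<bar>p n \<alpha> * (1 - p n \<alpha>) - 1 / 4\<bar> \<le> (w n \<alpha>)\<^sup>2 * B n" if \<alpha>: "\<alpha> \<in> obs m n" for \<alpha>
      proof (cases "w n \<alpha> = 0")
        case False
        define u where "u = X n (fst \<alpha>) (snd \<alpha>)"
        have u: "u \<in> {a..b}" unfolding u_def by (rule X_in[OF \<alpha>])
        have "\<not> R \<le> \<bar>(u - x) / bw n\<bar>" using False supp by (auto simp: w_def K_bw_def u_def)
        then have ux: "\<bar>u - x\<bar> \<le> R * bw n" using bw_pos[of n] by (simp add: abs_divide field_simps)
        have "\<bar>p n \<alpha> - F (cut t n \<alpha>)\<bar> \<le> e n" using elim(1) \<alpha> by blast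
        moreover have "\<bar>F (cut t n \<alpha>) - 1 / 2\<bar> \<le> L * (\<bar>shift t n / s x\<bar> + Lc * (R * bw n))"
        proof -
          have "\<bar>F (cut t n \<alpha>) - F 0\<bar> \<le> L * \<bar>cut t n \<alpha>\<bar>" using F_lip[of "cut t n \<alpha>" 0] by simp
          also have "\<bar>cut t n \<alpha>\<bar> \<le> \<bar>level (shift t n) x\<bar> + \<bar>level (shift t n) u - level (shift t n) x\<bar>"
            by (simp add: cut_def u_def)
          also have "\<dots> \<le> \<bar>shift t n / s x\<bar> + Lc * (R * bw n)"
          proof (rule add_mono)
            have "\<bar>level (shift t n) u - level (shift t n) x\<bar> \<le> Lc * \<bar>u - x\<bar>"
              by (rule lev[OF elim(2) u x_mem])
            also have "\<dots> \<le> Lc * (R * bw n)" by (rule mult_left_mono[OF ux Lc])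
            finally show "\<bar>level (shift t n) u - level (shift t n) x\<bar> \<le> Lc * (R * bw n)" .
          qed (simp add: level_def)
          finally show ?thesis using L_nonneg by (simp add: F_0 mult_left_mono)
        qed
        ultimately have d: "\<bar>p n \<alpha> - 1 / 2\<bar> \<le> B n" unfolding B_def by linarith
        have half: "\<bar>p n \<alpha> - 1 / 2\<bar> \<le> 1" using p01[of n \<alpha>] by linarith
        have "\<bar>p n \<alpha> * (1 - p n \<alpha>) - 1 / 4\<bar> = \<bar>p n \<alpha> - 1 / 2\<bar> * \<bar>p n \<alpha> - 1 / 2\<bar>"
        proof -
          have "p n \<alpha> * (1 - p n \<alpha>) - 1 / 4 = - ((p n \<alpha> - 1 / 2) * (p n \<alpha> - 1 / 2))"
            by (simp add: algebra_simps)
          then show ?thesis by (simp only: abs_minus_cancel abs_mult)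
        qed
        also have "\<dots> \<le> \<bar>p n \<alpha> - 1 / 2\<bar> * 1" by (rule mult_left_mono[OF half]) simp
        finally show ?thesis using d by (intro mult_left_mono) auto
      qed simp
      have eq: "(\<Sum>\<alpha>\<in>obs m n. (w n \<alpha>)\<^sup>2 * (p n \<alpha> * (1 - p n \<alpha>))) / (N n * bw n) - W n / 4
         = (\<Sum>\<alpha>\<in>obs m n. (w n \<alpha>)\<^sup>2 * (p n \<alpha> * (1 - p n \<alpha>) - 1 / 4)) / (N n * bw n)"
        by (simp add: W_def right_diff_distrib sum_subtractf diff_divide_distrib sum_divide_distrib[symmetric])
      have "\<bar>\<Sum>\<alpha>\<in>obs m n. (w n \<alpha>)\<^sup>2 * (p n \<alpha> * (1 - p n \<alpha>) - 1 / 4)\<bar> \<le> (\<Sum>\<alpha>\<in>obs m n. (w n \<alpha>)\<^sup>2 * B n)"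
        by (rule order_trans[OF sum_abs sum_mono]) (use bound in \<open>simp add: abs_mult\<close>)
      then have "\<bar>\<Sum>\<alpha>\<in>obs m n. (w n \<alpha>)\<^sup>2 * (p n \<alpha> * (1 - p n \<alpha>) - 1 / 4)\<bar> / \<bar>N n * bw n\<bar>
         \<le> (\<Sum>\<alpha>\<in>obs m n. (w n \<alpha>)\<^sup>2 * B n) / (N n * bw n)"
        using elim(3) by (simp add: divide_right_mono)
      moreover have "(\<Sum>\<alpha>\<in>obs m n. (w n \<alpha>)\<^sup>2 * B n) / (N n * bw n) = B n * W n"
        unfolding W_def sum_distrib_right[symmetric] by simp
      ultimately show ?case
        unfolding eq real_norm_def abs_divide by (simp only:)
    qed
  qed
  from tendsto_add[OF this tendsto_divide[OF W tendsto_const[of 4]]] show ?thesis by (simp add: mult.commute)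
qed

end

section \<open>Pairs of nearby observations and dependence windows\<close>

lemma m_le_M_obs: "i \<in> {1..n} \<Longrightarrow> m n i \<le> M_obs m n"
  unfolding M_obs_def by (rule Max_ge) auto

lemma finite_near_pairs: "finite (near_pairs m n k \<alpha> h)"
proof (rule finite_subset)
  show "near_pairs m n k \<alpha> h \<subseteq> {1..n} \<times> {0..M_obs m n} \<times> {0..M_obs m n}"
    using m_le_M_obs[of _ n m] by (fastforce simp: near_pairs_def)
qed auto

text \<open>Every ordered pair of distinct neighbours is one of the two orientations of a pair in
  \<open>near_pairs\<close>, and nonnegative weights allow passing to a larger index set. Starting
  at column 1 with \<open>h\<close> at least the longest row makes the block contain all rows
  completely.\<close>

lemma sum_neighbours_le:
  fixes w :: "nat \<times> nat \<Rightarrow> real"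
  assumes w: "\<And>\<alpha>. 0 \<le> w \<alpha>" and h: "M_obs m n \<le> h"
  shows "(\<Sum>\<alpha>\<in>obs m n. \<Sum>\<beta>\<in>{\<beta> \<in> obs m n. fst \<beta> = fst \<alpha> \<and> \<bar>int (snd \<alpha>) - int (snd \<beta>)\<bar> \<le> int k \<and> \<beta> \<noteq> \<alpha>}. w \<alpha> * w \<beta>)
    \<le> 2 * (\<Sum>(i, j1, j2)\<in>near_pairs m n k 1 h. w (i, j1) * w (i, j2))"
proof -
  define NP where "NP = near_pairs m n k 1 h"
  define f where "f p = w (fst p) * w (snd p)" for p
  define q1 q2 :: "nat \<times> nat \<times> nat \<Rightarrow> (nat \<times> nat) \<times> (nat \<times> nat)"
    where "q1 = (\<lambda>(i, j1, j2). ((i, j1), (i, j2)))" and "q2 = (\<lambda>(i, j1, j2). ((i, j2), (i, j1)))"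
  define Q where "Q = Sigma (obs m n) (\<lambda>\<alpha>. {\<beta> \<in> obs m n. fst \<beta> = fst \<alpha> \<and> \<bar>int (snd \<alpha>) - int (snd \<beta>)\<bar> \<le> int k \<and> \<beta> \<noteq> \<alpha>})"
  have fin: "finite NP" unfolding NP_def by (rule finite_near_pairs)
  have f0: "0 \<le> f p" for p using w by (simp add: f_def)
  have sub: "Q \<subseteq> q1 ` NP \<union> q2 ` NP"
  proof
    fix p assume p: "p \<in> Q"
    obtain i j i' j' where pe: "p = ((i, j), (i', j'))" by (cases p) auto
    have i: "i' = i" "j \<noteq> j'" "1 \<le> i" "i \<le> n" "1 \<le> j" "j \<le> m n i" "1 \<le> j'" "j' \<le> m n i"
      and d: "\<bar>int j - int j'\<bar> \<le> int k"
      using p by (auto simp: Q_def pe obs_def)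
    have mh: "m n i \<le> h" using m_le_M_obs[of i n m] i h by auto
    show "p \<in> q1 ` NP \<union> q2 ` NP"
    proof (cases "j < j'")
      case True
      then have "(i, j, j') \<in> NP" using i d mh by (auto simp: NP_def near_pairs_def)
      then have "q1 (i, j, j') \<in> q1 ` NP" by (rule imageI)
      then show ?thesis by (simp add: q1_def pe i)
    next
      case False
      then have "(i, j', j) \<in> NP" using i d mh by (auto simp: NP_def near_pairs_def abs_minus_commute)
      then have "q2 (i, j', j) \<in> q2 ` NP" by (rule imageI)
      then show ?thesis by (simp add: q2_def pe i)
    qed
  qed
  have "(\<Sum>\<alpha>\<in>obs m n. \<Sum>\<beta>\<in>{\<beta> \<in> obs m n. fst \<beta> = fst \<alpha> \<and> \<bar>int (snd \<alpha>) - int (snd \<beta>)\<bar> \<le> int k \<and> \<beta> \<noteq> \<alpha>}. w \<alpha> * w \<beta>)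
     = sum f Q"
    unfolding Q_def by (subst sum.Sigma) (auto simp: f_def case_prod_beta)
  also have "\<dots> \<le> sum f (q1 ` NP \<union> q2 ` NP)"
    by (rule sum_mono2[OF _ sub]) (use fin f0 in auto)
  also have "\<dots> \<le> sum f (q1 ` NP) + sum f (q2 ` NP)"
    by (subst sum.union_inter[symmetric]) (use fin f0 in \<open>auto intro!: sum_nonneg\<close>)
  also have "\<dots> \<le> sum (f \<circ> q1) NP + sum (f \<circ> q2) NP"
    by (intro add_mono sum_image_le fin f0)
  also have "\<dots> = 2 * (\<Sum>(i, j1, j2)\<in>NP. w (i, j1) * w (i, j2))"
    by (simp add: f_def q1_def q2_def comp_def case_prod_beta mult.commute)
  finally show ?thesis by (simp add: NP_def)
qed

definition window :: "nat \<Rightarrow> nat \<times> nat \<Rightarrow> ((int \<times> int) + int) set" where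
  "window k \<alpha> = (\<lambda>l. Inl (int (fst \<alpha>), int (snd \<alpha>) + l)) ` {- int k..int k}"

lemma window_inter:
  "window k \<alpha> \<inter> window k \<beta> \<noteq> {} \<longleftrightarrow> fst \<beta> = fst \<alpha> \<and> \<bar>int (snd \<alpha>) - int (snd \<beta>)\<bar> \<le> int (2 * k)"
proof
  assume "window k \<alpha> \<inter> window k \<beta> \<noteq> {}"
  then show "fst \<beta> = fst \<alpha> \<and> \<bar>int (snd \<alpha>) - int (snd \<beta>)\<bar> \<le> int (2 * k)"
    by (auto simp: window_def)
next
  assume *: "fst \<beta> = fst \<alpha> \<and> \<bar>int (snd \<alpha>) - int (snd \<beta>)\<bar> \<le> int (2 * k)"
  define d where "d = int (snd \<alpha>) - int (snd \<beta>)"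
  \<comment> \<open>The least \<open>l\<close> for which both \<open>l\<close> and
    \<open>l - d\<close> lie between \<open>- k\<close> and \<open>k\<close>; the windows are
    symmetric, so negating both gives a common innovation.\<close>
  define l where "l = max (- int k) (d - int k)"
  define l' where "l' = l - d"
  have d: "\<bar>d\<bar> \<le> 2 * int k" using * by (simp add: d_def)
  have "- l' \<in> {- int k..int k}" "- l \<in> {- int k..int k}"
    using d by (auto simp: l_def l'_def)
  moreover have "int (snd \<alpha>) + - l = int (snd \<beta>) + - l'" by (simp add: l'_def d_def)
  ultimately have "Inl (int (fst \<alpha>), int (snd \<alpha>) + - l) \<in> window k \<alpha>"
    "Inl (int (fst \<alpha>), int (snd \<alpha>) + - l) \<in> window k \<beta>"
    using * unfolding window_def by (metis imageI)+
  then show "window k \<alpha> \<inter> window k \<beta> \<noteq> {}" by blast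
qed

lemma card_window_nbh: "card {\<beta> \<in> obs m n. window k \<alpha> \<inter> window k \<beta> \<noteq> {}} \<le> 4 * k + 1"
proof -
  have "card {\<beta> \<in> obs m n. window k \<alpha> \<inter> window k \<beta> \<noteq> {}}
     \<le> card {int (snd \<alpha>) - int (2 * k)..int (snd \<alpha>) + int (2 * k)}"
  proof (rule card_inj_on_le[of "\<lambda>\<beta>. int (snd \<beta>)"])
    show "inj_on (\<lambda>\<beta>. int (snd \<beta>)) {\<beta> \<in> obs m n. window k \<alpha> \<inter> window k \<beta> \<noteq> {}}"
      by (auto simp: inj_on_def window_inter prod_eq_iff)
    show "(\<lambda>\<beta>. int (snd \<beta>)) ` {\<beta> \<in> obs m n. window k \<alpha> \<inter> window k \<beta> \<noteq> {}}
      \<subseteq> {int (snd \<alpha>) - int (2 * k)..int (snd \<alpha>) + int (2 * k)}"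
      by (auto simp: window_inter abs_le_iff)
  qed simp
  then show ?thesis by simp
qed

section \<open>Limit distribution of the estimator\<close>

locale lad_errors = error_process M \<epsilon> \<epsilon>' G + lad_model a b x m X bw K \<mu> s "F_err M G \<epsilon>" L
  for M :: "'w measure" and \<epsilon> \<epsilon>' G and a b x :: real and m X bw K \<mu> s L +
  fixes \<delta> :: real
  assumes C: "cond_C a b \<delta> m X K bw" and x_\<delta>: "x \<in> {a + \<delta>..b - \<delta>}"
    and log9: "(\<lambda>n. ln (N n) ^ 9 / (N n * bw n)) \<longlonglongrightarrow> 0"
    and nM: "(\<lambda>n. real n * real (M_obs m n)) \<in> O(\<lambda>n. N n)"
begin

lemma truncated_array:
  obtains k y Ct where "\<And>n. 1 \<le> k n" "(\<lambda>n. real (k n)) \<in> O(\<lambda>n. ln (N n))" "0 \<le> Ct"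
    "\<forall>\<^sub>F n in sequentially. \<forall>i j c.
      prob {\<omega> \<in> space M. (err G \<epsilon> i j \<omega> \<le> c) \<noteq> (err_trunc G \<epsilon> (y n) (k n) i j \<omega> \<le> c)} \<le> Ct / (N n)\<^sup>2"
proof -
  obtain Ct r where Ct: "0 \<le> Ct" and r: "0 < r" "r < 1" and tr:
    "\<forall>\<^sub>F k in sequentially. \<exists>y. \<forall>i j c.
      prob {\<omega> \<in> space M. (err G \<epsilon> i j \<omega> \<le> c) \<noteq> (err_trunc G \<epsilon> y k i j \<omega> \<le> c)} \<le> Ct * r ^ k"
    by (rule truncation[OF F_lip]) blast
  \<comment> \<open>This lag makes \<open>r ^ k n \<le> (N n) powr -2\<close>, which beats the number \<open>N n\<close> of indicators.\<close>
  define A where "A = 2 / (- ln r)"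
  have lnr: "ln r < 0" using r by simp
  have A: "0 < A" using lnr by (simp add: A_def divide_pos_neg)
  \<comment> \<open>The added 1 keeps the lag positive for every \<open>n\<close>, as (C)
    demands.\<close>
  define k where "k n = nat \<lceil>A * ln (N n)\<rceil> + 1" for n
  have k_ge: "A * ln (N n) \<le> real (k n)" for n
    unfolding k_def using real_nat_ceiling_ge[of "A * ln (N n)"] by simp
  have k_top: "filterlim k at_top sequentially"
  proof -
    have "filterlim (\<lambda>n. A * ln (N n)) at_top sequentially"
      by (intro filterlim_tendsto_pos_mult_at_top[OF tendsto_const A] filterlim_compose[OF ln_at_top N_real_top])
    then have "filterlim (\<lambda>n. real (k n)) at_top sequentially"
      by (rule filterlim_at_top_mono) (use k_ge in auto)
    then show ?thesis using filterlim_sequentially_iff_filterlim_real by blast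
  qed
  have ev: "\<forall>\<^sub>F n in sequentially. \<exists>y. \<forall>i j c.
      prob {\<omega> \<in> space M. (err G \<epsilon> i j \<omega> \<le> c) \<noteq> (err_trunc G \<epsilon> y (k n) i j \<omega> \<le> c)} \<le> Ct * r ^ k n"
    using k_top tr by (rule filterlim_iff[THEN iffD1, rule_format])
  \<comment> \<open>The choice is meaningful only from the threshold in \<open>ev\<close> onwards;
    for earlier \<open>n\<close> it is an arbitrary sequence.\<close>
  define y where "y n = (SOME y. \<forall>i j c.
      prob {\<omega> \<in> space M. (err G \<epsilon> i j \<omega> \<le> c) \<noteq> (err_trunc G \<epsilon> y (k n) i j \<omega> \<le> c)} \<le> Ct * r ^ k n)" for n
  show thesis
  proof (rule that[of k Ct y])
    show "1 \<le> k n" for n by (simp add: k_def)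
    have "\<forall>\<^sub>F n in sequentially. norm (real (k n)) \<le> (A + 2) * norm (ln (N n))"
      using eventually_N_ge[of "exp 1"]
    proof eventually_elim
      case (elim n)
      have N0: "0 < N n" by (rule less_le_trans[OF exp_gt_zero elim])
      have ln1: "1 \<le> ln (N n)" using ln_mono[OF elim exp_gt_zero] by simp
      have "real (k n) \<le> A * ln (N n) + 2"
        unfolding k_def using A ln1 by (simp add: of_nat_nat) linarith
      then show ?case using ln1 by (simp add: distrib_right)
    qed
    then show "(\<lambda>n. real (k n)) \<in> O(\<lambda>n. ln (N n))" by (rule landau_o.bigI[rotated]) (use A in simp)
    show "\<forall>\<^sub>F n in sequentially. \<forall>i j c.
      prob {\<omega> \<in> space M. (err G \<epsilon> i j \<omega> \<le> c) \<noteq> (err_trunc G \<epsilon> (y n) (k n) i j \<omega> \<le> c)} \<le> Ct / (N n)\<^sup>2"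
      using ev eventually_N_ge[of 1]
    proof eventually_elim
      case (elim n)
      have "r ^ k n = r powr real (k n)" using r by (simp add: powr_realpow)
      also have "\<dots> \<le> r powr (A * ln (N n))" using r k_ge by (intro powr_mono') auto
      also have "\<dots> = exp (- 2 * ln (N n))" using r lnr by (simp add: powr_def A_def)
      also have "\<dots> = 1 / (N n)\<^sup>2"
        using elim(2) by (simp add: exp_minus exp_double inverse_eq_divide)
      finally have rk: "Ct * r ^ k n \<le> Ct / (N n)\<^sup>2" using mult_left_mono[OF _ Ct, of "r ^ k n" "1 / (N n)\<^sup>2"] by simp
      show ?case
        using someI_ex[OF elim(1), folded y_def] rk order_trans by blast
    qed
  qed (rule Ct)
qed

text \<open>(C) is applied with lag \<open>2 * k n\<close>, because two windows of half-width
  \<open>k n\<close> meet up to that distance. Its bound \<open>M n b k \<iota>\<close> becomes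
  \<open>o(N b)\<close> through \<open>n M = O(N)\<close> and the vanishing of
  \<open>k \<iota>\<close>.\<close>

lemma near_sum_limit:
  assumes k1: "\<And>n. 1 \<le> k n" and kO: "(\<lambda>n. real (k n)) \<in> O(\<lambda>n. ln (N n))"
  shows "(\<lambda>n. (\<Sum>(i, j1, j2)\<in>near_pairs m n (2 * k n) 1 (max (2 * k n) (M_obs m n)). w n (i, j1) * w n (i, j2))
     / (N n * bw n)) \<longlonglongrightarrow> 0"
proof -
  have "\<forall>n. 2 * k n \<ge> 1" using k1 by (metis le_trans mult_2 le_add1)
  moreover have "(\<lambda>n. real (2 * k n)) \<in> O(\<lambda>n. ln (N n))" using kO by simp
  ultimately obtain \<iota> C1 where \<iota>: "(\<lambda>n. real (2 * k n) * \<iota> n) \<longlonglongrightarrow> 0"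
    and C1: "\<forall>\<^sub>F n in sequentially. \<forall>\<alpha> h. \<alpha> \<ge> 1 \<and> h \<ge> max (2 * k n) \<alpha> \<longrightarrow>
                 \<bar>\<Sum>(i, j1, j2)\<in>near_pairs m n (2 * k n) \<alpha> h.
                    K_bw K (bw n) (X n i j1 - x) * K_bw K (bw n) (X n i j2 - x)\<bar>
                 \<le> C1 * \<bar>real (min h (M_obs m n)) * real n * bw n * real (2 * k n) * \<iota> n\<bar>"
    using C x_\<delta> unfolding cond_C_def by (auto 0 3 dest!: bspec spec[of _ "\<lambda>n. 2 * k n"])
  obtain C2 where C2: "C2 > 0" and ev2: "\<forall>\<^sub>F n in sequentially. norm (real n * real (M_obs m n)) \<le> C2 * norm (N n)"
    using nM by (elim landau_o.bigE) auto
  \<comment> \<open>The block \<open>\<alpha> = 1\<close>, \<open>h \<ge> M_obs m n\<close> of (C) comprises all observations.\<close>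
  define S where "S n = (\<Sum>(i, j1, j2)\<in>near_pairs m n (2 * k n) 1 (max (2 * k n) (M_obs m n)). w n (i, j1) * w n (i, j2))" for n
  have lim: "(\<lambda>n. \<bar>C1\<bar> * C2 * \<bar>real (2 * k n) * \<iota> n\<bar>) \<longlonglongrightarrow> 0"
    by (rule tendsto_mult_right_zero) (rule tendsto_rabs_zero[OF \<iota>])
  have "(\<lambda>n. S n / (N n * bw n)) \<longlonglongrightarrow> 0"
  proof (rule Lim_null_comparison[OF _ lim])
    show "\<forall>\<^sub>F n in sequentially. norm (S n / (N n * bw n)) \<le> \<bar>C1\<bar> * C2 * \<bar>real (2 * k n) * \<iota> n\<bar>"
      using C1 ev2 eventually_N_ge[of 1]
    proof eventually_elim
      case (elim n)
      define z where "z = \<bar>real (2 * k n) * \<iota> n\<bar>"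
      have b: "0 < bw n" by (rule bw_pos)
      have "\<bar>S n\<bar> \<le> C1 * \<bar>real (min (max (2 * k n) (M_obs m n)) (M_obs m n)) * real n * bw n * real (2 * k n) * \<iota> n\<bar>"
        using elim(1)[rule_format, of 1 "max (2 * k n) (M_obs m n)"] k1[of n]
        by (simp add: S_def w_def case_prod_beta)
      also have "min (max (2 * k n) (M_obs m n)) (M_obs m n) = M_obs m n" by simp
      also have "C1 * \<bar>real (M_obs m n) * real n * bw n * real (2 * k n) * \<iota> n\<bar>
          = C1 * ((real n * real (M_obs m n)) * bw n * z)"
        using b by (simp add: z_def abs_mult mult_ac)
      also have "\<dots> \<le> \<bar>C1\<bar> * ((C2 * N n) * bw n * z)"
        proof (rule mult_mono[OF abs_ge_self])
          have nm: "real n * real (M_obs m n) \<le> C2 * N n" using elim(2) by simp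
          show "real n * real (M_obs m n) * bw n * z \<le> C2 * N n * bw n * z"
            using b by (intro mult_right_mono[OF mult_right_mono[OF nm]]) (simp_all add: z_def)
        qed (use b in \<open>simp_all add: z_def\<close>)
      finally have "\<bar>S n\<bar> \<le> (\<bar>C1\<bar> * C2 * z) * (N n * bw n)" by (simp add: mult_ac)
      then have "\<bar>S n\<bar> / (N n * bw n) \<le> \<bar>C1\<bar> * C2 * z" using elim(3) b by (simp add: divide_le_eq)
      then show ?case using elim(3) b by (simp add: z_def abs_divide abs_mult)
    qed
  qed
  then show ?thesis by (simp add: S_def)
qed

text \<open>The neighbourhood size is \<open>O(log N)\<close>, so every power of it up to the ninth
  is covered by the logarithmic rate assumption.\<close>

lemma window_rate:
  assumes kO: "(\<lambda>n. real (k n)) \<in> O(\<lambda>n. ln (N n))" and j: "j \<le> 9"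
  shows "(\<lambda>n. real (4 * k n + 1) ^ j / (N n * bw n)) \<longlonglongrightarrow> 0"
proof -
  obtain C where C: "C > 0" and ev: "\<forall>\<^sub>F n in sequentially. norm (real (k n)) \<le> C * norm (ln (N n))"
    using kO by (elim landau_o.bigE) auto
  have lim: "(\<lambda>n. (4 * C + 1) ^ j * (ln (N n) ^ 9 / (N n * bw n))) \<longlonglongrightarrow> 0"
    by (rule tendsto_mult_right_zero[OF log9])
  show ?thesis
  proof (rule Lim_null_comparison[OF _ lim])
    show "\<forall>\<^sub>F n in sequentially. norm (real (4 * k n + 1) ^ j / (N n * bw n)) \<le> (4 * C + 1) ^ j * (ln (N n) ^ 9 / (N n * bw n))"
      using ev eventually_N_ge[of "exp 1"] eventually_Nbw_ge[of 1]
    proof eventually_elim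
      case (elim n)
      have N0: "0 < N n" by (rule less_le_trans[OF exp_gt_zero elim(2)])
      have ln1: "1 \<le> ln (N n)" using ln_mono[OF elim(2) exp_gt_zero] by simp
      have "real (4 * k n + 1) \<le> (4 * C + 1) * ln (N n)"
        using elim(1) ln1 by (simp add: distrib_right)
      then have "real (4 * k n + 1) ^ j \<le> ((4 * C + 1) * ln (N n)) ^ j" by (rule power_mono) simp
      also have "\<dots> \<le> (4 * C + 1) ^ j * ln (N n) ^ 9"
        unfolding power_mult_distrib using ln1 C j by (intro mult_left_mono power_increasing) auto
      finally have "real (4 * k n + 1) ^ j / (N n * bw n) \<le> (4 * C + 1) ^ j * ln (N n) ^ 9 / (N n * bw n)"
        using elim(3) by (intro divide_right_mono) auto
      moreover have "norm (real (4 * k n + 1) ^ j / (N n * bw n)) = real (4 * k n + 1) ^ j / (N n * bw n)"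
        unfolding real_norm_def using elim(3) by (intro abs_of_nonneg divide_nonneg_nonneg) auto
      ultimately show ?case by simp
    qed
  qed
qed

text \<open>Limiting standard deviation of the sign statistic divided by \<open>sqrt (N b)\<close>:
  the squared weights contribute \<open>phi_K K / (b - a)\<close> and the indicators the Bernoulli
  variance 1/4.\<close>

definition \<sigma> :: real where
  "\<sigma> = sqrt (phi_K K / (4 * (b - a)))"

lemma \<sigma>_pos: "0 < \<sigma>"
proof -
  have "0 < phi_K K" by (rule cond_K_facts[OF K])
  then show ?thesis using ab by (simp add: \<sigma>_def)
qed

end

section \<open>The sign statistic of the truncated errors at a fixed \<open>t\<close>\<close>

locale truncated_lad = lad_errors M \<epsilon> \<epsilon>' G a b x m X bw K \<mu> s L \<delta>
  for M :: "'w measure" and \<epsilon> \<epsilon>' G and a b x :: real and m X bw K \<mu> s L \<delta> +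
  fixes t :: real and y :: "nat \<Rightarrow> int \<Rightarrow> real" and k :: "nat \<Rightarrow> nat" and Ct :: real
  assumes k1: "\<And>n. 1 \<le> k n" and kO: "(\<lambda>n. real (k n)) \<in> O(\<lambda>n. ln (N n))" and Ct: "0 \<le> Ct"
    and trunc: "\<forall>\<^sub>F n in sequentially. \<forall>i j c.
      prob {\<omega> \<in> space M. (err G \<epsilon> i j \<omega> \<le> c) \<noteq> (err_trunc G \<epsilon> (y n) (k n) i j \<omega> \<le> c)} \<le> Ct / (N n)\<^sup>2"
begin

definition below :: "nat \<Rightarrow> nat \<times> nat \<Rightarrow> 'w set" where
  "below n \<alpha> = {\<omega> \<in> space M. err_trunc G \<epsilon> (y n) (k n) (int (fst \<alpha>)) (int (snd \<alpha>)) \<omega> \<le> cut t n \<alpha>}"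

definition p :: "nat \<Rightarrow> nat \<times> nat \<Rightarrow> real" where
  "p n \<alpha> = prob (below n \<alpha>)"

definition bit :: "nat \<Rightarrow> nat \<times> nat \<Rightarrow> 'w \<Rightarrow> real" where
  "bit n \<alpha> \<omega> = of_bool (err_trunc G \<epsilon> (y n) (k n) (int (fst \<alpha>)) (int (snd \<alpha>)) \<omega> \<le> cut t n \<alpha>)"

text \<open>The sign is chosen so that, up to truncation, the sign statistic is a positive multiple
  of \<open>\<tau> n - Z n\<close>. Its nonnegativity then reads \<open>Z n \<le> \<tau> n\<close>,
  a value of the distribution function of \<open>Z n\<close>.\<close>

definition \<xi> :: "nat \<Rightarrow> nat \<times> nat \<Rightarrow> 'w \<Rightarrow> real" where
  "\<xi> n \<alpha> \<omega> = w n \<alpha> / (\<sigma> * sqrt (N n * bw n)) * (p n \<alpha> - bit n \<alpha> \<omega>)"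

lemma p_bounds: "0 \<le> p n \<alpha>" "p n \<alpha> \<le> 1"
  by (simp_all add: p_def)

lemma bit_measurable [measurable]: "bit n \<alpha> \<in> borel_measurable M"
  unfolding bit_def[abs_def] by measurable

lemma bit_bounds: "0 \<le> bit n \<alpha> \<omega>" "bit n \<alpha> \<omega> \<le> 1"
  by (simp_all add: bit_def)

lemma bit_integrable: "integrable M (bit n \<alpha>)"
  by (rule integrable_const_bound[of _ 1]) (auto simp: bit_def)

lemma expectation_bit: "expectation (bit n \<alpha>) = p n \<alpha>"
proof -
  have "expectation (bit n \<alpha>) = expectation (indicator (below n \<alpha>))"
    by (rule Bochner_Integration.integral_cong) (auto simp: bit_def below_def indicator_def)
  also have "\<dots> = p n \<alpha>" by (simp add: p_def below_def)
  finally show ?thesis .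
qed

lemma expectation_bit_sq: "expectation (\<lambda>\<omega>. (p n \<alpha> - bit n \<alpha> \<omega>)\<^sup>2) = p n \<alpha> * (1 - p n \<alpha>)"
proof -
  have "expectation (\<lambda>\<omega>. (p n \<alpha> - bit n \<alpha> \<omega>)\<^sup>2) = expectation (\<lambda>\<omega>. (p n \<alpha>)\<^sup>2 + (1 - 2 * p n \<alpha>) * bit n \<alpha> \<omega>)"
    by (rule Bochner_Integration.integral_cong) (auto simp: bit_def power2_eq_square algebra_simps)
  also have "\<dots> = (p n \<alpha>)\<^sup>2 + (1 - 2 * p n \<alpha>) * p n \<alpha>"
    using bit_integrable by (simp add: expectation_bit prob_space)
  finally show ?thesis by (simp add: power2_eq_square algebra_simps)
qed

lemma p_close: "\<forall>\<^sub>F n in sequentially. \<forall>\<alpha>\<in>obs m n. \<bar>p n \<alpha> - F_err M G \<epsilon> (cut t n \<alpha>)\<bar> \<le> Ct / (N n)\<^sup>2"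
  using trunc
proof eventually_elim
  case (elim n)
  show ?case
  proof
    fix \<alpha> assume "\<alpha> \<in> obs m n"
    define E1 where "E1 = {\<omega> \<in> space M. err G \<epsilon> (int (fst \<alpha>)) (int (snd \<alpha>)) \<omega> \<le> cut t n \<alpha>}"
    define D1 where "D1 = {\<omega> \<in> space M. (err G \<epsilon> (int (fst \<alpha>)) (int (snd \<alpha>)) \<omega> \<le> cut t n \<alpha>)
        \<noteq> (err_trunc G \<epsilon> (y n) (k n) (int (fst \<alpha>)) (int (snd \<alpha>)) \<omega> \<le> cut t n \<alpha>)}"
    have meas: "E1 \<in> events" "D1 \<in> events" "below n \<alpha> \<in> events"
      unfolding E1_def D1_def below_def by measurable
    have "prob E1 = F_err M G \<epsilon> (cut t n \<alpha>)" unfolding E1_def by (rule prob_err_le)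
    moreover have "prob D1 \<le> Ct / (N n)\<^sup>2" unfolding D1_def using elim by blast
    moreover have "prob E1 \<le> prob (below n \<alpha> \<union> D1)" "prob (below n \<alpha>) \<le> prob (E1 \<union> D1)"
      using meas by (auto intro!: finite_measure_mono simp: E1_def D1_def below_def)
    moreover have "prob (below n \<alpha> \<union> D1) \<le> prob (below n \<alpha>) + prob D1" "prob (E1 \<union> D1) \<le> prob E1 + prob D1"
      using meas by (auto intro!: measure_Un_le)
    ultimately show "\<bar>p n \<alpha> - F_err M G \<epsilon> (cut t n \<alpha>)\<bar> \<le> Ct / (N n)\<^sup>2"
      unfolding p_def by linarith
  qed
qed

lemma \<xi>_abs_le: "\<bar>\<xi> n \<alpha> \<omega>\<bar> \<le> w n \<alpha> / (\<sigma> * sqrt (N n * bw n))"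
proof -
  have A: "\<bar>p n \<alpha> - bit n \<alpha> \<omega>\<bar> \<le> 1" using p_bounds[of n \<alpha>] bit_bounds[of n \<alpha> \<omega>] by linarith
  have B: "0 \<le> w n \<alpha> / (\<sigma> * sqrt (N n * bw n))"
    using w_nonneg \<sigma>_pos bw_pos[of n] by (simp add: less_imp_le)
  show ?thesis
    unfolding \<xi>_def abs_mult abs_of_nonneg[OF B] using mult_left_mono[OF A B] by simp
qed

lemma \<xi>_local_dependence:
  assumes SK: "\<And>v. \<bar>K v\<bar> \<le> SK"
  shows "local_dependence M (innovations \<epsilon> \<epsilon>') (obs m n) (window (k n)) (\<xi> n)
    (\<lambda>\<alpha>. w n \<alpha> / (\<sigma> * sqrt (N n * bw n))) (SK / (\<sigma> * sqrt (N n * bw n))) (4 * k n + 1)"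
proof
  show "indep_vars (\<lambda>_. borel) (innovations \<epsilon> \<epsilon>') UNIV" by (rule indep_innovations)
  show "finite (obs m n)" by simp
  fix \<alpha> \<omega>
  have "depends_on (innovations \<epsilon> \<epsilon>') (window (k n) \<alpha>) (err_trunc G \<epsilon> (y n) (k n) (int (fst \<alpha>)) (int (snd \<alpha>)))"
    unfolding window_def by (rule depends_on_err_trunc[OF G])
  from depends_on_compose[OF this, of "\<lambda>z. w n \<alpha> / (\<sigma> * sqrt (N n * bw n)) * (p n \<alpha> - of_bool (z \<le> cut t n \<alpha>))"]
  show "depends_on (innovations \<epsilon> \<epsilon>') (window (k n) \<alpha>) (\<xi> n \<alpha>)"
    by (simp add: \<xi>_def[abs_def] bit_def)
  have "expectation (\<xi> n \<alpha>) = w n \<alpha> / (\<sigma> * sqrt (N n * bw n)) * (p n \<alpha> - expectation (bit n \<alpha>))"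
    unfolding \<xi>_def[abs_def] using bit_integrable by (simp add: prob_space)
  then show "expectation (\<xi> n \<alpha>) = 0" by (simp add: expectation_bit)
  show "\<bar>\<xi> n \<alpha> \<omega>\<bar> \<le> w n \<alpha> / (\<sigma> * sqrt (N n * bw n))" by (rule \<xi>_abs_le)
  show "w n \<alpha> / (\<sigma> * sqrt (N n * bw n)) \<le> SK / (\<sigma> * sqrt (N n * bw n))"
    using SK[of "(X n (fst \<alpha>) (snd \<alpha>) - x) / bw n"] \<sigma>_pos bw_pos[of n]
    by (intro divide_right_mono) (auto simp: w_def K_bw_def abs_le_iff less_imp_le)
  show "card {\<beta> \<in> obs m n. window (k n) \<alpha> \<inter> window (k n) \<beta> \<noteq> {}} \<le> 4 * k n + 1"
    by (rule card_window_nbh)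
qed

text \<open>The diagonal part tends to 1 by the choice of \<sigma>. The off-diagonal part is
  estimated by absolute values alone, with each covariance at most the product of the two normalised
  weights: it is sparsity of close pairs in the kernel window, supplied by (C), that makes it
  vanish, and no decay of correlations enters.\<close>

lemma covariance_limit:
  "(\<lambda>n. \<Sum>\<alpha>\<in>obs m n. \<Sum>\<beta>\<in>{\<beta> \<in> obs m n. window (k n) \<alpha> \<inter> window (k n) \<beta> \<noteq> {}}.
      expectation (\<lambda>\<omega>. \<xi> n \<alpha> \<omega> * \<xi> n \<beta> \<omega>)) \<longlonglongrightarrow> 1"
proof -
  define c where "c n \<alpha> \<beta> = expectation (\<lambda>\<omega>. \<xi> n \<alpha> \<omega> * \<xi> n \<beta> \<omega>)" for n \<alpha> \<beta>
  define nb where "nb n \<alpha> = {\<beta> \<in> obs m n. fst \<beta> = fst \<alpha> \<and> \<bar>int (snd \<alpha>) - int (snd \<beta>)\<bar> \<le> int (2 * k n) \<and> \<beta> \<noteq> \<alpha>}" for n \<alpha>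
  define V where "V n = (\<Sum>\<alpha>\<in>obs m n. c n \<alpha> \<alpha>)" for n
  define O1 where "O1 n = (\<Sum>\<alpha>\<in>obs m n. \<Sum>\<beta>\<in>nb n \<alpha>. c n \<alpha> \<beta>)" for n
  define q where "q n = N n * bw n" for n
  have split: "(\<Sum>\<alpha>\<in>obs m n. \<Sum>\<beta>\<in>{\<beta> \<in> obs m n. window (k n) \<alpha> \<inter> window (k n) \<beta> \<noteq> {}}. c n \<alpha> \<beta>) = V n + O1 n" for n
  proof -
    have "(\<Sum>\<beta>\<in>{\<beta> \<in> obs m n. window (k n) \<alpha> \<inter> window (k n) \<beta> \<noteq> {}}. c n \<alpha> \<beta>) = c n \<alpha> \<alpha> + (\<Sum>\<beta>\<in>nb n \<alpha>. c n \<alpha> \<beta>)"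
      if "\<alpha> \<in> obs m n" for \<alpha>
    proof -
      have "{\<beta> \<in> obs m n. window (k n) \<alpha> \<inter> window (k n) \<beta> \<noteq> {}} = insert \<alpha> (nb n \<alpha>)"
        using that by (auto simp: window_inter nb_def)
      moreover have "\<alpha> \<notin> nb n \<alpha>" "finite (nb n \<alpha>)" by (auto simp: nb_def)
      ultimately show ?thesis by simp
    qed
    then show ?thesis by (simp add: V_def O1_def sum.distrib)
  qed
  have q0: "0 \<le> q n" for n using bw_pos[of n] by (simp add: q_def less_imp_le)
  have V: "V \<longlonglongrightarrow> 1"
  proof -
    have e: "(\<lambda>n. Ct / (N n)\<^sup>2) \<longlonglongrightarrow> 0"
      by (intro tendsto_divide_0[OF tendsto_const] filterlim_at_top_imp_at_infinity
          filterlim_pow_at_top[OF _ N_real_top]) simp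
    have lim: "(\<lambda>n. (\<Sum>\<alpha>\<in>obs m n. (w n \<alpha>)\<^sup>2 * (p n \<alpha> * (1 - p n \<alpha>))) / (N n * bw n) / \<sigma>\<^sup>2)
        \<longlonglongrightarrow> phi_K K / (4 * (b - a)) / \<sigma>\<^sup>2"
      using \<sigma>_pos by (intro tendsto_divide tendsto_const variance_limit[OF p_close e p_bounds]) auto
    have one: "phi_K K / (4 * (b - a)) / \<sigma>\<^sup>2 = 1"
    proof -
      have "\<sigma>\<^sup>2 = phi_K K / (4 * (b - a))"
        using \<sigma>_pos unfolding \<sigma>_def by (simp add: real_sqrt_gt_0_iff)
      then show ?thesis using \<sigma>_pos by (metis divide_self power_not_zero less_irrefl)
    qed
    have V_eq: "V n = (\<Sum>\<alpha>\<in>obs m n. (w n \<alpha>)\<^sup>2 * (p n \<alpha> * (1 - p n \<alpha>))) / (N n * bw n) / \<sigma>\<^sup>2" for n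
    proof -
      have "c n \<alpha> \<alpha> = (w n \<alpha>)\<^sup>2 * (p n \<alpha> * (1 - p n \<alpha>)) / (\<sigma>\<^sup>2 * q n)" for \<alpha>
      proof -
        have "\<xi> n \<alpha> \<omega> * \<xi> n \<alpha> \<omega> = (w n \<alpha>)\<^sup>2 / (\<sigma>\<^sup>2 * q n) * (p n \<alpha> - bit n \<alpha> \<omega>)\<^sup>2" for \<omega>
        proof -
          have sq: "sqrt (N n * bw n) * sqrt (N n * bw n) = q n" using q0[of n] by (simp add: q_def)
          have "(u / (v * r) * z) * (u / (v * r) * z) = u\<^sup>2 / (v\<^sup>2 * (r * r)) * z\<^sup>2" for u v r z :: real
            by (simp add: power2_eq_square mult_ac)
          from this[of _ _ "sqrt (N n * bw n)"] show ?thesis unfolding sq \<xi>_def .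
        qed
        then show ?thesis unfolding c_def by (simp add: expectation_bit_sq)
      qed
      then show ?thesis by (simp add: V_def q_def sum_divide_distrib mult.commute)
    qed
    show ?thesis using lim unfolding one V_eq[symmetric] .
  qed
  have O1: "O1 \<longlonglongrightarrow> 0"
  proof -
    define S where "S n = (\<Sum>(i, j1, j2)\<in>near_pairs m n (2 * k n) 1 (max (2 * k n) (M_obs m n)). w n (i, j1) * w n (i, j2))" for n
    have lim: "(\<lambda>n. 2 / \<sigma>\<^sup>2 * (S n / (N n * bw n))) \<longlonglongrightarrow> 0"
      unfolding S_def by (rule tendsto_mult_right_zero[OF near_sum_limit[OF k1 kO]])
    show ?thesis
    proof (rule Lim_null_comparison[OF always_eventually lim], rule allI)
      fix n
      have c_le: "\<bar>c n \<alpha> \<beta>\<bar> \<le> w n \<alpha> * w n \<beta> / (\<sigma>\<^sup>2 * q n)" for \<alpha> \<beta>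
      proof -
        have "\<bar>c n \<alpha> \<beta>\<bar> \<le> w n \<alpha> / (\<sigma> * sqrt (N n * bw n)) * (w n \<beta> / (\<sigma> * sqrt (N n * bw n)))"
          unfolding c_def
        proof (rule abs_expectation_le)
          fix \<omega> show "\<bar>\<xi> n \<alpha> \<omega> * \<xi> n \<beta> \<omega>\<bar> \<le> w n \<alpha> / (\<sigma> * sqrt (N n * bw n)) * (w n \<beta> / (\<sigma> * sqrt (N n * bw n)))"
            unfolding abs_mult
            by (rule mult_mono[OF \<xi>_abs_le \<xi>_abs_le order_trans[OF abs_ge_zero \<xi>_abs_le] abs_ge_zero])
        qed
        also have "\<dots> = w n \<alpha> * w n \<beta> / (\<sigma>\<^sup>2 * q n)"
          using q0[of n] by (simp add: q_def power2_eq_square)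
        finally show ?thesis .
      qed
      have "\<bar>O1 n\<bar> \<le> (\<Sum>\<alpha>\<in>obs m n. \<Sum>\<beta>\<in>nb n \<alpha>. w n \<alpha> * w n \<beta> / (\<sigma>\<^sup>2 * q n))"
        unfolding O1_def by (intro order_trans[OF sum_abs] sum_mono order_trans[OF sum_abs sum_mono] c_le)
      also have "\<dots> = (\<Sum>\<alpha>\<in>obs m n. \<Sum>\<beta>\<in>nb n \<alpha>. w n \<alpha> * w n \<beta>) / (\<sigma>\<^sup>2 * q n)"
        by (simp add: sum_divide_distrib)
      also have "\<dots> \<le> 2 * S n / (\<sigma>\<^sup>2 * q n)"
        unfolding nb_def S_def using q0[of n]
        by (intro divide_right_mono sum_neighbours_le w_nonneg) auto
      finally show "norm (O1 n) \<le> 2 / \<sigma>\<^sup>2 * (S n / (N n * bw n))" by (simp add: q_def)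
    qed
  qed
  show ?thesis
    using tendsto_add[OF V O1] unfolding split[symmetric] c_def by simp
qed

end

context truncated_lad
begin

definition Z :: "nat \<Rightarrow> 'w \<Rightarrow> real" where
  "Z n \<omega> = (\<Sum>\<alpha>\<in>obs m n. \<xi> n \<alpha> \<omega>)"

lemma Z_measurable [measurable]: "Z n \<in> borel_measurable M"
  unfolding Z_def[abs_def] \<xi>_def by measurable

lemma clt: "weak_conv_m (\<lambda>n. distr M borel (Z n)) std_normal_distribution"
proof (rule levy_continuity)
  show "real_distribution (distr M borel (Z n))" for n
    by (rule real_distribution_distr) simp
  show "real_distribution std_normal_distribution" by (rule real_dist_normal_dist)
  fix u :: real
  obtain R SK where SK: "\<And>v. \<bar>K v\<bar> \<le> SK" by (rule cond_K_facts[OF K]) blast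
  have SK0: "0 \<le> SK" using SK[of 0] by linarith
  obtain Cw where Cw: "0 < Cw" and w_sum: "\<forall>\<^sub>F n in sequentially. (\<Sum>\<alpha>\<in>obs m n. w n \<alpha>) \<le> Cw * (N n * bw n)"
    by (rule sum_w_bound)
  define S where "S n = (\<Sum>\<alpha>\<in>obs m n. \<Sum>\<beta>\<in>{\<beta> \<in> obs m n. window (k n) \<alpha> \<inter> window (k n) \<beta> \<noteq> {}}.
      expectation (\<lambda>\<omega>. \<xi> n \<alpha> \<omega> * \<xi> n \<beta> \<omega>))" for n
  have S: "(\<lambda>n. \<bar>S n - 1\<bar>) \<longlonglongrightarrow> 0"
    using covariance_limit by (intro tendsto_rabs_zero) (simp add: S_def LIM_zero)
  define d where "d n = real (4 * k n + 1)" for n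
  define c1 where "c1 = 8 * (SK ^ 3 * Cw / \<sigma> ^ 4)"
  define c2 where "c2 = SK\<^sup>2 * Cw / \<sigma> ^ 3"
  define bnd where "bnd n = u\<^sup>2 * (\<bar>S n - 1\<bar> + sqrt (c1 * (d n ^ 3 / (N n * bw n))))
      + \<bar>u\<bar> ^ 3 * (c2 * sqrt (d n ^ 4 / (N n * bw n)))" for n
  have r3: "(\<lambda>n. d n ^ 3 / (N n * bw n)) \<longlonglongrightarrow> 0" and r4: "(\<lambda>n. d n ^ 4 / (N n * bw n)) \<longlonglongrightarrow> 0"
    unfolding d_def by (rule window_rate[OF kO]; simp)+
  have "(\<lambda>n. u\<^sup>2 * (\<bar>S n - 1\<bar> + sqrt (c1 * (d n ^ 3 / (N n * bw n))))
      + \<bar>u\<bar> ^ 3 * (c2 * sqrt (d n ^ 4 / (N n * bw n)))) \<longlonglongrightarrow> u\<^sup>2 * (0 + sqrt (c1 * 0)) + \<bar>u\<bar> ^ 3 * (c2 * sqrt 0)"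
    by (intro tendsto_add tendsto_mult tendsto_const S tendsto_real_sqrt r3 r4)
  then have bnd: "bnd \<longlonglongrightarrow> 0" unfolding bnd_def[abs_def] by simp
  have char_eq: "char (distr M borel (Z n)) u = (\<integral>\<omega>. iexp (u * Z n \<omega>) \<partial>M)" for n
    unfolding char_def by (rule integral_distr) (auto intro!: borel_measurable_continuous_onI continuous_intros)
  have "(\<lambda>n. char (distr M borel (Z n)) u) \<longlonglongrightarrow> complex_of_real (exp (- (u\<^sup>2) / 2))"
  proof (rule LIM_zero_cancel, rule Lim_null_comparison[OF _ bnd])
    show "\<forall>\<^sub>F n in sequentially. norm (char (distr M borel (Z n)) u - complex_of_real (exp (- (u\<^sup>2) / 2))) \<le> bnd n"
      using w_sum eventually_Nbw_ge[of 1]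
    proof eventually_elim
      case (elim n)
      interpret LD: local_dependence M "innovations \<epsilon> \<epsilon>'" "obs m n" "window (k n)" "\<xi> n"
        "\<lambda>\<alpha>. w n \<alpha> / (\<sigma> * sqrt (N n * bw n))" "SK / (\<sigma> * sqrt (N n * bw n))" "4 * k n + 1"
        by (rule \<xi>_local_dependence[OF SK])
      define q where "q = sqrt (N n * bw n)"
      have q: "0 < q" "q\<^sup>2 = N n * bw n" using elim(2) by (simp_all add: q_def)
      define B where "B = SK / (\<sigma> * q)"
      define V where "V = (\<Sum>\<alpha>\<in>obs m n. w n \<alpha> / (\<sigma> * q))"
      have B0: "0 \<le> B" using SK0 \<sigma>_pos q by (simp add: B_def)
      have d0: "0 \<le> d n" by (simp add: d_def)
      have V: "V \<le> Cw * q / \<sigma>"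
      proof -
        have "V = (\<Sum>\<alpha>\<in>obs m n. w n \<alpha>) / (\<sigma> * q)" by (simp add: V_def sum_divide_distrib)
        also have "\<dots> \<le> (Cw * q\<^sup>2) / (\<sigma> * q)"
          using elim(1) \<sigma>_pos q by (intro divide_right_mono) auto
        also have "\<dots> = Cw * q / \<sigma>" using q(1) by (simp add: power2_eq_square)
        finally show ?thesis .
      qed
      have b1: "8 * d n ^ 3 * B ^ 3 * V \<le> c1 * (d n ^ 3 / (N n * bw n))"
      proof -
        have "8 * d n ^ 3 * B ^ 3 * V \<le> 8 * d n ^ 3 * B ^ 3 * (Cw * q / \<sigma>)"
          using V B0 d0 by (intro mult_left_mono) auto
        also have "\<dots> = c1 * (d n ^ 3 / q\<^sup>2)"
          using q \<sigma>_pos by (simp add: c1_def B_def field_simps eval_nat_numeral)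
        finally show ?thesis by (simp add: q)
      qed
      have b2: "(d n * B)\<^sup>2 * V \<le> c2 * sqrt (d n ^ 4 / (N n * bw n))"
      proof -
        have "(d n * B)\<^sup>2 * V \<le> (d n * B)\<^sup>2 * (Cw * q / \<sigma>)"
          using V by (intro mult_left_mono) auto
        also have "\<dots> = c2 * ((d n)\<^sup>2 / q)"
          using q \<sigma>_pos by (simp add: c2_def B_def field_simps eval_nat_numeral)
        also have "(d n)\<^sup>2 / q = sqrt (d n ^ 4 / (N n * bw n))"
        proof -
          have "sqrt (d n ^ 4) = (d n)\<^sup>2" by (rule real_sqrt_unique) (simp_all add: d0)
          then show ?thesis by (simp add: real_sqrt_divide q_def)
        qed
        finally show ?thesis .
      qed
      have "norm ((\<integral>\<omega>. iexp (u * Z n \<omega>) \<partial>M) - complex_of_real (exp (- (u\<^sup>2) / 2)))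
        \<le> u\<^sup>2 * (\<bar>S n - 1\<bar> + sqrt (8 * d n ^ 3 * B ^ 3 * V)) + \<bar>u\<bar> ^ 3 * ((d n * B)\<^sup>2 * V)"
        using LD.clt_bound[of u] unfolding Z_def[symmetric] S_def[symmetric] d_def[symmetric]
          q_def[symmetric] B_def[symmetric] V_def[symmetric] .
      also have "\<dots> \<le> bnd n"
        unfolding bnd_def using b1 b2 by (intro add_mono mult_left_mono) auto
      finally show ?case unfolding char_eq .
    qed
  qed
  then show "(\<lambda>n. char (distr M borel (Z n)) u) \<longlonglongrightarrow> char std_normal_distribution u"
    by (simp add: char_std_normal_distribution)
qed

definition \<tau> :: "nat \<Rightarrow> real" where
  "\<tau> n = (\<Sum>\<alpha>\<in>obs m n. w n \<alpha> * (p n \<alpha> - 1 / 2)) / (\<sigma> * sqrt (N n * bw n))"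

text \<open>\<open>mean_limit\<close> concerns \<open>F_err\<close> at the thresholds, whereas
  \<tau> is centred at the truncated probabilities. Their difference is at most
  \<open>Ct / (N n)\<^sup>2\<close> per observation and the total weight is of order
  \<open>(q n)\<^sup>2\<close>, so after division by \<open>q n \<le> N n\<close> the discrepancy is
  \<open>O(1 / N n)\<close>.\<close>

lemma \<tau>_limit: "\<tau> \<longlonglongrightarrow> t * deriv (F_err M G \<epsilon>) 0 / (s x * (b - a)) / \<sigma>"
proof -
  obtain Cw where Cw: "0 < Cw" and w_sum: "\<forall>\<^sub>F n in sequentially. (\<Sum>\<alpha>\<in>obs m n. w n \<alpha>) \<le> Cw * (N n * bw n)"
    by (rule sum_w_bound)
  define q where "q n = sqrt (N n * bw n)" for n
  define A where "A n = (\<Sum>\<alpha>\<in>obs m n. w n \<alpha> * (F_err M G \<epsilon> (cut t n \<alpha>) - 1 / 2)) / q n" for n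
  define D where "D n = (\<Sum>\<alpha>\<in>obs m n. w n \<alpha> * (p n \<alpha> - F_err M G \<epsilon> (cut t n \<alpha>))) / q n" for n
  have A: "A \<longlonglongrightarrow> t * deriv (F_err M G \<epsilon>) 0 / (s x * (b - a))"
    unfolding A_def[abs_def] q_def by (rule mean_limit)
  have D: "D \<longlonglongrightarrow> 0"
  proof (rule Lim_null_comparison)
    show "(\<lambda>n. Cw * Ct * (1 / N n)) \<longlonglongrightarrow> 0"
      by (intro tendsto_mult_right_zero tendsto_divide_0[OF tendsto_const] filterlim_at_top_imp_at_infinity N_real_top)
    show "\<forall>\<^sub>F n in sequentially. norm (D n) \<le> Cw * Ct * (1 / N n)"
      using w_sum p_close eventually_N_ge[of 1] eventually_Nbw_ge[of 1] eventually_bw_le[OF zero_less_one]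
    proof eventually_elim
      case (elim n)
      have q: "0 < q n" "q n * q n = N n * bw n" using elim(4) by (simp_all add: q_def)
      have qN: "q n \<le> N n"
      proof (rule power2_le_imp_le)
        have "N n * bw n \<le> N n * N n" using elim(3,5) bw_pos[of n] by (intro mult_left_mono) auto
        then show "(q n)\<^sup>2 \<le> (N n)\<^sup>2" using q by (simp add: power2_eq_square)
      qed simp
      have "\<bar>\<Sum>\<alpha>\<in>obs m n. w n \<alpha> * (p n \<alpha> - F_err M G \<epsilon> (cut t n \<alpha>))\<bar> \<le> (\<Sum>\<alpha>\<in>obs m n. w n \<alpha> * (Ct / (N n)\<^sup>2))"
      proof (rule order_trans[OF sum_abs sum_mono])
        fix \<alpha> assume "\<alpha> \<in> obs m n"
        then have "\<bar>p n \<alpha> - F_err M G \<epsilon> (cut t n \<alpha>)\<bar> \<le> Ct / (N n)\<^sup>2" using elim(2) by blast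
        then show "\<bar>w n \<alpha> * (p n \<alpha> - F_err M G \<epsilon> (cut t n \<alpha>))\<bar> \<le> w n \<alpha> * (Ct / (N n)\<^sup>2)"
          unfolding abs_mult abs_of_nonneg[OF w_nonneg] by (rule mult_left_mono) (rule w_nonneg)
      qed
      also have "\<dots> = (\<Sum>\<alpha>\<in>obs m n. w n \<alpha>) * (Ct / (N n)\<^sup>2)" by (rule sum_distrib_right[symmetric])
      also have "\<dots> \<le> (Cw * (q n * q n)) * (Ct / (N n)\<^sup>2)"
        using elim(1) Ct unfolding q by (intro mult_right_mono) auto
      also have "\<dots> = (Cw * Ct * (q n / (N n)\<^sup>2)) * q n" by simp
      finally have "\<bar>\<Sum>\<alpha>\<in>obs m n. w n \<alpha> * (p n \<alpha> - F_err M G \<epsilon> (cut t n \<alpha>))\<bar> / q n \<le> Cw * Ct * (q n / (N n)\<^sup>2)"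
        using q by (simp add: pos_divide_le_eq)
      also have "\<dots> \<le> Cw * Ct * (1 / N n)"
      proof (rule mult_left_mono)
        have "q n / (N n)\<^sup>2 \<le> N n / (N n)\<^sup>2" by (rule divide_right_mono[OF qN]) simp
        then show "q n / (N n)\<^sup>2 \<le> 1 / N n"
          using elim(3) by (cases "N_obs m n = 0") (simp_all add: power2_eq_square)
      qed (use Cw Ct in simp)
      finally show ?case using q by (simp add: D_def abs_divide)
    qed
  qed
  have eq: "\<tau> n = (A n + D n) / \<sigma>" for n
  proof -
    have "(\<Sum>\<alpha>\<in>obs m n. w n \<alpha> * (p n \<alpha> - 1 / 2))
      = (\<Sum>\<alpha>\<in>obs m n. w n \<alpha> * (F_err M G \<epsilon> (cut t n \<alpha>) - 1 / 2)) + (\<Sum>\<alpha>\<in>obs m n. w n \<alpha> * (p n \<alpha> - F_err M G \<epsilon> (cut t n \<alpha>)))"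
      unfolding sum.distrib[symmetric] by (rule sum.cong) (auto simp: algebra_simps)
    then show ?thesis by (simp add: \<tau>_def A_def D_def q_def add_divide_distrib mult.commute)
  qed
  have "(\<lambda>n. (A n + D n) / \<sigma>) \<longlonglongrightarrow> (t * deriv (F_err M G \<epsilon>) 0 / (s x * (b - a)) + 0) / \<sigma>"
    using \<sigma>_pos by (intro tendsto_divide tendsto_add A D tendsto_const) simp
  then show ?thesis by (simp add: eq[abs_def])
qed

definition mismatch :: "nat \<Rightarrow> 'w set" where
  "mismatch n = (\<Union>\<alpha>\<in>obs m n. {\<omega> \<in> space M. (err G \<epsilon> (int (fst \<alpha>)) (int (snd \<alpha>)) \<omega> \<le> cut t n \<alpha>)
      \<noteq> (err_trunc G \<epsilon> (y n) (k n) (int (fst \<alpha>)) (int (snd \<alpha>)) \<omega> \<le> cut t n \<alpha>)})"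

lemma mismatch_measurable [measurable]: "mismatch n \<in> events"
  unfolding mismatch_def by measurable

lemma prob_mismatch: "(\<lambda>n. prob (mismatch n)) \<longlonglongrightarrow> 0"
proof (rule Lim_null_comparison)
  show "(\<lambda>n. Ct * (1 / N n)) \<longlonglongrightarrow> 0"
    by (intro tendsto_mult_right_zero tendsto_divide_0[OF tendsto_const] filterlim_at_top_imp_at_infinity N_real_top)
  show "\<forall>\<^sub>F n in sequentially. norm (prob (mismatch n)) \<le> Ct * (1 / N n)"
    using trunc eventually_N_ge[of 1]
  proof eventually_elim
    case (elim n)
    have "prob (mismatch n) \<le> (\<Sum>\<alpha>\<in>obs m n. prob {\<omega> \<in> space M. (err G \<epsilon> (int (fst \<alpha>)) (int (snd \<alpha>)) \<omega> \<le> cut t n \<alpha>)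
      \<noteq> (err_trunc G \<epsilon> (y n) (k n) (int (fst \<alpha>)) (int (snd \<alpha>)) \<omega> \<le> cut t n \<alpha>)})"
      unfolding mismatch_def by (rule finite_measure_subadditive_finite) auto
    also have "\<dots> \<le> (\<Sum>\<alpha>\<in>obs m n. Ct / (N n)\<^sup>2)"
      by (intro sum_mono) (use elim(1) in blast)
    also have "\<dots> = Ct * (1 / N n)" using elim(2) by (simp add: card_obs power2_eq_square)
    finally show ?case by simp
  qed
qed

text \<open>Off the mismatch event the truncated indicators are the true ones, because the scale is
  positive and an observation lies below the location exactly when its error lies below
  \<open>cut\<close>. Centring at the truncated probabilities then separates mean and
  fluctuation.\<close>

lemma sign_statistic:
  assumes \<omega>: "\<omega> \<in> space M - mismatch n" and pos: "0 < N n * bw n"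
  shows "(\<Sum>\<alpha>\<in>obs m n. w n \<alpha> * (of_bool (Y_obs \<mu> s X G \<epsilon> n (fst \<alpha>) (snd \<alpha>) \<omega> \<le> \<mu> x + shift t n) - 1 / 2))
    = \<sigma> * sqrt (N n * bw n) * (\<tau> n - Z n \<omega>)"
proof -
  have q: "0 < \<sigma> * sqrt (N n * bw n)" using \<sigma>_pos pos by simp
  have cancel: "c * (r / c) = r" if "0 < c" for c r :: real using that by simp
  have iff: "Y_obs \<mu> s X G \<epsilon> n (fst \<alpha>) (snd \<alpha>) \<omega> \<le> \<mu> x + shift t n \<longleftrightarrow>
      err_trunc G \<epsilon> (y n) (k n) (int (fst \<alpha>)) (int (snd \<alpha>)) \<omega> \<le> cut t n \<alpha>" if \<alpha>: "\<alpha> \<in> obs m n" for \<alpha>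
  proof -
    have "0 < s (X n (fst \<alpha>) (snd \<alpha>))" by (rule s_gt_0[OF X_in[OF \<alpha>]])
    then have "Y_obs \<mu> s X G \<epsilon> n (fst \<alpha>) (snd \<alpha>) \<omega> \<le> \<mu> x + shift t n \<longleftrightarrow>
        err G \<epsilon> (int (fst \<alpha>)) (int (snd \<alpha>)) \<omega> \<le> cut t n \<alpha>"
      by (simp add: Y_obs_def cut_def level_def pos_le_divide_eq mult.commute algebra_simps)
    then show ?thesis using \<omega> \<alpha> by (auto simp: mismatch_def)
  qed
  have "(\<Sum>\<alpha>\<in>obs m n. w n \<alpha> * (of_bool (Y_obs \<mu> s X G \<epsilon> n (fst \<alpha>) (snd \<alpha>) \<omega> \<le> \<mu> x + shift t n) - 1 / 2))
     = (\<Sum>\<alpha>\<in>obs m n. w n \<alpha> * (bit n \<alpha> \<omega> - 1 / 2))"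
    by (rule sum.cong) (auto simp: bit_def iff)
  also have "\<dots> = (\<Sum>\<alpha>\<in>obs m n. w n \<alpha> * (p n \<alpha> - 1 / 2)) - (\<Sum>\<alpha>\<in>obs m n. w n \<alpha> * (p n \<alpha> - bit n \<alpha> \<omega>))"
    unfolding sum_subtractf[symmetric] by (rule sum.cong) (auto simp: algebra_simps)
  also have "(\<Sum>\<alpha>\<in>obs m n. w n \<alpha> * (p n \<alpha> - 1 / 2)) = \<sigma> * sqrt (N n * bw n) * \<tau> n"
    unfolding \<tau>_def by (rule cancel[OF q, symmetric])
  also have "(\<Sum>\<alpha>\<in>obs m n. w n \<alpha> * (p n \<alpha> - bit n \<alpha> \<omega>)) = \<sigma> * sqrt (N n * bw n) * Z n \<omega>"
  proof -
    have "\<xi> n \<alpha> \<omega> = w n \<alpha> * (p n \<alpha> - bit n \<alpha> \<omega>) / (\<sigma> * sqrt (N n * bw n))" for \<alpha>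
      by (simp add: \<xi>_def)
    then show ?thesis
      unfolding Z_def by (simp only: sum_divide_distrib[symmetric] cancel[OF q])
  qed
  finally show ?thesis by (simp add: right_diff_distrib)
qed

text \<open>When the sign statistic is exactly zero, a minimiser may lie on either side of the
  location. The event for the estimator therefore implies only \<open>Z n \<le> \<tau> n\<close>,
  while it is guaranteed only by \<open>Z n < \<tau> n\<close>; the lower bound is accordingly
  restricted to \<open>z < \<tau> n\<close>.\<close>

lemma estimator_sandwich:
  assumes meas: "muhat \<in> borel_measurable M"
    and min: "\<And>\<omega>. \<omega> \<in> space M \<Longrightarrow>
      is_arg_min (LAD_loss m X K bw (\<lambda>n i j. Y_obs \<mu> s X G \<epsilon> n i j \<omega>) n x) (\<lambda>_. True) (muhat \<omega>)"
    and pos: "0 < N n * bw n"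
  shows "prob {\<omega> \<in> space M. muhat \<omega> \<le> \<mu> x + shift t n} \<le> cdf (distr M borel (Z n)) (\<tau> n) + prob (mismatch n)"
    and "z < \<tau> n \<Longrightarrow> cdf (distr M borel (Z n)) z \<le> prob {\<omega> \<in> space M. muhat \<omega> \<le> \<mu> x + shift t n} + prob (mismatch n)"
proof -
  let ?T = "\<lambda>\<omega>. \<Sum>\<alpha>\<in>obs m n. w n \<alpha> * (of_bool (Y_obs \<mu> s X G \<epsilon> n (fst \<alpha>) (snd \<alpha>) \<omega> \<le> \<mu> x + shift t n) - 1 / 2)"
  let ?A = "{\<omega> \<in> space M. muhat \<omega> \<le> \<mu> x + shift t n}"
  have loss: "LAD_loss m X K bw (\<lambda>n i j. Y_obs \<mu> s X G \<epsilon> n i j \<omega>) n x \<theta>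
    = (\<Sum>\<alpha>\<in>obs m n. \<bar>Y_obs \<mu> s X G \<epsilon> n (fst \<alpha>) (snd \<alpha>) \<omega> - \<theta>\<bar> * w n \<alpha>)" for \<omega> \<theta>
    unfolding LAD_loss_def w_def
    by (rule sum_obs[symmetric, where f="\<lambda>i j. \<bar>Y_obs \<mu> s X G \<epsilon> n i j \<omega> - \<theta>\<bar> * K_bw K (bw n) (X n i j - x)"])
  have min': "(\<Sum>\<alpha>\<in>obs m n. \<bar>Y_obs \<mu> s X G \<epsilon> n (fst \<alpha>) (snd \<alpha>) \<omega> - muhat \<omega>\<bar> * w n \<alpha>)
      \<le> (\<Sum>\<alpha>\<in>obs m n. \<bar>Y_obs \<mu> s X G \<epsilon> n (fst \<alpha>) (snd \<alpha>) \<omega> - \<theta>\<bar> * w n \<alpha>)" if "\<omega> \<in> space M" for \<omega> \<theta>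
    using min[OF that] unfolding is_arg_min_def loss by (auto simp: not_less)
  have q: "0 < \<sigma> * sqrt (N n * bw n)" using \<sigma>_pos pos by simp
  have cdf: "cdf (distr M borel (Z n)) z = prob {\<omega> \<in> space M. Z n \<omega> \<le> z}" for z
    unfolding cdf_def by (subst measure_distr) (auto simp: vimage_def Int_def conj_commute)
  have sets: "?A \<in> events" "\<And>z. {\<omega> \<in> space M. Z n \<omega> \<le> z} \<in> events"
    using meas by measurable
  have "?A \<subseteq> {\<omega> \<in> space M. Z n \<omega> \<le> \<tau> n} \<union> mismatch n"
  proof
    fix \<omega> assume \<omega>: "\<omega> \<in> ?A"
    show "\<omega> \<in> {\<omega> \<in> space M. Z n \<omega> \<le> \<tau> n} \<union> mismatch n"
    proof (cases "\<omega> \<in> mismatch n")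
      case False
      have "0 \<le> ?T \<omega>"
        by (rule weighted_median_ge[OF _ w_nonneg min']) (use \<omega> in auto)
      then have "0 \<le> \<tau> n - Z n \<omega>"
        using sign_statistic[of \<omega> n] \<omega> False pos q by (simp add: zero_le_mult_iff)
      then show ?thesis using \<omega> by simp
    qed simp
  qed
  then have "prob ?A \<le> prob ({\<omega> \<in> space M. Z n \<omega> \<le> \<tau> n} \<union> mismatch n)"
    by (intro finite_measure_mono) (use sets in auto)
  also have "\<dots> \<le> prob {\<omega> \<in> space M. Z n \<omega> \<le> \<tau> n} + prob (mismatch n)"
    by (intro measure_Un_le) (use sets in auto)
  finally show "prob ?A \<le> cdf (distr M borel (Z n)) (\<tau> n) + prob (mismatch n)" by (simp add: cdf)
  assume z: "z < \<tau> n"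
  have "{\<omega> \<in> space M. Z n \<omega> \<le> z} \<subseteq> ?A \<union> mismatch n"
  proof
    fix \<omega> assume \<omega>: "\<omega> \<in> {\<omega> \<in> space M. Z n \<omega> \<le> z}"
    show "\<omega> \<in> ?A \<union> mismatch n"
    proof (cases "\<omega> \<in> mismatch n")
      case False
      have "0 < \<tau> n - Z n \<omega>" using \<omega> z by simp
      then have "0 < ?T \<omega>"
        using sign_statistic[of \<omega> n] \<omega> False pos q by (simp add: zero_less_mult_iff)
      then have "muhat \<omega> \<le> \<mu> x + shift t n"
        by (intro weighted_median_le[OF w_nonneg min']) (use \<omega> in auto)
      then show ?thesis using \<omega> by simp
    qed simp
  qed
  then have "prob {\<omega> \<in> space M. Z n \<omega> \<le> z} \<le> prob (?A \<union> mismatch n)"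
    by (intro finite_measure_mono) (use sets in auto)
  also have "\<dots> \<le> prob ?A + prob (mismatch n)"
    by (intro measure_Un_le) (use sets in auto)
  finally show "cdf (distr M borel (Z n)) z \<le> prob ?A + prob (mismatch n)" by (simp add: cdf)
qed

end

text \<open>The argument \<tau> moves with \<open>n\<close>, whereas convergence of \<open>H\<close>
  is known only at fixed points. Monotonicity traps the moving argument between two fixed points
  near \<tau>0, and continuity of \<Phi> closes the gap. Choosing the lower point strictly below
  \<tau> matches the strict lower bound.\<close>

lemma cdf_sandwich_limit:
  fixes H :: "nat \<Rightarrow> real \<Rightarrow> real" and \<Phi> :: "real \<Rightarrow> real"
  assumes H: "\<And>z. (\<lambda>n. H n z) \<longlonglongrightarrow> \<Phi> z" and mono: "\<And>n u v. u \<le> v \<Longrightarrow> H n u \<le> H n v"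
    and \<Phi>: "isCont \<Phi> \<tau>0" and \<tau>: "\<tau> \<longlonglongrightarrow> \<tau>0" and d: "d \<longlonglongrightarrow> 0"
    and up: "\<forall>\<^sub>F n in sequentially. P n \<le> H n (\<tau> n) + d n"
    and low: "\<forall>\<^sub>F n in sequentially. \<forall>z<\<tau> n. H n z \<le> P n + d n"
  shows "P \<longlonglongrightarrow> \<Phi> \<tau>0"
proof (rule LIMSEQ_I)
  fix r :: real assume r: "0 < r"
  obtain e where e: "0 < e" and cont: "\<And>z. \<bar>z - \<tau>0\<bar> < e \<Longrightarrow> \<bar>\<Phi> z - \<Phi> \<tau>0\<bar> < r / 4"
    using \<Phi>[unfolded continuous_at_eps_delta, rule_format, of "r / 4"] r
    unfolding dist_real_def by auto
  define z1 z2 where "z1 = \<tau>0 - e / 2" and "z2 = \<tau>0 + e / 2"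
  have z: "\<bar>\<Phi> z1 - \<Phi> \<tau>0\<bar> < r / 4" "\<bar>\<Phi> z2 - \<Phi> \<tau>0\<bar> < r / 4"
    unfolding z1_def z2_def using e by (intro cont; simp)+
  have ev: "\<forall>\<^sub>F n in sequentially. \<bar>H n z - \<Phi> z\<bar> < r / 4" for z
    using tendstoD[OF H[of z], of "r / 4"] r by (simp add: dist_real_def)
  have ev\<tau>: "\<forall>\<^sub>F n in sequentially. \<bar>\<tau> n - \<tau>0\<bar> < e / 2"
    using tendstoD[OF \<tau>, of "e / 2"] e by (simp add: dist_real_def)
  have evd: "\<forall>\<^sub>F n in sequentially. \<bar>d n\<bar> < r / 4"
    using tendstoD[OF d, of "r / 4"] r by (simp add: dist_real_def)
  have "\<forall>\<^sub>F n in sequentially. \<bar>P n - \<Phi> \<tau>0\<bar> < r"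
    using ev[of z1] ev[of z2] ev\<tau> evd up low
  proof eventually_elim
    case (elim n)
    have \<tau>n: "z1 < \<tau> n" "\<tau> n \<le> z2" using elim(3) unfolding z1_def z2_def abs_less_iff by linarith+
    have "P n \<le> H n z2 + d n" using elim(5) mono[OF \<tau>n(2), of n] by linarith
    moreover have "H n z1 \<le> P n + d n" using elim(6) \<tau>n(1) by blast
    ultimately show ?case using elim(1,2,4) z by linarith
  qed
  then show "\<exists>n0. \<forall>n\<ge>n0. norm (P n - \<Phi> \<tau>0) < r" by (simp add: eventually_sequentially)
qed

lemma cdf_normal:
  assumes "0 < \<sigma>"
  shows "cdf (density lborel (normal_density 0 \<sigma>)) t = cdf std_normal_distribution (t / \<sigma>)"
proof -
  let ?M = "density lborel (normal_density 0 \<sigma>)"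
  interpret prob_space ?M by (rule prob_space_normal_density[OF assms])
  have "distributed ?M lborel (\<lambda>x. x) (normal_density 0 \<sigma>)"
    unfolding distributed_def by (simp add: distr_id2)
  then have "distributed ?M lborel (\<lambda>x. (x - 0) / \<sigma>) std_normal_density"
    by (subst (asm) normal_standard_normal_convert[OF assms])
  then have "distr ?M lborel (\<lambda>x. x / \<sigma>) = std_normal_distribution"
    by (simp add: distributed_def)
  then have "cdf std_normal_distribution (t / \<sigma>) = measure (distr ?M lborel (\<lambda>x. x / \<sigma>)) {..t / \<sigma>}"
    by (simp add: cdf_def)
  also have "\<dots> = measure ?M ((\<lambda>x. x / \<sigma>) -` {..t / \<sigma>} \<inter> space ?M)"
    by (rule measure_distr) auto
  also have "(\<lambda>x. x / \<sigma>) -` {..t / \<sigma>} \<inter> space ?M = {..t}"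
    using assms by (auto simp: divide_le_cancel)
  finally show ?thesis by (simp add: cdf_def)
qed

lemma isCont_cdf_std_normal: "isCont (cdf std_normal_distribution) z"
proof -
  interpret real_distribution std_normal_distribution by (rule real_dist_normal_dist)
  have "emeasure std_normal_distribution {z} = 0"
    by (subst emeasure_density) (auto intro!: nn_integral_0_iff_AE[THEN iffD2] AE_I'[of "{z}"] simp: null_sets_def indicator_def)
  then have "measure std_normal_distribution {z} = 0" by (simp add: measure_def)
  then show ?thesis by (simp add: isCont_cdf)
qed

lemma (in lad_errors) estimator_limit:
  assumes meas: "\<And>n. muhat n \<in> borel_measurable M"
    and min: "\<And>n \<omega>. \<omega> \<in> space M \<Longrightarrow>
      is_arg_min (LAD_loss m X K bw (\<lambda>n i j. Y_obs \<mu> s X G \<epsilon> n i j \<omega>) n x) (\<lambda>_. True) (muhat n \<omega>)"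
  shows "(\<lambda>n. prob {\<omega> \<in> space M. muhat n \<omega> \<le> \<mu> x + shift t n})
    \<longlonglongrightarrow> cdf std_normal_distribution (t * deriv (F_err M G \<epsilon>) 0 / (s x * (b - a)) / \<sigma>)"
proof -
  obtain k y Ct where k1: "\<And>n. 1 \<le> k n" and kO: "(\<lambda>n. real (k n)) \<in> O(\<lambda>n. ln (N n))" and Ct: "0 \<le> Ct"
    and trunc: "\<forall>\<^sub>F n in sequentially. \<forall>i j c.
      prob {\<omega> \<in> space M. (err G \<epsilon> i j \<omega> \<le> c) \<noteq> (err_trunc G \<epsilon> (y n) (k n) i j \<omega> \<le> c)} \<le> Ct / (N n)\<^sup>2"
    by (rule truncated_array) blast
  interpret T: truncated_lad M \<epsilon> \<epsilon>' G a b x m X bw K \<mu> s L \<delta> t y k Ct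
    by unfold_locales (rule k1 kO Ct trunc)+
  have clt: "(\<lambda>n. cdf (distr M borel (T.Z n)) z) \<longlonglongrightarrow> cdf std_normal_distribution z" for z
    using T.clt isCont_cdf_std_normal by (simp add: weak_conv_m_def weak_conv_def)
  show ?thesis
  proof (rule cdf_sandwich_limit[OF clt _ isCont_cdf_std_normal T.\<tau>_limit T.prob_mismatch])
    show "cdf (distr M borel (T.Z n)) u \<le> cdf (distr M borel (T.Z n)) v" if "u \<le> v" for n u v
    proof -
      interpret D: real_distribution "distr M borel (T.Z n)" by (rule real_distribution_distr) simp
      show ?thesis by (rule D.cdf_nondecreasing[OF that])
    qed
    show "\<forall>\<^sub>F n in sequentially. prob {\<omega> \<in> space M. muhat n \<omega> \<le> \<mu> x + shift t n}
        \<le> cdf (distr M borel (T.Z n)) (T.\<tau> n) + prob (T.mismatch n)"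
      using eventually_Nbw_ge[of 1]
      by eventually_elim (rule T.estimator_sandwich(1)[OF meas min]; simp)
    show "\<forall>\<^sub>F n in sequentially. \<forall>z<T.\<tau> n. cdf (distr M borel (T.Z n)) z
        \<le> prob {\<omega> \<in> space M. muhat n \<omega> \<le> \<mu> x + shift t n} + prob (T.mismatch n)"
      using eventually_Nbw_ge[of 1]
      by eventually_elim (intro allI impI T.estimator_sandwich(2)[OF meas min]; simp)
  qed
qed

theorem corollary4p1:
  fixes M :: "'w measure"
    and \<epsilon> :: "int \<Rightarrow> int \<Rightarrow> 'w \<Rightarrow> real" and \<epsilon>' :: "int \<Rightarrow> 'w \<Rightarrow> real"
    and G :: "(int \<Rightarrow> real) \<Rightarrow> real"
    and m :: "nat \<Rightarrow> nat \<Rightarrow> nat" and X :: "nat \<Rightarrow> nat \<Rightarrow> nat \<Rightarrow> real"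
    and K \<mu> s :: "real \<Rightarrow> real" and bw :: "nat \<Rightarrow> real"
    and muhat :: "nat \<Rightarrow> real \<Rightarrow> 'w \<Rightarrow> real"
    and a b \<delta> x :: real
  assumes "prob_space M"
    and "iid_innovations M \<epsilon> \<epsilon>'"
    and "G \<in> borel_measurable (PiM UNIV (\<lambda>_. borel))"
    and "F_err M G \<epsilon> 0 = 1 / 2"
    and "F_err M G \<epsilon> 1 - F_err M G \<epsilon> (- 1) = 1 / 2"
    and "\<forall>u. F_err M G \<epsilon> differentiable (at u)"
    and "a < b" and "\<delta> > 0" and "\<forall>n. bw n > 0"
    and "filterlim (N_obs m) at_top sequentially"
    and "cond_D M G \<epsilon> \<epsilon>'"
    and "cond_X a b m X"
    and "cond_K K"
    and "cond_S a b \<mu> s (f_err M G \<epsilon>)"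
    and "cond_C a b \<delta> m X K bw"
    and "bw \<longlonglongrightarrow> 0"
    and "(\<lambda>n. ln (real (N_obs m n)) ^ 3 / (real (N_obs m n) * bw n)) \<longlonglongrightarrow> 0"
    and "(\<lambda>n. ln (real (N_obs m n)) ^ 9 / (real (N_obs m n) * bw n)
               + real (N_obs m n) * bw n ^ 9) \<longlonglongrightarrow> 0"
    and "(\<lambda>n. real n * real (M_obs m n)) \<in> O(\<lambda>n. real (N_obs m n))"
    and "filterlim (\<lambda>n. real n * bw n) at_top sequentially"
    and "(\<lambda>n. ln (real (N_obs m n))) \<in> O(\<lambda>n. sqrt (real (M_obs m n)))"
    and "x \<in> {a + \<delta>..b - \<delta>}"
    and "\<forall>n. muhat n x \<in> borel_measurable M"
    and "\<forall>n. \<forall>\<omega>\<in>space M.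
           is_arg_min (LAD_loss m X K bw (\<lambda>n i j. Y_obs \<mu> s X G \<epsilon> n i j \<omega>) n x)
             (\<lambda>_. True) (muhat n x \<omega>)"
  shows "weak_conv_m
      (\<lambda>n. distr M borel (\<lambda>\<omega>. sqrt (real (N_obs m n) * bw n) *
             (muhat n x \<omega> - \<mu> x - psi_K K * rho_mu \<mu> s (f_err M G \<epsilon>) x * (bw n)\<^sup>2)))
      (density lborel (normal_density 0
         (sqrt (phi_K K * (b - a) * (s x)\<^sup>2 / (4 * (f_err M G \<epsilon> 0)\<^sup>2)))))"
proof -
  note M = assms(1) and iid = assms(2) and G = assms(3) and F0 = assms(4)
    and F_diff = assms(6) and ab = assms(7) and \<delta> = assms(8) and bw = assms(9) and N_top = assms(10)
    and D = assms(11) and X = assms(12) and K = assms(13) and S = assms(14) and C = assms(15)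
    and bw0 = assms(16) and rate = assms(18) and nM = assms(19)
    and x = assms(22) and meas = assms(23) and argmin = assms(24)
  define F where "F = F_err M G \<epsilon>"
  define f where "f = f_err M G \<epsilon>"
  have f: "f = deriv F" by (simp add: f_def F_def f_err_def)
  define N where "N n = real (N_obs m n)" for n
  interpret EP: error_process M \<epsilon> \<epsilon>' G
    by (rule error_process.intro[OF M error_process_axioms.intro[OF iid G D]])
  have DF: "(F has_real_derivative f u) (at u)" for u
    using F_diff unfolding f F_def by (simp add: DERIV_deriv_iff_real_differentiable)
  have f_C: "bounded_C 4 UNIV f" using S by (simp add: cond_S_def f_def)
  then obtain Df where Df0: "Df 0 = f"
    and Df_all: "\<forall>k<4. \<forall>u\<in>UNIV. (Df k has_real_derivative Df (Suc k) u) (at u)"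
    and Df_bd: "\<forall>k\<le>4. bounded (range (Df k))"
    unfolding bounded_C_def by blast
  have Df: "(Df k has_real_derivative Df (Suc k) u) (at u)" if "k < 4" for k u
    using Df_all that by blast
  have "bounded (range (Df 0))" using Df_bd by blast
  then obtain L where L: "\<forall>z\<in>range (Df 0). norm z \<le> L" unfolding bounded_iff by blast
  have F_lip: "\<bar>F u - F v\<bar> \<le> L * \<bar>u - v\<bar>" for u v
    by (rule bounded_deriv_lipschitz[of UNIV F f]) (use DF L Df0 in auto)
  interpret FD: real_distribution "distr M borel (err G \<epsilon> 0 0)"
    by (rule EP.real_distribution_distr) simp
  have F_01: "0 \<le> F u" "F u \<le> 1" for u
    unfolding F_def F_err_def by (simp_all add: FD.cdf_nonneg FD.cdf_bounded_prob)
  have F_C: "bounded_C 4 {- 1..1} F"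
  proof -
    \<comment> \<open>The derivatives of the distribution function are those of the density shifted
      by one order; order 0 is \<open>F\<close> itself, bounded as a probability.\<close>
    define D' where "D' k = (case k of 0 \<Rightarrow> F | Suc j \<Rightarrow> Df j)" for k
    have "(D' k has_real_derivative D' (Suc k) u) (at u within {- 1..1})" if "k < 4" for k u
      using that DF[of u] Df[of "k - 1" u]
      by (cases k) (auto simp: D'_def Df0 intro: has_field_derivative_at_within)
    moreover have "bounded (D' k ` {- 1..1})" if "k \<le> 4" for k
    proof (cases k)
      case 0
      have "bounded (D' 0 ` {- 1..1})"
        by (rule boundedI[of _ 1]) (use F_01 in \<open>auto simp: D'_def abs_le_iff intro: order_trans[of _ 0]\<close>)
      then show ?thesis using 0 by simp
    next
      case (Suc j)
      then show ?thesis
        using Df_bd[rule_format, of j] that by (auto simp: D'_def intro: bounded_subset)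
    qed
    ultimately show ?thesis
      unfolding bounded_C_def by (intro exI[of _ D']) (auto simp: D'_def)
  qed
  have f0: "f 0 > 0" using S by (simp add: cond_S_def f_def)
  \<comment> \<open>For an empty design the claim rests on the convention that \<open>ln 0\<close>
    is 0.\<close>
  have N1: "ln (N n) \<ge> 0" for n
    by (cases "N_obs m n = 0") (auto simp: N_def)
  \<comment> \<open>Both summands of the rate condition are nonnegative, so each is dominated by
    their sum.\<close>
  have log9: "(\<lambda>n. ln (N n) ^ 9 / (N n * bw n)) \<longlonglongrightarrow> 0"
    and Nb9: "(\<lambda>n. N n * bw n ^ 9) \<longlonglongrightarrow> 0"
  proof -
    have 0: "0 \<le> ln (N n) ^ 9 / (N n * bw n)" "0 \<le> N n * bw n ^ 9" for n
      using N1[of n] bw[rule_format, of n] by (simp_all add: N_def)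
    note lim = rate[folded N_def]
    show "(\<lambda>n. ln (N n) ^ 9 / (N n * bw n)) \<longlonglongrightarrow> 0"
      by (rule Lim_null_comparison[OF always_eventually lim], rule allI)
        (metis 0 abs_of_nonneg le_add_same_cancel1 real_norm_def)
    show "(\<lambda>n. N n * bw n ^ 9) \<longlonglongrightarrow> 0"
      by (rule Lim_null_comparison[OF always_eventually lim], rule allI)
        (metis 0 abs_of_nonneg le_add_same_cancel2 real_norm_def)
  qed
  have N_real: "filterlim N at_top sequentially"
    unfolding N_def[abs_def] by (rule filterlim_compose[OF filterlim_real_sequentially N_top])
  \<comment> \<open>Once \<open>ln (N n) \<ge> 1\<close> and the logarithmic rate is below 1,
    \<open>ln (N n) \<le> ln (N n) ^ 9 \<le> N n * bw n\<close>, and the left side diverges.\<close>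
  have Nbw: "filterlim (\<lambda>n. N n * bw n) at_top sequentially"
  proof (rule filterlim_at_top_mono[OF filterlim_compose[OF ln_at_top N_real]])
    have "\<forall>\<^sub>F n in sequentially. exp 1 \<le> N n" using N_real by (simp add: filterlim_at_top)
    moreover have "\<forall>\<^sub>F n in sequentially. ln (N n) ^ 9 / (N n * bw n) < 1"
      using order_tendstoD(2)[OF log9, of 1] by simp
    ultimately show "\<forall>\<^sub>F n in sequentially. ln (N n) \<le> N n * bw n"
    proof eventually_elim
      case (elim n)
      have N0: "0 < N n" by (rule less_le_trans[OF exp_gt_zero elim(1)])
      have ln1: "1 \<le> ln (N n)" using ln_mono[OF elim(1) exp_gt_zero] by simp
      have "ln (N n) ^ 1 \<le> ln (N n) ^ 9" by (rule power_increasing) (use ln1 in auto)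
      also have "\<dots> \<le> N n * bw n"
        using elim(2) N0 bw[rule_format, of n] by (simp add: divide_less_eq)
      finally show ?case by simp
    qed
  qed
  have ax: "a < x" "x < b" using x \<delta> by auto
  have \<mu>: "bounded_C 4 {a..b} \<mu>" and s: "bounded_C 4 {a..b} s" and s_pos: "(INF t\<in>{a..b}. s t) > 0"
    using S by (auto simp: cond_S_def)
  interpret LE: lad_errors M \<epsilon> \<epsilon>' G a b x m X bw K \<mu> s L \<delta>
  proof unfold_locales
    show "deriv (F_err M G \<epsilon>) 0 > 0" using f0 by (simp add: f F_def)
  qed (use ab ax bw bw0 Nbw N_top X K \<mu> s s_pos F_C F_lip F0 F_01 Nb9 C x log9 nM in \<open>simp_all add: N_def F_def\<close>)
  have sx: "0 < s x" by (rule LE.s_gt_0[OF LE.x_mem])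
  define \<sigma>' where "\<sigma>' = sqrt (phi_K K * (b - a) * (s x)\<^sup>2 / (4 * (f 0)\<^sup>2))"
  \<comment> \<open>The limit of \<tau> is \<open>t * f 0 / (s x * (b - a) * \<sigma>)\<close>.
    Reading it as \<open>t / \<sigma>'\<close> fixes the standard deviation, and one factor
    \<open>b - a\<close> survives because \<open>\<sigma>\<^sup>2\<close> contains its
    inverse.\<close>
  have \<sigma>': "\<sigma>' = s x * (b - a) * LE.\<sigma> / f 0"
  proof (unfold \<sigma>'_def, rule real_sqrt_unique)
    have "LE.\<sigma>\<^sup>2 = phi_K K / (4 * (b - a))"
      using LE.\<sigma>_pos unfolding LE.\<sigma>_def by simp
    then show "(s x * (b - a) * LE.\<sigma> / f 0)\<^sup>2 = phi_K K * (b - a) * (s x)\<^sup>2 / (4 * (f 0)\<^sup>2)"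
      using ab f0 by (simp add: power_mult_distrib power_divide) (simp add: power2_eq_square field_simps)
    show "0 \<le> s x * (b - a) * LE.\<sigma> / f 0" using sx ab LE.\<sigma>_pos f0 by simp
  qed
  have \<sigma>'_pos: "0 < \<sigma>'" unfolding \<sigma>' using sx ab LE.\<sigma>_pos f0 by simp
  define W where "W n \<omega> = sqrt (real (N_obs m n) * bw n) *
     (muhat n x \<omega> - \<mu> x - psi_K K * rho_mu \<mu> s f x * (bw n)\<^sup>2)" for n \<omega>
  have W_meas: "W n \<in> borel_measurable M" for n
    unfolding W_def[abs_def]
    by (intro borel_measurable_times borel_measurable_diff borel_measurable_const) (use meas in blast)
  have "(\<lambda>n. cdf (distr M borel (W n)) t) \<longlonglongrightarrow> cdf (density lborel (normal_density 0 \<sigma>')) t" for t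
  proof -
    have lim: "(\<lambda>n. measure M {\<omega> \<in> space M. muhat n x \<omega> \<le> \<mu> x + LE.shift t n})
      \<longlonglongrightarrow> cdf (density lborel (normal_density 0 \<sigma>')) t"
    proof -
      have "t * deriv (F_err M G \<epsilon>) 0 / (s x * (b - a)) / LE.\<sigma> = t / \<sigma>'"
        unfolding \<sigma>' f F_def by simp
      then show ?thesis
        using LE.estimator_limit[of "\<lambda>n. muhat n x" t] meas argmin
        unfolding cdf_normal[OF \<sigma>'_pos] by simp
    qed
    have "\<forall>\<^sub>F n in sequentially. measure M {\<omega> \<in> space M. muhat n x \<omega> \<le> \<mu> x + LE.shift t n} = cdf (distr M borel (W n)) t"
      using LE.eventually_Nbw_ge[of 1]
    proof eventually_elim
      case (elim n)
      have q: "0 < sqrt (real (N_obs m n) * bw n)" using elim by simp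
      have "W n \<omega> \<le> t \<longleftrightarrow> muhat n x \<omega> \<le> \<mu> x + LE.shift t n" for \<omega>
      proof -
        have "W n \<omega> \<le> t \<longleftrightarrow> muhat n x \<omega> - \<mu> x - psi_K K * rho_mu \<mu> s f x * (bw n)\<^sup>2 \<le> t / sqrt (real (N_obs m n) * bw n)"
          unfolding W_def pos_le_divide_eq[OF q] by (simp add: mult.commute)
        also have "\<dots> \<longleftrightarrow> muhat n x \<omega> \<le> \<mu> x + LE.shift t n"
          unfolding LE.shift_def f F_def by (simp only: diff_le_eq) (simp add: algebra_simps)
        finally show ?thesis .
      qed
      then show ?case
        unfolding cdf_def by (subst measure_distr[OF W_meas]) (auto simp: vimage_def Int_def conj_commute)
    qed
    then show ?thesis by (rule Lim_transform_eventually[OF lim])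
  qed
  then have "weak_conv_m (\<lambda>n. distr M borel (W n)) (density lborel (normal_density 0 \<sigma>'))"
    unfolding weak_conv_m_def weak_conv_def by blast
  then show ?thesis unfolding W_def[abs_def] \<sigma>'_def f_def .
qed

end
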